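(* Let $k$ be an infinite field of characteristic not $2$, let $l/k$ be a normal and separable extension field, and let $$i\colon \mathrm{Gal}(l/k) \hookrightarrow U_{\mathrm{ds}} \subset G_{\max} \cong W(E_6) \subset S_{27}$$ be an injective group homomorphism. Then there exists a nonsingular cubic surface $S$ over $k$ such that (i) the $27$ lines on $S$ are defined over $l$ and each $\sigma \in \mathrm{Gal}(l/k)$ permutes them as described by $i(\sigma) \in U_{\mathrm{ds}} \subset S_{27}$; (ii) $S$ is $k$-unirational.
   Context: A nonsingular cubic surface over an algebraically closed (or separably closed) field contains exactly $27$ lines. The maximal group of permutations of the $27$ lines respecting the intersection pairing is, up to permutation isomorphism, a fixed subgroup $G_{\max} \subset S_{27}$, isomorphic to the Weyl group $W(E_6)$ of order $51840$. A double-six is a configuration of twelve lines $E_1,\dots,E_6,E'_1,\dots,E'_6$ such that $E_1,\dots,E_6$ are mutually skew, $E'_1,\dots,E'_6$ are mutually skew, $E_i \cdot E'_j = 1$ for $i \neq j$, and $E_i \cdot E'_i = 0$ for $i = 1,\dots,6$. Every nonsingular cubic surface contains exactly $36$ double-sixes, acted upon transitively by $G_{\max}$. The subgroup $U_{\mathrm{ds}} \subset G_{\max}$ is the stabiliser of a double-six; it has index $36$. That $\sigma$ permutes the lines as described by $i(\sigma)$ means that there is a numbering of the $27$ lines by $\{1,\dots,27\}$, carrying the group of permutations respecting the intersection pairing to $G_{\max}$, under which each $\sigma \in \mathrm{Gal}(l/k)$ acts as $i(\sigma)$. A surface $S$ is $k$-unirational if there is a dominant rational map over $k$ from a projective space to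 $S$. *)

theory Defs
  imports
    "HOL-Analysis.Analysis"
    "HOL-Library.Poly_Mapping"
    "HOL-Algebra.Algebraic_Closure_Type"
    "HOL-Algebra.Sym_Groups"
begin

section \<open>Field extensions\<close>

text \<open>
  An extension of fields is given by an embedding of the type of the base field into the type
  of the extension field; a field \<open>'k\<close> is thereby an arbitrary field, of any characteristic.
\<close>

definition field_embedding :: "('k::field \<Rightarrow> 'l::field) \<Rightarrow> bool" where
  "field_embedding \<iota> \<longleftrightarrow>
     \<iota> 1 = 1 \<and> (\<forall>x y. \<iota> (x + y) = \<iota> x + \<iota> y) \<and> (\<forall>x y. \<iota> (x * y) = \<iota> x * \<iota> y)"

definition algebraic_extension :: "('k::field \<Rightarrow> 'l::field) \<Rightarrow> bool" where
  "algebraic_extension \<iota> \<longleftrightarrow>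
     field_embedding \<iota> \<and> (\<forall>x. \<exists>p. p \<noteq> 0 \<and> poly (map_poly \<iota> p) x = 0)"

definition splits_into_linear_factors :: "'a::field poly \<Rightarrow> bool" where
  "splits_into_linear_factors p \<longleftrightarrow>
     (\<exists>c xs. p = Polynomial.smult c (\<Prod>x\<leftarrow>xs. [:- x, 1:]))"

definition normal_extension :: "('k::field \<Rightarrow> 'l::field) \<Rightarrow> bool" where
  "normal_extension \<iota> \<longleftrightarrow>
     algebraic_extension \<iota> \<and>
     (\<forall>p. Factorial_Ring.irreducible p \<longrightarrow> (\<exists>x. poly (map_poly \<iota> p) x = 0)
        \<longrightarrow> splits_into_linear_factors (map_poly \<iota> p))"

definition separable_polynomial :: "'k::field poly \<Rightarrow> bool" where
  "separable_polynomial p \<longleftrightarrow> rsquarefree (map_poly (to_ac :: 'k \<Rightarrow> 'k alg_closure) p)"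

definition separable_extension :: "('k::field \<Rightarrow> 'l::field) \<Rightarrow> bool" where
  "separable_extension \<iota> \<longleftrightarrow>
     algebraic_extension \<iota> \<and>
     (\<forall>p. Factorial_Ring.irreducible p \<longrightarrow> (\<exists>x. poly (map_poly \<iota> p) x = 0)
        \<longrightarrow> separable_polynomial p)"

definition Gal :: "('k::field \<Rightarrow> 'l::field) \<Rightarrow> ('l \<Rightarrow> 'l) monoid" where
  "Gal \<iota> = \<lparr> carrier = {\<sigma>. bij \<sigma> \<and> field_embedding \<sigma> \<and> (\<forall>a. \<sigma> (\<iota> a) = \<iota> a)},
            mult = (\<circ>), one = id \<rparr>"


section \<open>Multivariate polynomials\<close>

text \<open>
  Polynomials with variables indexed by \<open>'v\<close>: finitely supported maps from exponent vectors
  to coefficients.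
\<close>

type_synonym ('v, 'a) mpoly = "('v \<Rightarrow>\<^sub>0 nat) \<Rightarrow>\<^sub>0 'a"

text \<open>Evaluation at a point with coordinates in an extension \<open>j\<close> of the coefficient field.\<close>

definition mp_eval :: "('a::field \<Rightarrow> 'b::field) \<Rightarrow> ('v, 'a) mpoly \<Rightarrow> ('v \<Rightarrow> 'b) \<Rightarrow> 'b" where
  "mp_eval j p x =
     (\<Sum>m \<in> Poly_Mapping.keys p. j (Poly_Mapping.lookup p m) *
        (\<Prod>v \<in> Poly_Mapping.keys m. x v ^ Poly_Mapping.lookup m v))"

definition mp_partial :: "'v \<Rightarrow> ('v, 'a::field) mpoly \<Rightarrow> ('v, 'a) mpoly" where
  "mp_partial v p =
     (\<Sum>m \<in> Poly_Mapping.keys p.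
        Poly_Mapping.single (m - Poly_Mapping.single v 1)
          (of_nat (Poly_Mapping.lookup m v) * Poly_Mapping.lookup p m))"

text \<open>Forms (homogeneous polynomials, including 0) of degree \<open>d\<close> in the variables \<open>V\<close>.\<close>

definition forms :: "'v set \<Rightarrow> nat \<Rightarrow> ('v, 'a::field) mpoly set" where
  "forms V d = {p. \<forall>m \<in> Poly_Mapping.keys p.
     Poly_Mapping.keys m \<subseteq> V \<and> (\<Sum>v \<in> Poly_Mapping.keys m. Poly_Mapping.lookup m v) = d}"


section \<open>Cubic surfaces\<close>

text \<open>
  A cubic surface in \<open>P\<^sup>3\<close> over \<open>'k\<close> is given by a nonzero cubic form with coefficients in
  \<open>'k\<close>. Its geometric points are taken in an algebraically closed field \<open>'b\<close>, in which
  \<open>'k\<close> is embedded by \<open>j\<close>. Points of \<open>P\<^sup>3\<close> are represented by the nonzero vectors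
  spanning them, so that a subset of \<open>P\<^sup>3\<close> is encoded by the cone over it without its apex.
\<close>

type_synonym 'a quaternary = "(4, 'a) mpoly"

definition zero_locus :: "('k::field \<Rightarrow> 'b::alg_closed_field) \<Rightarrow> 'k quaternary \<Rightarrow> ('b^4) set" where
  "zero_locus j F = {x. x \<noteq> 0 \<and> mp_eval j F (($) x) = 0}"

definition cubic_surface :: "'k::field quaternary \<Rightarrow> bool" where
  "cubic_surface F \<longleftrightarrow> F \<in> forms UNIV 3 \<and> F \<noteq> 0"

definition nonsingular :: "('k::field \<Rightarrow> 'b::alg_closed_field) \<Rightarrow> 'k quaternary \<Rightarrow> bool" where
  "nonsingular j F \<longleftrightarrow>
     (\<forall>x \<in> zero_locus j F. \<exists>v. mp_eval j (mp_partial v F) (($) x) \<noteq> 0)"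

text \<open>A line in \<open>P\<^sup>3\<close> is a two-dimensional linear subspace of the space of vectors.\<close>

definition lines_on :: "('k::field \<Rightarrow> 'b::alg_closed_field) \<Rightarrow> 'k quaternary \<Rightarrow> ('b^4) set set" where
  "lines_on j F = {W. vec.subspace W \<and> vec.dim W = 2 \<and> W - {0} \<subseteq> zero_locus j F}"

text \<open>
  The intersection numbers of lines on a nonsingular cubic surface: distinct lines meet
  transversally if at all, and every line has self-intersection \<open>-1\<close>.
\<close>

definition line_pairing :: "('b::field^4) set \<Rightarrow> ('b^4) set \<Rightarrow> int" where
  "line_pairing W W' = (if W = W' then -1 else if W \<inter> W' \<noteq> {0} then 1 else 0)"

definition vec_emb :: "('l \<Rightarrow> 'b) \<Rightarrow> 'l^4 \<Rightarrow> 'b^4" where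
  "vec_emb j v = (\<chi> a. j (v $ a))"

definition defined_over :: "('l::field \<Rightarrow> 'b::field) \<Rightarrow> ('b^4) set \<Rightarrow> bool" where
  "defined_over j W \<longleftrightarrow> (\<exists>V. W = vec.span (vec_emb j ` V))"

text \<open>
  The conjugate under \<open>\<sigma>\<close> of a subspace defined over \<open>'l\<close>: apply \<open>\<sigma>\<close> to the coordinates of
  its \<open>'l\<close>-rational vectors.
\<close>

definition conjugate :: "('l::field \<Rightarrow> 'b::field) \<Rightarrow> ('l \<Rightarrow> 'l) \<Rightarrow> ('b^4) set \<Rightarrow> ('b^4) set" where
  "conjugate j \<sigma> W = vec.span (vec_emb (j \<circ> \<sigma>) ` {v. vec_emb j v \<in> W})"


section \<open>Unirationality\<close>

definition zariski_closure :: "('b::alg_closed_field^4) set \<Rightarrow> ('b^4) set" where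
  "zariski_closure A =
     {x. x \<noteq> 0 \<and> (\<forall>d. \<forall>G \<in> forms UNIV d. (\<forall>a\<in>A. mp_eval id G (($) a) = 0)
                         \<longrightarrow> mp_eval id G (($) x) = 0)}"

text \<open>
  A rational map over \<open>'k\<close> from \<open>P\<^sup>n\<close> (with homogeneous coordinates indexed by \<open>{..n}\<close>) to
  \<open>P\<^sup>3\<close> is given by four forms of the same degree with coefficients in \<open>'k\<close>, not all zero.
\<close>

definition rational_map :: "nat \<Rightarrow> (4 \<Rightarrow> (nat, 'k::field) mpoly) \<Rightarrow> bool" where
  "rational_map n \<phi> \<longleftrightarrow> (\<exists>d. \<forall>a. \<phi> a \<in> forms {..n} d) \<and> (\<exists>a. \<phi> a \<noteq> 0)"

definition image_of_map ::
    "('k::field \<Rightarrow> 'b::alg_closed_field) \<Rightarrow> (4 \<Rightarrow> (nat, 'k) mpoly) \<Rightarrow> ('b^4) set" where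
  "image_of_map j \<phi> = {y. y \<noteq> 0 \<and> (\<exists>t. y = (\<chi> a. mp_eval j (\<phi> a) t))}"

definition unirational :: "('k::field \<Rightarrow> 'b::alg_closed_field) \<Rightarrow> 'k quaternary \<Rightarrow> bool" where
  "unirational j F \<longleftrightarrow>
     (\<exists>n \<phi>. rational_map n \<phi> \<and> image_of_map j \<phi> \<subseteq> zero_locus j F \<and>
            zero_locus j F \<subseteq> zariski_closure (image_of_map j \<phi>))"


section \<open>The groups \<open>G\<^sub>m\<^sub>a\<^sub>x\<close> and \<open>U\<^sub>d\<^sub>s\<close>\<close>

definition pairing_group :: "'a set \<Rightarrow> ('a \<Rightarrow> 'a \<Rightarrow> int) \<Rightarrow> ('a \<Rightarrow> 'a) set" where
  "pairing_group A P = {\<pi>. \<pi> permutes A \<and> (\<forall>x\<in>A. \<forall>y\<in>A. P (\<pi> x) (\<pi> y) = P x y)}"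

text \<open>
  Schlaefli's notation for the 27 lines. If the surface is the blow-up of the plane in six
  points, then \<open>LA i\<close> is the exceptional curve over the \<open>i\<close>-th point, \<open>LB i\<close> is the conic
  through the other five points, and \<open>LC i j\<close> (\<open>i < j\<close>) is the line through the points
  \<open>i\<close> and \<open>j\<close>.
\<close>

datatype schlaefli = LA nat | LB nat | LC nat nat

fun schlaefli_pairing :: "schlaefli \<Rightarrow> schlaefli \<Rightarrow> int" where
  "schlaefli_pairing (LA i) (LA j) = (if i = j then -1 else 0)"
| "schlaefli_pairing (LB i) (LB j) = (if i = j then -1 else 0)"
| "schlaefli_pairing (LA i) (LB j) = (if i = j then 0 else 1)"
| "schlaefli_pairing (LB i) (LA j) = (if i = j then 0 else 1)"
| "schlaefli_pairing (LA i) (LC j k) = (if i \<in> {j, k} then 1 else 0)"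
| "schlaefli_pairing (LB i) (LC j k) = (if i \<in> {j, k} then 1 else 0)"
| "schlaefli_pairing (LC j k) (LA i) = (if i \<in> {j, k} then 1 else 0)"
| "schlaefli_pairing (LC j k) (LB i) = (if i \<in> {j, k} then 1 else 0)"
| "schlaefli_pairing (LC i j) (LC k l) =
     (if {i, j} = {k, l} then -1 else if {i, j} \<inter> {k, l} = {} then 1 else 0)"

definition schlaefli_lines :: "schlaefli list" where
  "schlaefli_lines =
     [LA 1, LA 2, LA 3, LA 4, LA 5, LA 6,
      LB 1, LB 2, LB 3, LB 4, LB 5, LB 6,
      LC 1 2, LC 1 3, LC 1 4, LC 1 5, LC 1 6,
      LC 2 3, LC 2 4, LC 2 5, LC 2 6,
      LC 3 4, LC 3 5, LC 3 6,
      LC 4 5, LC 4 6,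
      LC 5 6]"

definition pairing27 :: "nat \<Rightarrow> nat \<Rightarrow> int" where
  "pairing27 m n = schlaefli_pairing (schlaefli_lines ! (m - 1)) (schlaefli_lines ! (n - 1))"

definition G_max :: "(nat \<Rightarrow> nat) set" where
  "G_max = pairing_group {1..27} pairing27"

definition double_six :: "'a set \<Rightarrow> ('a \<Rightarrow> 'a \<Rightarrow> int) \<Rightarrow> 'a set \<Rightarrow> bool" where
  "double_six A P D \<longleftrightarrow>
     D \<subseteq> A \<and> card D = 12 \<and>
     (\<exists>E E' :: nat \<Rightarrow> 'a. D = E ` {1..6} \<union> E' ` {1..6} \<and>
        (\<forall>i\<in>{1..6}. \<forall>j\<in>{1..6}. i \<noteq> j \<longrightarrow>
            P (E i) (E j) = 0 \<and> P (E' i) (E' j) = 0 \<and> P (E i) (E' j) = 1) \<and>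
        (\<forall>i\<in>{1..6}. P (E i) (E' i) = 0))"

text \<open>The two sixes may be interchanged, so that the index in \<^const>\<open>G_max\<close> is 36, not 72.\<close>

definition U_ds :: "nat set \<Rightarrow> (nat \<Rightarrow> nat) set" where
  "U_ds D = {\<pi> \<in> G_max. \<pi> ` D = D}"

text \<open>
  A numbering \<open>\<nu>\<close> of the lines on the surface that carries the group of permutations respecting
  the intersection pairing to \<^const>\<open>G_max\<close>.
\<close>

definition line_numbering ::
    "('k::field \<Rightarrow> 'b::alg_closed_field) \<Rightarrow> 'k quaternary \<Rightarrow> (nat \<Rightarrow> ('b^4) set) \<Rightarrow> bool" where
  "line_numbering j F \<nu> \<longleftrightarrow>
     bij_betw \<nu> {1..27} (lines_on j F) \<and>
     pairing_group {1..27} (\<lambda>m n. line_pairing (\<nu> m) (\<nu> n)) = G_max"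

end

(*
  The proof uses the cubic surfaces T^3 - Y z^2 - Y^2 w + (terms divisible by w) = 0, whose section by
  the plane w = 0 is the cuspidal cubic (u, u^3, 1, 0); three points of the cuspidal cubic are collinear
  iff their parameters add up to 0. Such surfaces are parametrised by the Cartan subalgebra of E6,
  with coordinates r_1, ..., r_6 of sum 0 and s adapted to a double-six: the positive roots are
  r_i - r_j, 2 s and r_i + r_j + r_k +- s, and the 27 lines A_i, B_i, C_ij meet the cuspidal cubic at
  u = r_i - s, r_i + s and - r_i - r_j. The coefficients of the cubic are polynomials in s^2 and the
  elementary symmetric polynomials of the r_i. Now U_ds is the group S_6 x {+-1} acting on this
  double-six, so if the Galois group permutes the r_i and changes the sign of s as prescribed by i,
  then the surface is defined over k and the lines are permuted by i. By the independence of field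
  automorphisms and because k is infinite, such r, s exist in l with no root of E6 vanishing.

  For such r, s the lines A_i, B_i, C_ij are all the lines and the surface is smooth: the discriminant
  of the pencil of conics residual to A_i has as its only zeros the five planes spanned by A_i, B_j, C_ij,
  and every line meets the plane of A_i, B_j, C_ij. The tangent plane at a point of the cuspidal cubic
  meets the surface in a cubic curve singular at that point, hence parametrised by the lines through it.
  As the cuspidal cubic is rational over k, these parametrisations give a dominant rational map from
  3-space to the surface.
*)

theory Submission
  imports Defs "HOL-Library.Reflection"
begin

hide_const (open) Polynomials.degree Polynomials.lead_coeff up_ring.coeff up_ring.monom Coset.order Module.smult
no_notation fps_nth (infixl \<open>$\<close> 75)

section \<open>Polynomial identities by reflection\<close>

text \<open>The smooth points of a cuspidal cubic form the additive group, which makes the traces of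
  the 27 lines on \<open>w = 0\<close> linear forms in r and s. As U_ds acts on r and s by
  permutations and a sign, values with a prescribed Galois action are sums over the Galois group,
  which is finite because it embeds into a group of permutations of 27 numbers. The second parameter
  of a line, its offset, is again a polynomial in r and s with integer coefficients; so the lines
  need no further field, and conjugating a line means substituting into these polynomials.

  The count of the lines and the smoothness must hold in characteristic 3 as well. They are
  therefore derived from identities over the integers, in which the obstruction to two lines being
  skew is a product of roots of E6. Characteristic 2 is excluded already by the root 2 s, the
  difference of the parameters of B_i and A_i. Dominance is not derived from irreducibility: a form
  vanishing on the image is followed along plane sections, which are double covers of a line because
  the cubic is quadratic in \<open>Y\<close>.\<close>

datatype ring_exp = RVar nat | RConst int | RAdd ring_exp ring_exp | RSub ring_exp ring_exp
  | RMul ring_exp ring_exp | RPow ring_exp nat | RNeg ring_exp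

primrec ring_val :: "ring_exp \<Rightarrow> 'a::comm_ring_1 list \<Rightarrow> 'a" where
  "ring_val (RVar n) vs = vs ! n"
| "ring_val (RConst c) vs = of_int c"
| "ring_val (RAdd p q) vs = ring_val p vs + ring_val q vs"
| "ring_val (RSub p q) vs = ring_val p vs - ring_val q vs"
| "ring_val (RMul p q) vs = ring_val p vs * ring_val q vs"
| "ring_val (RPow p n) vs = ring_val p vs ^ n"
| "ring_val (RNeg p) vs = - ring_val p vs"

fun ring_eq :: "ring_exp \<times> ring_exp \<Rightarrow> 'a::comm_ring_1 list \<Rightarrow> bool" where
  "ring_eq (p, q) vs \<longleftrightarrow> ring_val p vs = ring_val q vs"

text \<open>The goals contain \<open>0\<close>, \<open>1\<close> and numerals, not
  \<open>of_int c\<close>, so these are the shapes under which reification has to recognise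
  constants; they replace the equation of \<open>RConst\<close> in
  \<open>ring_reify\<close>.\<close>

lemma ring_val_const:
  "ring_val (RConst 0) vs = 0" "ring_val (RConst 1) vs = 1" "ring_val (RConst (numeral n)) vs = numeral n"
  by simp_all

lemmas ring_reify = ring_eq.simps ring_val.simps(1,3-7) ring_val_const

text \<open>Horner form: \<open>DN q p\<close> stands for q + x p with x the first variable, where q
  involves only the later variables and p again all of them. The form is not canonical; it serves
  only to recognise that a difference is 0.\<close>

datatype dense = DC int | DN dense dense

primrec dense_val :: "dense \<Rightarrow> 'a::comm_ring_1 list \<Rightarrow> 'a" where
  "dense_val (DC c) vs = of_int c"
| "dense_val (DN q p) vs = dense_val q (tl vs) + vs ! 0 * dense_val p vs"

fun dense_add :: "dense \<Rightarrow> dense \<Rightarrow> dense" where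
  "dense_add (DC a) (DC b) = DC (a + b)"
| "dense_add (DC a) (DN q p) = DN (dense_add (DC a) q) p"
| "dense_add (DN q p) (DC a) = DN (dense_add q (DC a)) p"
| "dense_add (DN q p) (DN q' p') = DN (dense_add q q') (dense_add p p')"

primrec dense_scale :: "int \<Rightarrow> dense \<Rightarrow> dense" where
  "dense_scale c (DC a) = DC (c * a)"
| "dense_scale c (DN q p) = DN (dense_scale c q) (dense_scale c p)"

text \<open>From (q + x p) (q' + x p') = q q' + x (q p' + p (q' + x p')). The variables of q are
  shifted against those of p', so q enters the second product as \<open>DN q (DC 0)\<close>.\<close>

fun dense_mul :: "dense \<Rightarrow> dense \<Rightarrow> dense" where
  "dense_mul (DC a) p = (if a = 0 then DC 0 else dense_scale a p)"
| "dense_mul (DN q p) (DC a) = (if a = 0 then DC 0 else dense_scale a (DN q p))"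
| "dense_mul (DN q p) (DN q' p') =
     DN (dense_mul q q') (dense_add (dense_mul (DN q (DC 0)) p') (dense_mul p (DN q' p')))"

primrec dense_pow :: "dense \<Rightarrow> nat \<Rightarrow> dense" where
  "dense_pow p 0 = DC 1"
| "dense_pow p (Suc n) = dense_mul p (dense_pow p n)"

primrec dense_var :: "nat \<Rightarrow> dense" where
  "dense_var 0 = DN (DC 0) (DC 1)"
| "dense_var (Suc n) = DN (dense_var n) (DC 0)"

primrec dense_zero :: "dense \<Rightarrow> bool" where
  "dense_zero (DC c) \<longleftrightarrow> c = 0"
| "dense_zero (DN q p) \<longleftrightarrow> dense_zero q \<and> dense_zero p"

primrec ring_norm :: "ring_exp \<Rightarrow> dense" where
  "ring_norm (RVar n) = dense_var n"
| "ring_norm (RConst c) = DC c"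
| "ring_norm (RAdd p q) = dense_add (ring_norm p) (ring_norm q)"
| "ring_norm (RSub p q) = dense_add (ring_norm p) (dense_scale (-1) (ring_norm q))"
| "ring_norm (RMul p q) = dense_mul (ring_norm p) (ring_norm q)"
| "ring_norm (RPow p n) = dense_pow (ring_norm p) n"
| "ring_norm (RNeg p) = dense_scale (-1) (ring_norm p)"

lemma dense_val_add: "dense_val (dense_add p q) vs = dense_val p vs + dense_val q vs"
  by (induction p q arbitrary: vs rule: dense_add.induct) (simp_all add: algebra_simps)

lemma dense_val_scale: "dense_val (dense_scale c p) vs = of_int c * dense_val p vs"
  by (induction p arbitrary: vs) (simp_all add: algebra_simps)

lemma dense_val_mul: "dense_val (dense_mul p q) vs = dense_val p vs * dense_val q vs"
  by (induction p q arbitrary: vs rule: dense_mul.induct)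
    (simp_all add: dense_val_scale dense_val_add algebra_simps)

lemma dense_val_pow: "dense_val (dense_pow p n) vs = dense_val p vs ^ n"
  by (induction n) (simp_all add: dense_val_mul)

lemma dense_val_var: "n < length vs \<Longrightarrow> dense_val (dense_var n) vs = vs ! n"
  by (induction n arbitrary: vs) (auto simp: nth_tl)

lemma dense_val_zero: "dense_zero p \<Longrightarrow> dense_val p vs = 0"
  by (induction p arbitrary: vs) auto

primrec ring_vars_below :: "nat \<Rightarrow> ring_exp \<Rightarrow> bool" where
  "ring_vars_below m (RVar n) \<longleftrightarrow> n < m"
| "ring_vars_below m (RConst c) \<longleftrightarrow> True"
| "ring_vars_below m (RAdd p q) \<longleftrightarrow> ring_vars_below m p \<and> ring_vars_below m q"
| "ring_vars_below m (RSub p q) \<longleftrightarrow> ring_vars_below m p \<and> ring_vars_below m q"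
| "ring_vars_below m (RMul p q) \<longleftrightarrow> ring_vars_below m p \<and> ring_vars_below m q"
| "ring_vars_below m (RPow p n) \<longleftrightarrow> ring_vars_below m p"
| "ring_vars_below m (RNeg p) \<longleftrightarrow> ring_vars_below m p"

lemma dense_val_norm: "ring_vars_below (length vs) p \<Longrightarrow> dense_val (ring_norm p) vs = ring_val p vs"
  by (induction p) (simp_all add: dense_val_add dense_val_scale dense_val_mul dense_val_pow dense_val_var)

text \<open>Both premises concern syntax and are settled by evaluation. All constants are integers,
  so one evaluation proves the identity in every commutative ring, whatever its characteristic. The
  bound on the variables keeps \<open>vs ! n\<close> inside the list, where \<open>tl\<close> shifts
  it correctly.\<close>

lemma ring_eqI:
  assumes "ring_vars_below (length vs) (RSub p q)" "dense_zero (ring_norm (RSub p q))"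
  shows "ring_eq (p, q) vs"
proof -
  have "ring_val (RSub p q) vs = 0"
    using dense_val_norm[OF assms(1)] dense_val_zero[OF assms(2)] by metis
  then show ?thesis by (simp add: ring_eq.simps)
qed

section \<open>A family of cubic surfaces with a cuspidal plane section\<close>

primrec esym :: "'a::comm_ring_1 list \<Rightarrow> nat \<Rightarrow> 'a" where
  "esym [] k = (if k = 0 then 1 else 0)"
| "esym (x # xs) k = esym xs k + (case k of 0 \<Rightarrow> 0 | Suc m \<Rightarrow> x * esym xs m)"

text \<open>
  For the weights 1, 3, 0, -3 of \<open>T\<close>, \<open>Y\<close>, \<open>z\<close>, \<open>w\<close> the cubic is homogeneous of weight 3 if
  \<open>k n\<close> has weight \<open>n\<close>. The coefficients are the solution of the equations saying that the surface
  contains lines meeting the plane \<open>w = 0\<close> in the points \<open>(u, u\<^sup>3, 1, 0)\<close> with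
  \<open>u = r\<^sub>i - s\<close>, \<open>r\<^sub>i + s\<close> and \<open>-r\<^sub>i - r\<^sub>j\<close>, where \<open>e n\<close> is the \<open>n\<close>-th elementary symmetric
  polynomial in \<open>r\<^sub>1, \<dots>, r\<^sub>6\<close> and \<open>e 1 = 0\<close>.
\<close>

definition coeffs :: "(nat \<Rightarrow> 'a::comm_ring_1) \<Rightarrow> 'a \<Rightarrow> nat \<Rightarrow> 'a" where
  "coeffs e s n =
     (if n = 2 then s^2 - e 2
      else if n = 3 then e 3
      else if n = 4 then e 2 * s^2 - e 4
      else if n = 5 then e 5 + e 3 * s^2
      else if n = 6 then s^2 * e 4 - e 6
      else if n = 8 then s^2 * (4 * e 6 - (e 3)^2)
      else if n = 9 then s^2 * (e 5 * s^2 - 2 * e 3 * e 4 + e 2 * e 5)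
      else if n = 12 then s^2 * (e 6 * s^4 + (e 5)^2 - 4 * e 4 * e 6 - e 3 * e 5 * s^2 + (e 3)^2 * e 4
        + 2 * e 2 * e 6 * s^2 - e 2 * e 3 * e 5 + (e 2)^2 * e 6)
      else 0)"

lemma coeffs_simps:
  "coeffs e s 2 = s^2 - e 2" "coeffs e s 3 = e 3" "coeffs e s 4 = e 2 * s^2 - e 4"
  "coeffs e s 5 = e 5 + e 3 * s^2" "coeffs e s 6 = s^2 * e 4 - e 6"
  "coeffs e s 8 = s^2 * (4 * e 6 - (e 3)^2)"
  "coeffs e s 9 = s^2 * (e 5 * s^2 - 2 * e 3 * e 4 + e 2 * e 5)"
  "coeffs e s 12 = s^2 * (e 6 * s^4 + (e 5)^2 - 4 * e 4 * e 6 - e 3 * e 5 * s^2 + (e 3)^2 * e 4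
        + 2 * e 2 * e 6 * s^2 - e 2 * e 3 * e 5 + (e 2)^2 * e 6)"
  by (simp_all add: coeffs_def)

text \<open>On \<open>w = 0\<close> only T^3 = Y z^2 remains, with its cusp at (0, 1, 0, 0). The
  weights 2, 5, 6, 8, 9, 12 are the degrees of the basic invariants of the Weyl group of E6;
  \<open>k 3\<close> and \<open>k 4\<close> correspond to shifts of \<open>z\<close> and
  \<open>T\<close> by multiples of \<open>w\<close>, which are not normalised away as this would
  divide by 2 and 3.\<close>

definition cubic :: "(nat \<Rightarrow> 'a::comm_ring_1) \<Rightarrow> 'a \<Rightarrow> 'a \<Rightarrow> 'a \<Rightarrow> 'a \<Rightarrow> 'a" where
  "cubic k T Y z w = T^3 - Y * z^2 - Y^2 * w + k 2 * Y * T * w + k 3 * Y * z * w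
     + k 4 * T^2 * w + k 5 * T * z * w + k 6 * z^2 * w
     + k 8 * T * w^2 + k 9 * z * w^2 + k 12 * w^3"

text \<open>
  For a line through \<open>(u, u\<^sup>3, 1, 0)\<close> and \<open>(b, c, 0, 1)\<close>, tangency at the first point forces
  \<open>c = intercept k u b\<close>. It then lies on the surface if and only if \<open>line_eq1\<close> and \<open>line_eq0\<close> vanish.
\<close>

definition intercept :: "(nat \<Rightarrow> 'a::comm_ring_1) \<Rightarrow> 'a \<Rightarrow> 'a \<Rightarrow> 'a" where
  "intercept k u b = 3 * u^2 * b - u^6 + k 2 * u^4 + k 3 * u^3 + k 4 * u^2 + k 5 * u + k 6"

text \<open>The parameter \<open>b\<close> of the line with u = x - s, for x one of the roots: a
  common zero of \<open>line_eq1\<close> and \<open>line_eq0\<close> there. Changing the sign of s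
  gives the offset for u = x + s, and \<open>offset_C\<close> belongs to u = - x - y; it depends on
  s only through its square.\<close>

definition offset_A :: "(nat \<Rightarrow> 'a::comm_ring_1) \<Rightarrow> 'a \<Rightarrow> 'a \<Rightarrow> 'a" where
  "offset_A e s x = s * (e 3 - x * e 2 - 2 * x^3) + 2 * x^2 * s^2 - x * s^3"

definition offset_C :: "(nat \<Rightarrow> 'a::comm_ring_1) \<Rightarrow> 'a \<Rightarrow> 'a \<Rightarrow> 'a \<Rightarrow> 'a" where
  "offset_C e s x y = e 4 - x * y * e 2 - x * y * s^2 + x^2 * y^2 + (x + y)^2 * e 2
     - 2 * (x + y)^2 * x * y + (x + y)^4"

definition line_eq1 where
  "line_eq1 k u b = 3 * u * b^2 - 2 * u^3 * intercept k u b + k 2 * (u^3 * b + u * intercept k u b)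
     + k 3 * intercept k u b + 2 * k 4 * u * b + k 5 * b + k 8 * u + k 9"

definition line_eq0 where
  "line_eq0 k u b = b^3 - (intercept k u b)^2 + k 2 * intercept k u b * b + k 4 * b^2 + k 8 * b + k 12"

text \<open>
  Up to the factor \<open>u - u'\<close> this is the determinant of the four points spanning the two lines.
\<close>

definition skewness :: "(nat \<Rightarrow> 'a::comm_ring_1) \<Rightarrow> 'a \<Rightarrow> 'a \<Rightarrow> 'a \<Rightarrow> 'a \<Rightarrow> 'a" where
  "skewness k u b u' b' = intercept k u b - intercept k u' b' - (u^2 + u * u' + u'^2) * (b - b')"

definition conic1 where
  "conic1 k u b m = 3 * b - m^2 + k 2 * m + k 4"
definition conic2 where
  "conic2 k u b m = 6 * u * b - 2 * m * u^3 + k 2 * (m * u + u^3) + k 3 * m + 2 * k 4 * u + k 5"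
definition conic0 where
  "conic0 k u b m = 3 * b^2 - 2 * m * intercept k u b + k 2 * (m * b + intercept k u b) + 2 * k 4 * b + k 8"

lemmas conic_coeff_defs = conic1_def conic2_def conic0_def

text \<open>
  The conic residual to the line with parameters \<open>u\<close>, \<open>b\<close> in the plane of slope \<open>m\<close> through it, in the
  coordinates \<open>p\<close>, \<open>z\<close>, \<open>w\<close> of \<open>cubic_plane\<close>.
\<close>

definition conic where
  "conic k u b m p z w = p^2 + 3 * u * p * z + (3 * u^2 - m) * z^2
     + conic1 k u b m * p * w + conic2 k u b m * z * w + conic0 k u b m * w^2"

text \<open>The planes through the line that do not contain the cusp (0, 1, 0, 0) are spanned by it
  and a vector (1, m, 0, 0); \<open>p\<close> is the coordinate along this vector. The cubic minus
  its restriction to the line is then divisible by \<open>p\<close>.\<close>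

lemma cubic_plane:
  fixes k :: "nat \<Rightarrow> 'a::comm_ring_1"
  shows "cubic k (u * z + b * w + p) (u^3 * z + intercept k u b * w + m * p) z w =
    cubic k (u * z + b * w) (u^3 * z + intercept k u b * w) z w + p * conic k u b m p z w"
proof -
  \<comment> \<open>The coefficients and \<open>intercept k u b\<close> become plain variables, so
    that reification meets a polynomial identity; this one holds for every value \<open>i\<close> of
    the intercept.\<close>
  have *: "T^3 - Y * z^2 - Y^2 * w + k2 * Y * T * w + k3 * Y * z * w
     + k4 * T^2 * w + k5 * T * z * w + k6 * z^2 * w + k8 * T * w^2 + k9 * z * w^2 + k12 * w^3
     = T0^3 - Y0 * z^2 - Y0^2 * w + k2 * Y0 * T0 * w + k3 * Y0 * z * w
     + k4 * T0^2 * w + k5 * T0 * z * w + k6 * z^2 * w + k8 * T0 * w^2 + k9 * z * w^2 + k12 * w^3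
     + p * (p^2 + 3 * u * p * z + (3 * u^2 - m) * z^2
     + (3 * b - m^2 + k2 * m + k4) * p * w + (6 * u * b - 2 * m * u^3 + k2 * (m * u + u^3) + k3 * m + 2 * k4 * u + k5) * z * w
     + (3 * b^2 - 2 * m * i + k2 * (m * b + i) + 2 * k4 * b + k8) * w^2)"
    if "T = u * z + b * w + p" "Y = u^3 * z + i * w + m * p" "T0 = u * z + b * w" "Y0 = u^3 * z + i * w"
    for T Y T0 Y0 k2 k3 k4 k5 k6 k8 k9 k12 i u b m z w p :: 'a
    unfolding that by (reify ring_reify, rule ring_eqI, simp, code_simp)
  show ?thesis unfolding cubic_def conic_def conic_coeff_defs by (rule *) simp_all
qed

text \<open>The coefficient of z^3 vanishes because (u, u^3, 1, 0) is on the cuspidal cubic, that of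
  z^2 w by the choice of \<open>intercept\<close>; the two others are the conditions for the line to
  lie on the surface.\<close>

lemma cubic_line:
  fixes k :: "nat \<Rightarrow> 'a::comm_ring_1"
  shows "cubic k (u * z + b * w) (u^3 * z + intercept k u b * w) z w = line_eq1 k u b * z * w^2 + line_eq0 k u b * w^3"
proof -
  have *: "T^3 - Y * z^2 - Y^2 * w + k2 * Y * T * w + k3 * Y * z * w
     + k4 * T^2 * w + k5 * T * z * w + k6 * z^2 * w + k8 * T * w^2 + k9 * z * w^2 + k12 * w^3
     = (3 * u * b^2 - 2 * u^3 * i + k2 * (u^3 * b + u * i) + k3 * i + 2 * k4 * u * b + k5 * b + k8 * u + k9) * z * w^2
      + (b^3 - i^2 + k2 * i * b + k4 * b^2 + k8 * b + k12) * w^3"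
    if "T = u * z + b * w" "Y = u^3 * z + i * w" "i = 3 * u^2 * b - u^6 + k2 * u^4 + k3 * u^3 + k4 * u^2 + k5 * u + k6"
    for T Y k2 k3 k4 k5 k6 k8 k9 k12 i u b z w :: 'a
    unfolding that by (reify ring_reify, rule ring_eqI, simp, code_simp)
  show ?thesis unfolding cubic_def line_eq1_def line_eq0_def by (rule *) (simp_all add: intercept_def)
qed

section \<open>Identities placing the 27 lines on the surface and relative to each other\<close>

text \<open>The premises say that e 2, ..., e 6 are the elementary symmetric polynomials of x and
  five further roots: \<open>g2\<close>, ..., \<open>g5\<close> are those of the five, whose sum is
  - x. Hiding the five roots in this way keeps the identity small. Below, \<open>q2\<close>,
  \<open>q3\<close>, \<open>q4\<close> and \<open>h2\<close>, \<open>h3\<close> play the same part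
  for four or three remaining roots.\<close>

lemma line_eq1_A:
  fixes e :: "nat \<Rightarrow> 'a::comm_ring_1" and x s g2 g3 g4 g5 :: 'a
  assumes e: "e 2 = g2 - x^2" "e 3 = g3 + x * g2" "e 4 = g4 + x * g3" "e 5 = g5 + x * g4" "e 6 = x * g5"
  shows "line_eq1 (coeffs e s) (x - s) (offset_A e s x) = 0"
  unfolding line_eq1_def intercept_def offset_A_def coeffs_simps e
  by (reify ring_reify, rule ring_eqI, simp, code_simp)

lemma line_eq0_A:
  fixes e :: "nat \<Rightarrow> 'a::comm_ring_1" and x s g2 g3 g4 g5 :: 'a
  assumes e: "e 2 = g2 - x^2" "e 3 = g3 + x * g2" "e 4 = g4 + x * g3" "e 5 = g5 + x * g4" "e 6 = x * g5"
  shows "line_eq0 (coeffs e s) (x - s) (offset_A e s x) = 0"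
  unfolding line_eq0_def intercept_def offset_A_def coeffs_simps e
  by (reify ring_reify, rule ring_eqI, simp, code_simp)

lemma line_eq1_C:
  fixes e :: "nat \<Rightarrow> 'a::comm_ring_1" and x y s q2 q3 q4 :: 'a
  assumes e: "e 2 = q2 - (x + y)^2 + x * y" "e 3 = q3 + (x + y) * q2 - x * y * (x + y)"
    "e 4 = q4 + (x + y) * q3 + x * y * q2" "e 5 = (x + y) * q4 + x * y * q3" "e 6 = x * y * q4"
  shows "line_eq1 (coeffs e s) (- x - y) (offset_C e s x y) = 0"
  unfolding line_eq1_def intercept_def offset_C_def coeffs_simps e
  by (reify ring_reify, rule ring_eqI, simp, code_simp)

lemma line_eq0_C:
  fixes e :: "nat \<Rightarrow> 'a::comm_ring_1" and x y s q2 q3 q4 :: 'a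
  assumes e: "e 2 = q2 - (x + y)^2 + x * y" "e 3 = q3 + (x + y) * q2 - x * y * (x + y)"
    "e 4 = q4 + (x + y) * q3 + x * y * q2" "e 5 = (x + y) * q4 + x * y * q3" "e 6 = x * y * q4"
  shows "line_eq0 (coeffs e s) (- x - y) (offset_C e s x y) = 0"
  unfolding line_eq0_def intercept_def offset_C_def coeffs_simps e
  by (reify ring_reify, rule ring_eqI, simp, code_simp)

text \<open>The polynomial factor is the product of r_i - r_k over the five other indices k. In this
  and the three following identities the skewness of two disjoint lines is, up to sign, a product of
  six roots of E6.\<close>

lemma skewness_AB:
  fixes e :: "nat \<Rightarrow> 'a::comm_ring_1" and x s g2 g3 g4 g5 :: 'a
  assumes e: "e 2 = g2 - x^2" "e 3 = g3 + x * g2" "e 4 = g4 + x * g3" "e 5 = g5 + x * g4" "e 6 = x * g5"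
  shows "skewness (coeffs e s) (x - s) (offset_A e s x) (x + s) (offset_A e (- s) x) = 2 * s * (x^5 + x * x^4 + g2 * x^3 - g3 * x^2 + g4 * x - g5)"
  unfolding skewness_def intercept_def offset_A_def coeffs_simps e
  by (reify ring_reify, rule ring_eqI, simp, code_simp)

lemma skewness_AA:
  fixes e :: "nat \<Rightarrow> 'a::comm_ring_1" and x y s q2 q3 q4 :: 'a
  assumes e: "e 2 = q2 - (x + y)^2 + x * y" "e 3 = q3 + (x + y) * q2 - x * y * (x + y)"
    "e 4 = q4 + (x + y) * q3 + x * y * q2" "e 5 = (x + y) * q4 + x * y * q3" "e 6 = x * y * q4"
  shows "skewness (coeffs e s) (x - s) (offset_A e s x) (y - s) (offset_A e s y) = (x - y) * 2 * s * ((s - x - y)^4 + (x + y) * (s - x - y)^3 + q2 * (s - x - y)^2 - q3 * (s - x - y) + q4)"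
  unfolding skewness_def intercept_def offset_A_def coeffs_simps e
  by (reify ring_reify, rule ring_eqI, simp, code_simp)

lemma skewness_AC:
  fixes e :: "nat \<Rightarrow> 'a::comm_ring_1" and x y z s h2 h3 :: 'a
  assumes e: "e 2 = h2 - (x + y + z)^2 + (x * y + x * z + y * z)"
    "e 3 = h3 + (x + y + z) * h2 - (x * y + x * z + y * z) * (x + y + z) + x * y * z"
    "e 4 = (x + y + z) * h3 + (x * y + x * z + y * z) * h2 - x * y * z * (x + y + z)"
    "e 5 = (x * y + x * z + y * z) * h3 + x * y * z * h2" "e 6 = x * y * z * h3"
  shows "skewness (coeffs e s) (x - s) (offset_A e s x) (- y - z) (offset_C e s y z) = (x + y + z - s) * (x - y) * (x - z) * ((y + z + s)^3 - (x + y + z) * (y + z + s)^2 + h2 * (y + z + s) + h3)"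
  unfolding skewness_def intercept_def offset_A_def offset_C_def coeffs_simps e
  by (reify ring_reify, rule ring_eqI, simp, code_simp)

lemma skewness_CC:
  fixes e :: "nat \<Rightarrow> 'a::comm_ring_1" and x y z s h2 h3 :: 'a
  assumes e: "e 2 = h2 - (x + y + z)^2 + (x * y + x * z + y * z)"
    "e 3 = h3 + (x + y + z) * h2 - (x * y + x * z + y * z) * (x + y + z) + x * y * z"
    "e 4 = (x + y + z) * h3 + (x * y + x * z + y * z) * h2 - x * y * z * (x + y + z)"
    "e 5 = (x * y + x * z + y * z) * h3 + x * y * z * h2" "e 6 = x * y * z * h3"
  shows "skewness (coeffs e s) (- x - y) (offset_C e s x y) (- x - z) (offset_C e s x z) = - (y - z) * (x^3 + (x + y + z) * x^2 + h2 * x - h3) * (x + y + z - s) * (x + y + z + s)"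
  unfolding skewness_def intercept_def offset_C_def coeffs_simps e
  by (reify ring_reify, rule ring_eqI, simp, code_simp)

lemma skewness_AB_eq_0:
  fixes e :: "nat \<Rightarrow> 'a::comm_ring_1" and x y s q2 q3 q4 :: 'a
  assumes e: "e 2 = q2 - (x + y)^2 + x * y" "e 3 = q3 + (x + y) * q2 - x * y * (x + y)"
    "e 4 = q4 + (x + y) * q3 + x * y * q2" "e 5 = (x + y) * q4 + x * y * q3" "e 6 = x * y * q4"
  shows "skewness (coeffs e s) (x - s) (offset_A e s x) (y + s) (offset_A e (- s) y) = 0"
  unfolding skewness_def intercept_def offset_A_def coeffs_simps e
  by (reify ring_reify, rule ring_eqI, simp, code_simp)

lemma skewness_AC_eq_0:
  fixes e :: "nat \<Rightarrow> 'a::comm_ring_1" and x y s q2 q3 q4 :: 'a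
  assumes e: "e 2 = q2 - (x + y)^2 + x * y" "e 3 = q3 + (x + y) * q2 - x * y * (x + y)"
    "e 4 = q4 + (x + y) * q3 + x * y * q2" "e 5 = (x + y) * q4 + x * y * q3" "e 6 = x * y * q4"
  shows "skewness (coeffs e s) (x - s) (offset_A e s x) (- x - y) (offset_C e s x y) = 0"
  unfolding skewness_def intercept_def offset_A_def offset_C_def coeffs_simps e
  by (reify ring_reify, rule ring_eqI, simp, code_simp)

text \<open>\<open>c\<close> is the product of the two roots left over, whose sum is - x - y - z -
  t.\<close>

lemma skewness_CC_eq_0:
  fixes e :: "nat \<Rightarrow> 'a::comm_ring_1" and x y z t s c :: 'a
  assumes e: "e 2 = c + x * y + z * t + (x + y) * (z + t) - (x + y + z + t)^2"
    "e 3 = (x + y + z + t) * c - (x + y + z + t) * (x * y + z * t + (x + y) * (z + t)) + (x + y) * z * t + (z + t) * x * y"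
    "e 4 = c * (x * y + z * t + (x + y) * (z + t)) - (x + y + z + t) * ((x + y) * z * t + (z + t) * x * y) + x * y * z * t"
    "e 5 = c * ((x + y) * z * t + (z + t) * x * y) - (x + y + z + t) * x * y * z * t"
    "e 6 = x * y * z * t * c"
  shows "skewness (coeffs e s) (- x - y) (offset_C e s x y) (- z - t) (offset_C e s z t) = 0"
  unfolding skewness_def intercept_def offset_C_def coeffs_simps e
  by (reify ring_reify, rule ring_eqI, simp, code_simp)

section \<open>Planes containing three lines, and degenerate residual conics\<close>

text \<open>The slope u0^2 + u0 u1 + u1^2 is that of the chord through the points u0 and u1 of the
  cuspidal cubic, so the plane is the one of A_i and B_j. This and the next two identities say
  together that its residual conic is the product of the linear forms defining B_j and C_ij.\<close>

lemma tri_ABC1: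
  fixes e :: "nat \<Rightarrow> 'a::comm_ring_1" and x y s q2 q3 q4 :: 'a
  assumes e: "e 2 = q2 - (x + y)^2 + x * y" "e 3 = q3 + (x + y) * q2 - x * y * (x + y)"
    "e 4 = q4 + (x + y) * q3 + x * y * q2" "e 5 = (x + y) * q4 + x * y * q3" "e 6 = x * y * q4"
  shows "conic1 (coeffs e s) (x - s) (offset_A e s x) ((x - s)^2 + (x - s) * (y + s) + (y + s)^2) = - (offset_A e (- s) y - offset_A e s x) - (offset_C e s x y - offset_A e s x)"
  unfolding conic_coeff_defs intercept_def offset_A_def offset_C_def coeffs_simps e
  by (reify ring_reify, rule ring_eqI, simp, code_simp)

lemma tri_ABC2:
  fixes e :: "nat \<Rightarrow> 'a::comm_ring_1" and x y s q2 q3 q4 :: 'a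
  assumes e: "e 2 = q2 - (x + y)^2 + x * y" "e 3 = q3 + (x + y) * q2 - x * y * (x + y)"
    "e 4 = q4 + (x + y) * q3 + x * y * q2" "e 5 = (x + y) * q4 + x * y * q3" "e 6 = x * y * q4"
  shows "conic2 (coeffs e s) (x - s) (offset_A e s x) ((x - s)^2 + (x - s) * (y + s) + (y + s)^2) = (y + s - (x - s)) * (offset_C e s x y - offset_A e s x) + (- x - y - (x - s)) * (offset_A e (- s) y - offset_A e s x)"
  unfolding conic_coeff_defs intercept_def offset_A_def offset_C_def coeffs_simps e
  by (reify ring_reify, rule ring_eqI, simp, code_simp)

lemma tri_ABC0:
  fixes e :: "nat \<Rightarrow> 'a::comm_ring_1" and x y s q2 q3 q4 :: 'a
  assumes e: "e 2 = q2 - (x + y)^2 + x * y" "e 3 = q3 + (x + y) * q2 - x * y * (x + y)"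
    "e 4 = q4 + (x + y) * q3 + x * y * q2" "e 5 = (x + y) * q4 + x * y * q3" "e 6 = x * y * q4"
  shows "conic0 (coeffs e s) (x - s) (offset_A e s x) ((x - s)^2 + (x - s) * (y + s) + (y + s)^2) = (offset_A e (- s) y - offset_A e s x) * (offset_C e s x y - offset_A e s x)"
  unfolding conic_coeff_defs intercept_def offset_A_def offset_C_def coeffs_simps e
  by (reify ring_reify, rule ring_eqI, simp, code_simp)

text \<open>The long expression is \<open>offset_C\<close> of the two remaining roots, written in
  terms of their sum - x - y - z - t and their product \<open>c\<close>.\<close>

lemma tri_CCC1:
  fixes e :: "nat \<Rightarrow> 'a::comm_ring_1" and x y z t s c :: 'a
  assumes e: "e 2 = c + x * y + z * t + (x + y) * (z + t) - (x + y + z + t)^2"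
    "e 3 = (x + y + z + t) * c - (x + y + z + t) * (x * y + z * t + (x + y) * (z + t)) + (x + y) * z * t + (z + t) * x * y"
    "e 4 = c * (x * y + z * t + (x + y) * (z + t)) - (x + y + z + t) * ((x + y) * z * t + (z + t) * x * y) + x * y * z * t"
    "e 5 = c * ((x + y) * z * t + (z + t) * x * y) - (x + y + z + t) * x * y * z * t"
    "e 6 = x * y * z * t * c"
  shows "conic1 (coeffs e s) (- x - y) (offset_C e s x y) ((- x - y)^2 + (- x - y) * (- z - t) + (- z - t)^2) = - (offset_C e s z t - offset_C e s x y) - ((e 4 - c * e 2 - c * s^2 + c^2 + (x + y + z + t)^2 * e 2 - 2 * (x + y + z + t)^2 * c + (x + y + z + t)^4) - offset_C e s x y)"
  unfolding conic_coeff_defs intercept_def offset_C_def coeffs_simps e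
  by (reify ring_reify, rule ring_eqI, simp, code_simp)

lemma tri_CCC2:
  fixes e :: "nat \<Rightarrow> 'a::comm_ring_1" and x y z t s c :: 'a
  assumes e: "e 2 = c + x * y + z * t + (x + y) * (z + t) - (x + y + z + t)^2"
    "e 3 = (x + y + z + t) * c - (x + y + z + t) * (x * y + z * t + (x + y) * (z + t)) + (x + y) * z * t + (z + t) * x * y"
    "e 4 = c * (x * y + z * t + (x + y) * (z + t)) - (x + y + z + t) * ((x + y) * z * t + (z + t) * x * y) + x * y * z * t"
    "e 5 = c * ((x + y) * z * t + (z + t) * x * y) - (x + y + z + t) * x * y * z * t"
    "e 6 = x * y * z * t * c"
  shows "conic2 (coeffs e s) (- x - y) (offset_C e s x y) ((- x - y)^2 + (- x - y) * (- z - t) + (- z - t)^2) = (- z - t - (- x - y)) * ((e 4 - c * e 2 - c * s^2 + c^2 + (x + y + z + t)^2 * e 2 - 2 * (x + y + z + t)^2 * c + (x + y + z + t)^4) - offset_C e s x y) + (x + y + z + t - (- x - y)) * (offset_C e s z t - offset_C e s x y)"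
  unfolding conic_coeff_defs intercept_def offset_C_def coeffs_simps e
  by (reify ring_reify, rule ring_eqI, simp, code_simp)

lemma tri_CCC0:
  fixes e :: "nat \<Rightarrow> 'a::comm_ring_1" and x y z t s c :: 'a
  assumes e: "e 2 = c + x * y + z * t + (x + y) * (z + t) - (x + y + z + t)^2"
    "e 3 = (x + y + z + t) * c - (x + y + z + t) * (x * y + z * t + (x + y) * (z + t)) + (x + y) * z * t + (z + t) * x * y"
    "e 4 = c * (x * y + z * t + (x + y) * (z + t)) - (x + y + z + t) * ((x + y) * z * t + (z + t) * x * y) + x * y * z * t"
    "e 5 = c * ((x + y) * z * t + (z + t) * x * y) - (x + y + z + t) * x * y * z * t"
    "e 6 = x * y * z * t * c"
  shows "conic0 (coeffs e s) (- x - y) (offset_C e s x y) ((- x - y)^2 + (- x - y) * (- z - t) + (- z - t)^2) = (offset_C e s z t - offset_C e s x y) * ((e 4 - c * e 2 - c * s^2 + c^2 + (x + y + z + t)^2 * e 2 - 2 * (x + y + z + t)^2 * c + (x + y + z + t)^4) - offset_C e s x y)"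
  unfolding conic_coeff_defs intercept_def offset_C_def coeffs_simps e
  by (reify ring_reify, rule ring_eqI, simp, code_simp)

text \<open>Half the Hessian determinant of \<open>conic\<close> as a quadratic form in p, z,
  w.\<close>

definition conic_disc where
  "conic_disc k u b m = 4 * (3 * u^2 - m) * conic0 k u b m + 3 * u * conic1 k u b m * conic2 k u b m - (conic2 k u b m)^2
     - (3 * u^2 - m) * (conic1 k u b m)^2 - 9 * u^2 * conic0 k u b m"

text \<open>A plane through A_i meets the cuspidal cubic in the points u0 = x - s, u and - u0 - u;
  the variable is t = u - s. The first factor vanishes if u belongs to some B_k, the second if it
  belongs to some C_ik, and exchanging u with - u0 - u exchanges the two.\<close>

lemma conic_disc_A:
  fixes e :: "nat \<Rightarrow> 'a::comm_ring_1" and x s g2 g3 g4 g5 t :: 'a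
  assumes e: "e 2 = g2 - x^2" "e 3 = g3 + x * g2" "e 4 = g4 + x * g3" "e 5 = g5 + x * g4" "e 6 = x * g5"
  shows "conic_disc (coeffs e s) (x - s) (offset_A e s x) ((x - s)^2 + (x - s) * (t + s) + (t + s)^2) = - (t^5 + x * t^4 + g2 * t^3 - g3 * t^2 + g4 * t - g5) * ((- t - s - x)^5 + x * (- t - s - x)^4 + g2 * (- t - s - x)^3 - g3 * (- t - s - x)^2 + g4 * (- t - s - x) - g5)"
  unfolding conic_disc_def conic_coeff_defs intercept_def offset_A_def coeffs_simps e
  by (reify ring_reify, rule ring_eqI, simp, code_simp)

section \<open>Elementary symmetric polynomials of the roots\<close>

lemma esym_0 [simp]: "esym xs 0 = 1"
  by (induction xs) auto

lemma coeff_prod_esym: "Polynomial.coeff (\<Prod>y\<leftarrow>xs. [:1, y:]) n = esym xs n"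
  for xs :: "'a::comm_ring_1 list"
proof (induction xs arbitrary: n)
  case (Cons x xs)
  then show ?case by (cases n) (simp_all add: algebra_simps)
qed simp

text \<open>The generating function, a product of factors 1 + y X, does not depend on their
  order.\<close>

lemma esym_mset_cong:
  assumes "mset xs = mset ys"
  shows "esym xs = esym ys"
proof -
  have "(\<Prod>y\<leftarrow>xs. [:1, y:]) = (\<Prod>y\<leftarrow>ys. [:1, y:])"
    using assms by (metis mset_map prod_mset_prod_list)
  then show ?thesis by (metis coeff_prod_esym ext)
qed

lemma esym_eval:
  "esym (x # xs) 1 = esym xs 1 + x" "esym (x # xs) 2 = esym xs 2 + x * esym xs 1"
  "esym (x # xs) 3 = esym xs 3 + x * esym xs 2" "esym (x # xs) 4 = esym xs 4 + x * esym xs 3"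
  "esym (x # xs) 5 = esym xs 5 + x * esym xs 4" "esym (x # xs) 6 = esym xs 6 + x * esym xs 5"
  "esym [] 1 = 0" "esym [] 2 = 0" "esym [] 3 = 0" "esym [] 4 = 0" "esym [] 5 = 0" "esym [] 6 = 0"
  by (simp_all add: numeral_eq_Suc)

definition root_esym :: "(nat \<Rightarrow> 'a::comm_ring_1) \<Rightarrow> nat \<Rightarrow> 'a" where
  "root_esym r = esym (map r [1..<7])"

text \<open>Moves chosen roots to the front of the list, so that identities stated for particular
  positions apply to arbitrary indices.\<close>

lemma root_esym_split:
  assumes "distinct ks" "set ks \<subseteq> {1..6}"
  obtains ms where "distinct ms" "set ms = {1..6} - set ks" "length ms = 6 - length ks"
    "root_esym r = esym (map r ks @ map r ms)" "sum_list (map r ks) + sum_list (map r ms) = (\<Sum>i\<in>{1..6}. r i)"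
proof -
  define ms where "ms = sorted_list_of_set ({1..6::nat} - set ks)"
  have ms: "distinct ms" "set ms = {1..6} - set ks" by (auto simp: ms_def)
  have d: "distinct (ks @ ms)" "set (ks @ ms) = {1..6}" using assms ms by auto
  have m: "mset (ks @ ms) = mset [1..<7]"
    using d by (intro set_eq_iff_mset_eq_distinct[THEN iffD1]) auto
  have "length (ks @ ms) = 6"
    using m by (metis mset_eq_length length_upt diff_numeral_Suc eval_nat_numeral(3) numeral_eq_Suc pred_numeral_simps(3) diff_Suc_1 One_nat_def)
  then have "length ms = 6 - length ks" by simp
  moreover have "root_esym r = esym (map r ks @ map r ms)"
    unfolding root_esym_def using m by (intro esym_mset_cong) (metis map_append mset_map)
  moreover have "sum_list (map r ks) + sum_list (map r ms) = (\<Sum>i\<in>{1..6}. r i)"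
    using d by (metis map_append sum_list.append sum_list_distinct_conv_sum_set)
  ultimately show ?thesis using that ms by blast
qed

text \<open>
  Together with \<open>2 s \<noteq> 0\<close> and \<open>r i \<noteq> r j\<close>, these conditions say that none of the 36 positive roots
  of \<open>E\<^sub>6\<close> vanishes at \<open>(r, s)\<close>.
\<close>

definition generic :: "(nat \<Rightarrow> 'a::field) \<Rightarrow> 'a \<Rightarrow> bool" where
  "generic r s \<longleftrightarrow> (2::'a) \<noteq> 0 \<and> s \<noteq> 0 \<and> (\<Sum>i\<in>{1..6}. r i) = 0 \<and> inj_on r {1..6} \<and>
     (\<forall>i\<in>{1..6}. \<forall>j\<in>{1..6}. \<forall>k\<in>{1..6}. i \<noteq> j \<longrightarrow> i \<noteq> k \<longrightarrow> j \<noteq> k \<longrightarrow>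
        r i + r j + r k \<noteq> s \<and> r i + r j + r k \<noteq> - s)"

lemma generic_uminus: "generic r s \<Longrightarrow> generic r (- s)"
  unfolding generic_def by auto

lemma genericD:
  assumes "generic r s"
  shows "(2::'a::field) \<noteq> 0" "s \<noteq> (0::'a)" "(\<Sum>i\<in>{1..6}. r i) = 0"
    "\<And>i j. i \<in> {1..6} \<Longrightarrow> j \<in> {1..6} \<Longrightarrow> i \<noteq> j \<Longrightarrow> r i \<noteq> r j"
    "\<And>i j k. i \<in> {1..6} \<Longrightarrow> j \<in> {1..6} \<Longrightarrow> k \<in> {1..6} \<Longrightarrow> i \<noteq> j \<Longrightarrow> i \<noteq> k \<Longrightarrow> j \<noteq> k \<Longrightarrow> r i + r j + r k \<noteq> s"
    "\<And>i j k. i \<in> {1..6} \<Longrightarrow> j \<in> {1..6} \<Longrightarrow> k \<in> {1..6} \<Longrightarrow> i \<noteq> j \<Longrightarrow> i \<noteq> k \<Longrightarrow> j \<noteq> k \<Longrightarrow> r i + r j + r k \<noteq> - s"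
  using assms unfolding generic_def inj_on_def by blast+

text \<open>The vanishing sum eliminates the last root and leaves an identity in free variables. The
  last equation concerns the monic polynomial with roots a, b, c, d, f: its coefficient of t^4 is x
  because the five add up to - x.\<close>

lemma esym_split1:
  fixes x a b c d f :: "'a::comm_ring_1"
  assumes f: "f = - x - a - b - c - d"
  shows "esym [x,a,b,c,d,f] 2 = esym [a,b,c,d,f] 2 - x^2"
    "esym [x,a,b,c,d,f] 3 = esym [a,b,c,d,f] 3 + x * esym [a,b,c,d,f] 2"
    "esym [x,a,b,c,d,f] 4 = esym [a,b,c,d,f] 4 + x * esym [a,b,c,d,f] 3"
    "esym [x,a,b,c,d,f] 5 = esym [a,b,c,d,f] 5 + x * esym [a,b,c,d,f] 4"
    "esym [x,a,b,c,d,f] 6 = x * esym [a,b,c,d,f] 5"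
    "t^5 + x * t^4 + esym [a,b,c,d,f] 2 * t^3 - esym [a,b,c,d,f] 3 * t^2
      + esym [a,b,c,d,f] 4 * t - esym [a,b,c,d,f] 5 = (t - a) * (t - b) * (t - c) * (t - d) * (t - f)"
  unfolding f esym_eval by ((reify ring_reify, rule ring_eqI, simp, code_simp)+)

lemma esym_split2:
  fixes x y a b c d :: "'a::comm_ring_1"
  assumes d: "d = - x - y - a - b - c"
  shows "esym [x,y,a,b,c,d] 2 = esym [a,b,c,d] 2 - (x + y)^2 + x * y"
    "esym [x,y,a,b,c,d] 3 = esym [a,b,c,d] 3 + (x + y) * esym [a,b,c,d] 2 - x * y * (x + y)"
    "esym [x,y,a,b,c,d] 4 = esym [a,b,c,d] 4 + (x + y) * esym [a,b,c,d] 3 + x * y * esym [a,b,c,d] 2"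
    "esym [x,y,a,b,c,d] 5 = (x + y) * esym [a,b,c,d] 4 + x * y * esym [a,b,c,d] 3"
    "esym [x,y,a,b,c,d] 6 = x * y * esym [a,b,c,d] 4"
    "t^4 + (x + y) * t^3 + esym [a,b,c,d] 2 * t^2 - esym [a,b,c,d] 3 * t
      + esym [a,b,c,d] 4 = (t - a) * (t - b) * (t - c) * (t - d)"
  unfolding d esym_eval by ((reify ring_reify, rule ring_eqI, simp, code_simp)+)

lemma esym_split3:
  fixes x y z a b c :: "'a::comm_ring_1"
  assumes c: "c = - x - y - z - a - b"
  shows "esym [x,y,z,a,b,c] 2 = esym [a,b,c] 2 - (x + y + z)^2 + (x * y + x * z + y * z)"
    "esym [x,y,z,a,b,c] 3 = esym [a,b,c] 3 + (x + y + z) * esym [a,b,c] 2 - (x * y + x * z + y * z) * (x + y + z) + x * y * z"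
    "esym [x,y,z,a,b,c] 4 = (x + y + z) * esym [a,b,c] 3 + (x * y + x * z + y * z) * esym [a,b,c] 2 - x * y * z * (x + y + z)"
    "esym [x,y,z,a,b,c] 5 = (x * y + x * z + y * z) * esym [a,b,c] 3 + x * y * z * esym [a,b,c] 2"
    "esym [x,y,z,a,b,c] 6 = x * y * z * esym [a,b,c] 3"
    "t^3 + (x + y + z) * t^2 + esym [a,b,c] 2 * t - esym [a,b,c] 3 = (t - a) * (t - b) * (t - c)"
  unfolding c esym_eval by ((reify ring_reify, rule ring_eqI, simp, code_simp)+)

lemma esym_split4:
  fixes x y z t a b :: "'a::comm_ring_1"
  assumes b: "b = - x - y - z - t - a"
  shows "esym [x,y,z,t,a,b] 2 = a * b + x * y + z * t + (x + y) * (z + t) - (x + y + z + t)^2"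
    "esym [x,y,z,t,a,b] 3 = (x + y + z + t) * (a * b) - (x + y + z + t) * (x * y + z * t + (x + y) * (z + t)) + (x + y) * z * t + (z + t) * x * y"
    "esym [x,y,z,t,a,b] 4 = a * b * (x * y + z * t + (x + y) * (z + t)) - (x + y + z + t) * ((x + y) * z * t + (z + t) * x * y) + x * y * z * t"
    "esym [x,y,z,t,a,b] 5 = a * b * ((x + y) * z * t + (z + t) * x * y) - (x + y + z + t) * x * y * z * t"
    "esym [x,y,z,t,a,b] 6 = x * y * z * t * (a * b)"
  unfolding b esym_eval by ((reify ring_reify, rule ring_eqI, simp, code_simp)+)

lemma list_length2: "length xs = 2 \<Longrightarrow> \<exists>a b. xs = [a,b]"
  by (auto simp: length_Suc_conv eval_nat_numeral)

lemma list_length3: "length xs = 3 \<Longrightarrow> \<exists>a b c. xs = [a,b,c]"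
  by (auto simp: length_Suc_conv eval_nat_numeral)

lemma list_length4: "length xs = 4 \<Longrightarrow> \<exists>a b c d. xs = [a,b,c,d]"
  by (auto simp: length_Suc_conv eval_nat_numeral)

lemma list_length5: "length xs = 5 \<Longrightarrow> \<exists>a b c d f. xs = [a,b,c,d,f]"
  by (auto simp: length_Suc_conv eval_nat_numeral)

lemma split1:
  fixes r :: "nat \<Rightarrow> 'a::field"
  assumes sum: "(\<Sum>i\<in>{1..6}. r i) = 0" and i: "i \<in> {1..6}"
  obtains g2 g3 g4 g5 where
    "root_esym r 2 = g2 - (r i)^2" "root_esym r 3 = g3 + r i * g2" "root_esym r 4 = g4 + r i * g3" "root_esym r 5 = g5 + r i * g4" "root_esym r 6 = r i * g5"
    "\<And>t. t^5 + r i * t^4 + g2 * t^3 - g3 * t^2 + g4 * t - g5 = (\<Prod>k\<in>{1..6}-{i}. t - r k)"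
proof -
  have "distinct [i]" "set [i] \<subseteq> {1..6}" using i by auto
  from root_esym_split[OF this, of r] obtain ms where ms: "distinct ms" "set ms = {1..6} - set [i]"
    "length ms = 6 - length [i]" "root_esym r = esym (map r [i] @ map r ms)"
    "sum_list (map r [i]) + sum_list (map r ms) = (\<Sum>i\<in>{1..6}. r i)"
    by blast
  have "length ms = 5" using ms(3) by simp
  then obtain a b c d f where m: "ms = [a,b,c,d,f]"
    by (metis (no_types) list_length5)
  have "r i + r a + r b + r c + r d + r f = 0" using ms(5) unfolding m sum by (simp add: add.assoc)
  then have f: "r f = - r i - r a - r b - r c - r d" by (simp add: eq_neg_iff_add_eq_0 algebra_simps)
  have "(\<Prod>k\<in>set ms. t - r k) = (\<Prod>k\<leftarrow>ms. t - r k)" for t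
    using ms(1) by (rule prod.distinct_set_conv_list)
  moreover have "set ms = {1..6} - {i}" using ms(2) by simp
  ultimately have P: "(\<Prod>k\<in>{1..6}-{i}. t - r k) = (t - r a) * (t - r b) * (t - r c) * (t - r d) * (t - r f)" for t
    by (simp add: m mult.assoc)
  have E: "root_esym r = esym [r i, r a, r b, r c, r d, r f]" using ms(4) unfolding m by (simp only: list.map append.simps)
  show ?thesis
    by (rule that[of "esym [r a, r b, r c, r d, r f] 2" "esym [r a, r b, r c, r d, r f] 3" "esym [r a, r b, r c, r d, r f] 4" "esym [r a, r b, r c, r d, r f] 5"]; unfold E P; rule esym_split1[OF f])
qed

lemma split2:
  fixes r :: "nat \<Rightarrow> 'a::field"
  assumes sum: "(\<Sum>i\<in>{1..6}. r i) = 0" and i: "i \<in> {1..6}" "j \<in> {1..6}" "i \<noteq> j"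
  obtains q2 q3 q4 where
    "root_esym r 2 = q2 - (r i + r j)^2 + r i * r j" "root_esym r 3 = q3 + (r i + r j) * q2 - r i * r j * (r i + r j)"
    "root_esym r 4 = q4 + (r i + r j) * q3 + r i * r j * q2" "root_esym r 5 = (r i + r j) * q4 + r i * r j * q3" "root_esym r 6 = r i * r j * q4"
    "\<And>t. t^4 + (r i + r j) * t^3 + q2 * t^2 - q3 * t + q4 = (\<Prod>k\<in>{1..6}-{i,j}. t - r k)"
proof -
  have "distinct [i,j]" "set [i,j] \<subseteq> {1..6}" using i by auto
  from root_esym_split[OF this, of r] obtain ms where ms: "distinct ms" "set ms = {1..6} - set [i,j]"
    "length ms = 6 - length [i,j]" "root_esym r = esym (map r [i,j] @ map r ms)"
    "sum_list (map r [i,j]) + sum_list (map r ms) = (\<Sum>i\<in>{1..6}. r i)"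
    by blast
  have "length ms = 4" using ms(3) by simp
  then obtain a b c d where m: "ms = [a,b,c,d]"
    by (metis (no_types) list_length4)
  have "r i + r j + r a + r b + r c + r d = 0" using ms(5) unfolding m sum by (simp add: add.assoc)
  then have f: "r d = - r i - r j - r a - r b - r c" by (simp add: eq_neg_iff_add_eq_0 algebra_simps)
  have "(\<Prod>k\<in>set ms. t - r k) = (\<Prod>k\<leftarrow>ms. t - r k)" for t
    using ms(1) by (rule prod.distinct_set_conv_list)
  moreover have "set ms = {1..6} - {i,j}" using ms(2) by simp
  ultimately have P: "(\<Prod>k\<in>{1..6}-{i,j}. t - r k) = (t - r a) * (t - r b) * (t - r c) * (t - r d)" for t
    by (simp add: m mult.assoc)
  have E: "root_esym r = esym [r i, r j, r a, r b, r c, r d]" using ms(4) unfolding m by (simp only: list.map append.simps)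
  show ?thesis
    by (rule that[of "esym [r a, r b, r c, r d] 2" "esym [r a, r b, r c, r d] 3" "esym [r a, r b, r c, r d] 4"]; unfold E P; rule esym_split2[OF f])
qed

lemma split3:
  fixes r :: "nat \<Rightarrow> 'a::field"
  assumes sum: "(\<Sum>i\<in>{1..6}. r i) = 0" and i: "i \<in> {1..6}" "j \<in> {1..6}" "k \<in> {1..6}" "i \<noteq> j" "i \<noteq> k" "j \<noteq> k"
  obtains h2 h3 where
    "root_esym r 2 = h2 - (r i + r j + r k)^2 + (r i * r j + r i * r k + r j * r k)"
    "root_esym r 3 = h3 + (r i + r j + r k) * h2 - (r i * r j + r i * r k + r j * r k) * (r i + r j + r k) + r i * r j * r k"
    "root_esym r 4 = (r i + r j + r k) * h3 + (r i * r j + r i * r k + r j * r k) * h2 - r i * r j * r k * (r i + r j + r k)"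
    "root_esym r 5 = (r i * r j + r i * r k + r j * r k) * h3 + r i * r j * r k * h2" "root_esym r 6 = r i * r j * r k * h3"
    "\<And>t. t^3 + (r i + r j + r k) * t^2 + h2 * t - h3 = (\<Prod>l\<in>{1..6}-{i,j,k}. t - r l)"
proof -
  have "distinct [i,j,k]" "set [i,j,k] \<subseteq> {1..6}" using i by auto
  from root_esym_split[OF this, of r] obtain ms where ms: "distinct ms" "set ms = {1..6} - set [i,j,k]"
    "length ms = 6 - length [i,j,k]" "root_esym r = esym (map r [i,j,k] @ map r ms)"
    "sum_list (map r [i,j,k]) + sum_list (map r ms) = (\<Sum>i\<in>{1..6}. r i)"
    by blast
  have "length ms = 3" using ms(3) by simp
  then obtain a b c where m: "ms = [a,b,c]"
    by (metis (no_types) list_length3)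
  have "r i + r j + r k + r a + r b + r c = 0" using ms(5) unfolding m sum by (simp add: add.assoc)
  then have f: "r c = - r i - r j - r k - r a - r b" by (simp add: eq_neg_iff_add_eq_0 algebra_simps)
  have "(\<Prod>k\<in>set ms. t - r k) = (\<Prod>k\<leftarrow>ms. t - r k)" for t
    using ms(1) by (rule prod.distinct_set_conv_list)
  moreover have "set ms = {1..6} - {i,j,k}" using ms(2) by simp
  ultimately have P: "(\<Prod>k\<in>{1..6}-{i,j,k}. t - r k) = (t - r a) * (t - r b) * (t - r c)" for t
    by (simp add: m mult.assoc)
  have E: "root_esym r = esym [r i, r j, r k, r a, r b, r c]" using ms(4) unfolding m by (simp only: list.map append.simps)
  show ?thesis
    by (rule that[of "esym [r a, r b, r c] 2" "esym [r a, r b, r c] 3"]; unfold E P; rule esym_split3[OF f])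
qed

text \<open>Here the two remaining indices themselves are returned: they name the third line in the
  plane of C_ij and C_kl.\<close>

lemma split4:
  fixes r :: "nat \<Rightarrow> 'a::field"
  assumes sum: "(\<Sum>i\<in>{1..6}. r i) = 0" and i: "i \<in> {1..6}" "j \<in> {1..6}" "k \<in> {1..6}" "l \<in> {1..6}" "distinct [i,j,k,l]"
  obtains m n where "m \<in> {1..6}" "n \<in> {1..6}" "distinct [i,j,k,l,m,n]" "r m + r n = - (r i + r j + r k + r l)"
    "root_esym r 2 = r m * r n + r i * r j + r k * r l + (r i + r j) * (r k + r l) - (r i + r j + r k + r l)^2"
    "root_esym r 3 = (r i + r j + r k + r l) * (r m * r n) - (r i + r j + r k + r l) * (r i * r j + r k * r l + (r i + r j) * (r k + r l)) + (r i + r j) * r k * r l + (r k + r l) * r i * r j"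
    "root_esym r 4 = r m * r n * (r i * r j + r k * r l + (r i + r j) * (r k + r l)) - (r i + r j + r k + r l) * ((r i + r j) * r k * r l + (r k + r l) * r i * r j) + r i * r j * r k * r l"
    "root_esym r 5 = r m * r n * ((r i + r j) * r k * r l + (r k + r l) * r i * r j) - (r i + r j + r k + r l) * r i * r j * r k * r l"
    "root_esym r 6 = r i * r j * r k * r l * (r m * r n)"
proof -
  have "distinct [i,j,k,l]" "set [i,j,k,l] \<subseteq> {1..6}" using i by auto
  from root_esym_split[OF this, of r] obtain ms where ms: "distinct ms" "set ms = {1..6} - set [i,j,k,l]"
    "length ms = 6 - length [i,j,k,l]" "root_esym r = esym (map r [i,j,k,l] @ map r ms)"
    "sum_list (map r [i,j,k,l]) + sum_list (map r ms) = (\<Sum>i\<in>{1..6}. r i)"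
    by blast
  have "length ms = 2" using ms(3) by simp
  then obtain a b where m: "ms = [a,b]"
    by (metis (no_types) list_length2)
  have "r i + r j + r k + r l + r a + r b = 0" using ms(5) unfolding m sum by (simp add: add.assoc)
  then have f: "r b = - r i - r j - r k - r l - r a" by (simp add: eq_neg_iff_add_eq_0 algebra_simps)
  have d: "a \<in> {1..6}" "b \<in> {1..6}" "distinct [i,j,k,l,a,b]"
  proof -
    have ab: "a \<in> {1..6} - set [i,j,k,l]" "b \<in> {1..6} - set [i,j,k,l]" "a \<noteq> b"
      using ms(1) unfolding ms(2)[symmetric] by (simp_all add: m)
    then show "a \<in> {1..6}" "b \<in> {1..6}" "distinct [i,j,k,l,a,b]"
      using i(5) by auto
  qed
  have s: "r a + r b = - (r i + r j + r k + r l)" using f by simp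
  have E: "root_esym r = esym [r i, r j, r k, r l, r a, r b]" using ms(4) unfolding m by (simp only: list.map append.simps)
  show ?thesis
    by (rule that[OF d s]; unfold E; rule esym_split4[OF f])
qed

section \<open>Incidence of the lines\<close>

abbreviation surface_coeffs :: "(nat \<Rightarrow> 'a::comm_ring_1) \<Rightarrow> 'a \<Rightarrow> nat \<Rightarrow> 'a" where
  "surface_coeffs r s \<equiv> coeffs (root_esym r) s"

lemma coeffs_uminus [simp]: "coeffs e (- s) = coeffs e s"
  by (rule ext) (simp add: coeffs_def)

lemma offset_C_uminus [simp]: "offset_C e (- s) = offset_C e s"
  by (intro ext) (simp add: offset_C_def)

lemma offset_C_commute: "offset_C e s x y = offset_C e s y x"
  by (simp add: offset_C_def algebra_simps)

lemma skew_swap: "skewness k u b u' b' = - skewness k u' b' u b"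
  by (simp add: skewness_def algebra_simps)

fun slope :: "(nat \<Rightarrow> 'a::comm_ring_1) \<Rightarrow> 'a \<Rightarrow> schlaefli \<Rightarrow> 'a" where
  "slope r s (LA i) = r i - s"
| "slope r s (LB i) = r i + s"
| "slope r s (LC i j) = - r i - r j"

fun offset :: "(nat \<Rightarrow> 'a::comm_ring_1) \<Rightarrow> 'a \<Rightarrow> schlaefli \<Rightarrow> 'a" where
  "offset r s (LA i) = offset_A (root_esym r) s (r i)"
| "offset r s (LB i) = offset_A (root_esym r) (- s) (r i)"
| "offset r s (LC i j) = offset_C (root_esym r) s (r i) (r j)"

definition on_surface :: "(nat \<Rightarrow> 'a::comm_ring_1) \<Rightarrow> 'a \<Rightarrow> 'a \<Rightarrow> bool" where
  "on_surface k u b \<longleftrightarrow> line_eq1 k u b = 0 \<and> line_eq0 k u b = 0"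

fun label :: "schlaefli \<Rightarrow> bool" where
  "label (LA i) \<longleftrightarrow> i \<in> {1..6}"
| "label (LB i) \<longleftrightarrow> i \<in> {1..6}"
| "label (LC i j) \<longleftrightarrow> i \<in> {1..6} \<and> j \<in> {1..6} \<and> i \<noteq> j"

abbreviation label_skewness :: "(nat \<Rightarrow> 'a::comm_ring_1) \<Rightarrow> 'a \<Rightarrow> schlaefli \<Rightarrow> schlaefli \<Rightarrow> 'a" where
  "label_skewness r s x y \<equiv> skewness (surface_coeffs r s) (slope r s x) (offset r s x) (slope r s y) (offset r s y)"

lemma on_surface_A: "generic r s \<Longrightarrow> i \<in> {1..6} \<Longrightarrow> on_surface (surface_coeffs r s) (r i - s) (offset_A (root_esym r) s (r i))"
  unfolding on_surface_def by (metis split1[OF genericD(3)] line_eq1_A line_eq0_A)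

lemma on_surface_line:
  assumes g: "generic r s" and x: "label x"
  shows "on_surface (surface_coeffs r s) (slope r s x) (offset r s x)"
proof (cases x)
  case (LA i)
  then show ?thesis using on_surface_A[OF g] x by simp
next
  case (LB i)
  then show ?thesis using on_surface_A[OF generic_uminus[OF g]] x by simp
next
  case (LC i j)
  then have ij: "i \<in> {1..6}" "j \<in> {1..6}" "i \<noteq> j" using x by auto
  obtain q2 q3 q4 where q: "root_esym r 2 = q2 - (r i + r j)^2 + r i * r j" "root_esym r 3 = q3 + (r i + r j) * q2 - r i * r j * (r i + r j)"
    "root_esym r 4 = q4 + (r i + r j) * q3 + r i * r j * q2" "root_esym r 5 = (r i + r j) * q4 + r i * r j * q3" "root_esym r 6 = r i * r j * q4"
    "\<And>t. t^4 + (r i + r j) * t^3 + q2 * t^2 - q3 * t + q4 = (\<Prod>k\<in>{1..6}-{i,j}. t - r k)"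
    by (fact split2[OF genericD(3)[OF g] ij])
  show ?thesis using line_eq1_C[OF q(1-5)] line_eq0_C[OF q(1-5)] by (simp add: LC on_surface_def)
qed

lemma meet_A_B:
  assumes g: "generic r s" and ij: "i \<in> {1..6}" "j \<in> {1..6}" "i \<noteq> j"
  shows "label_skewness r s (LA i) (LB j) = 0"
proof -
  obtain q2 q3 q4 where q: "root_esym r 2 = q2 - (r i + r j)^2 + r i * r j" "root_esym r 3 = q3 + (r i + r j) * q2 - r i * r j * (r i + r j)"
    "root_esym r 4 = q4 + (r i + r j) * q3 + r i * r j * q2" "root_esym r 5 = (r i + r j) * q4 + r i * r j * q3" "root_esym r 6 = r i * r j * q4"
    "\<And>t. t^4 + (r i + r j) * t^3 + q2 * t^2 - q3 * t + q4 = (\<Prod>k\<in>{1..6}-{i,j}. t - r k)"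
    by (fact split2[OF genericD(3)[OF g] ij])
  show ?thesis using skewness_AB_eq_0[OF q(1-5)] by simp
qed

lemma meet_A_C:
  assumes g: "generic r s" and ij: "i \<in> {1..6}" "j \<in> {1..6}" "i \<noteq> j"
  shows "label_skewness r s (LA i) (LC i j) = 0"
proof -
  obtain q2 q3 q4 where q: "root_esym r 2 = q2 - (r i + r j)^2 + r i * r j" "root_esym r 3 = q3 + (r i + r j) * q2 - r i * r j * (r i + r j)"
    "root_esym r 4 = q4 + (r i + r j) * q3 + r i * r j * q2" "root_esym r 5 = (r i + r j) * q4 + r i * r j * q3" "root_esym r 6 = r i * r j * q4"
    "\<And>t. t^4 + (r i + r j) * t^3 + q2 * t^2 - q3 * t + q4 = (\<Prod>k\<in>{1..6}-{i,j}. t - r k)"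
    by (fact split2[OF genericD(3)[OF g] ij])
  show ?thesis using skewness_AC_eq_0[OF q(1-5)] by simp
qed

lemma meet_C_C:
  assumes g: "generic r s" and i: "i \<in> {1..6}" "j \<in> {1..6}" "k \<in> {1..6}" "l \<in> {1..6}" "distinct [i,j,k,l]"
  shows "label_skewness r s (LC i j) (LC k l) = 0"
  by (rule split4[OF genericD(3)[OF g] i]) (simp add: skewness_CC_eq_0)

lemma prod_nonzero:
  fixes f :: "'i \<Rightarrow> 'a::field"
  assumes "finite A" "\<And>k. k \<in> A \<Longrightarrow> f k \<noteq> 0"
  shows "(\<Prod>k\<in>A. f k) \<noteq> 0"
  using assms by simp

text \<open>The factors are r_i - r_j, 2 s and s - r_i - r_j - r_k for the four other k, all nonzero
  for generic values.\<close>

lemma skew_A_A: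
  assumes g: "generic r s" and ij: "i \<in> {1..6}" "j \<in> {1..6}" "i \<noteq> j"
  shows "label_skewness r s (LA i) (LA j) \<noteq> 0"
proof -
  obtain q2 q3 q4 where q: "root_esym r 2 = q2 - (r i + r j)^2 + r i * r j" "root_esym r 3 = q3 + (r i + r j) * q2 - r i * r j * (r i + r j)"
    "root_esym r 4 = q4 + (r i + r j) * q3 + r i * r j * q2" "root_esym r 5 = (r i + r j) * q4 + r i * r j * q3" "root_esym r 6 = r i * r j * q4"
    "\<And>t. t^4 + (r i + r j) * t^3 + q2 * t^2 - q3 * t + q4 = (\<Prod>k\<in>{1..6}-{i,j}. t - r k)"
    by (fact split2[OF genericD(3)[OF g] ij])
  have "(\<Prod>k\<in>{1..6}-{i,j}. (s - r i - r j) - r k) \<noteq> 0"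
  proof (rule prod_nonzero)
    fix k assume "k \<in> {1..6} - {i,j}"
    then have "r i + r j + r k \<noteq> s" using genericD(5)[OF g] ij by auto
    then show "s - r i - r j - r k \<noteq> 0" by (auto simp: algebra_simps)
  qed simp
  then show ?thesis
    using skewness_AA[OF q(1-5), of s] genericD(4)[OF g ij] genericD(1,2)[OF g] unfolding q(6) by simp
qed

lemma skew_A_B:
  assumes g: "generic r s" and i: "i \<in> {1..6}"
  shows "label_skewness r s (LA i) (LB i) \<noteq> 0"
proof -
  obtain g2 g3 g4 g5 where q:
    "root_esym r 2 = g2 - (r i)^2" "root_esym r 3 = g3 + r i * g2" "root_esym r 4 = g4 + r i * g3" "root_esym r 5 = g5 + r i * g4" "root_esym r 6 = r i * g5"
    "\<And>t. t^5 + r i * t^4 + g2 * t^3 - g3 * t^2 + g4 * t - g5 = (\<Prod>k\<in>{1..6}-{i}. t - r k)"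
    by (fact split1[OF genericD(3)[OF g] i])
  have "(\<Prod>k\<in>{1..6}-{i}. r i - r k) \<noteq> 0"
    by (rule prod_nonzero) (use genericD(4)[OF g] i in auto)
  then show ?thesis
    using skewness_AB[OF q(1-5), of s] genericD(1,2)[OF g] unfolding q(6) by simp
qed

lemma skew_A_C:
  assumes g: "generic r s" and i: "i \<in> {1..6}" "j \<in> {1..6}" "k \<in> {1..6}" "i \<noteq> j" "i \<noteq> k" "j \<noteq> k"
  shows "label_skewness r s (LA i) (LC j k) \<noteq> 0"
proof -
  obtain h2 h3 where q:
    "root_esym r 2 = h2 - (r i + r j + r k)^2 + (r i * r j + r i * r k + r j * r k)"
    "root_esym r 3 = h3 + (r i + r j + r k) * h2 - (r i * r j + r i * r k + r j * r k) * (r i + r j + r k) + r i * r j * r k"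
    "root_esym r 4 = (r i + r j + r k) * h3 + (r i * r j + r i * r k + r j * r k) * h2 - r i * r j * r k * (r i + r j + r k)"
    "root_esym r 5 = (r i * r j + r i * r k + r j * r k) * h3 + r i * r j * r k * h2" "root_esym r 6 = r i * r j * r k * h3"
    "\<And>t. t^3 + (r i + r j + r k) * t^2 + h2 * t - h3 = (\<Prod>l\<in>{1..6}-{i,j,k}. t - r l)"
    by (fact split3[OF genericD(3)[OF g] i])
  \<comment> \<open>At this t the polynomial of \<open>split3\<close>, whose roots are the remaining
    r_l, is minus the cubic factor in \<open>skewness_AC\<close>.\<close>
  define t where "t = - (r j + r k + s)"
  have "(r j + r k + s)^3 - (r i + r j + r k) * (r j + r k + s)^2 + h2 * (r j + r k + s) + h3 =
     - (t^3 + (r i + r j + r k) * t^2 + h2 * t - h3)"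
    unfolding t_def by (simp add: power2_eq_square power3_eq_cube algebra_simps)
  also have "\<dots> = - (\<Prod>l\<in>{1..6}-{i,j,k}. t - r l)" unfolding q(6) ..
  also have "\<dots> \<noteq> 0"
  proof -
    have "(\<Prod>l\<in>{1..6}-{i,j,k}. t - r l) \<noteq> 0"
    proof (rule prod_nonzero)
      fix l assume "l \<in> {1..6} - {i,j,k}"
      then have "r j + r k + r l \<noteq> - s" using genericD(6)[OF g] i by auto
      then have "r j + r k + r l + s \<noteq> 0" by (simp add: eq_neg_iff_add_eq_0)
      moreover have "t - r l = - (r j + r k + r l + s)" by (simp add: t_def)
      ultimately show "t - r l \<noteq> 0" by (metis neg_equal_0_iff_equal)
    qed simp
    then show ?thesis by simp
  qed
  finally have *: "(r j + r k + s)^3 - (r i + r j + r k) * (r j + r k + s)^2 + h2 * (r j + r k + s) + h3 \<noteq> 0" .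
  have "r i + r j + r k \<noteq> s" using genericD(5)[OF g] i by auto
  then show ?thesis
    using skewness_AC[OF q(1-5), of s] * genericD(4)[OF g] i by simp
qed

lemma skew_C_C:
  assumes g: "generic r s" and i: "i \<in> {1..6}" "j \<in> {1..6}" "k \<in> {1..6}" "i \<noteq> j" "i \<noteq> k" "j \<noteq> k"
  shows "label_skewness r s (LC i j) (LC i k) \<noteq> 0"
proof -
  obtain h2 h3 where q:
    "root_esym r 2 = h2 - (r i + r j + r k)^2 + (r i * r j + r i * r k + r j * r k)"
    "root_esym r 3 = h3 + (r i + r j + r k) * h2 - (r i * r j + r i * r k + r j * r k) * (r i + r j + r k) + r i * r j * r k"
    "root_esym r 4 = (r i + r j + r k) * h3 + (r i * r j + r i * r k + r j * r k) * h2 - r i * r j * r k * (r i + r j + r k)"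
    "root_esym r 5 = (r i * r j + r i * r k + r j * r k) * h3 + r i * r j * r k * h2" "root_esym r 6 = r i * r j * r k * h3"
    "\<And>t. t^3 + (r i + r j + r k) * t^2 + h2 * t - h3 = (\<Prod>l\<in>{1..6}-{i,j,k}. t - r l)"
    by (fact split3[OF genericD(3)[OF g] i])
  have "(\<Prod>l\<in>{1..6}-{i,j,k}. r i - r l) \<noteq> 0"
    by (rule prod_nonzero) (use genericD(4)[OF g] i in auto)
  moreover have "r i + r j + r k \<noteq> s" "r i + r j + r k \<noteq> - s" using genericD(5,6)[OF g] i by auto
  then have "r i + r j + r k - s \<noteq> 0" "r i + r j + r k + s \<noteq> 0" by (auto simp: eq_neg_iff_add_eq_0)
  ultimately show ?thesis
    using skewness_CC[OF q(1-5), of s] genericD(4)[OF g i(2,3,6)] unfolding q(6) by simp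
qed

lemma LC_commute: "slope r s (LC i j) = slope r s (LC j i)" "offset r s (LC i j) = offset r s (LC j i)"
  by (simp_all add: offset_C_commute)

text \<open>Changing the sign of s interchanges A and B and preserves the surface and the C_ij, so
  most statements for B follow from those for A; the order of a pair is reversed by the antisymmetry
  of the skewness.\<close>

lemma pairing_cases:
  assumes g: "generic r s" and x: "label x" "label y"
  shows "(schlaefli_pairing x y = 1 \<longrightarrow> label_skewness r s x y = 0) \<and> (schlaefli_pairing x y = 0 \<longrightarrow> label_skewness r s x y \<noteq> 0)"
proof -
  note g' = generic_uminus[OF g]
  have BB: "label_skewness r s (LB i) (LB j) \<noteq> 0" if "i \<in> {1..6}" "j \<in> {1..6}" "i \<noteq> j" for i j
    using skew_A_A[OF g' that] by simp
  have BC: "label_skewness r s (LB i) (LC i j) = 0" if "i \<in> {1..6}" "j \<in> {1..6}" "i \<noteq> j" for i j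
    using meet_A_C[OF g' that] by simp
  have BC': "label_skewness r s (LB i) (LC j k) \<noteq> 0" if "i \<in> {1..6}" "j \<in> {1..6}" "k \<in> {1..6}" "i \<noteq> j" "i \<noteq> k" "j \<noteq> k" for i j k
    using skew_A_C[OF g' that] by simp
  have AC2: "label_skewness r s (LA i) (LC j i) = 0" if "i \<in> {1..6}" "j \<in> {1..6}" "i \<noteq> j" for i j
    unfolding LC_commute[of r s j i] by (rule meet_A_C[OF g that])
  have BC2: "label_skewness r s (LB i) (LC j i) = 0" if "i \<in> {1..6}" "j \<in> {1..6}" "i \<noteq> j" for i j
    unfolding LC_commute[of r s j i] by (rule BC[OF that])
  have S0: "label_skewness r s x y = 0 \<longleftrightarrow> label_skewness r s y x = 0" for x y
    by (subst skew_swap) simp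
  have CC: "label_skewness r s (LC i j) (LC k l) \<noteq> 0"
    if c: "i \<in> {1..6}" "j \<in> {1..6}" "k \<in> {1..6}" "l \<in> {1..6}" "i \<noteq> j" "k \<noteq> l" "{i,j} \<noteq> {k,l}" "{i,j} \<inter> {k,l} \<noteq> {}" for i j k l
  proof -
    have C: "label_skewness r s (LC a c) (LC a d) \<noteq> 0 \<and> label_skewness r s (LC c a) (LC a d) \<noteq> 0 \<and> label_skewness r s (LC a c) (LC d a) \<noteq> 0
        \<and> label_skewness r s (LC c a) (LC d a) \<noteq> 0"
      if "a \<in> {1..6}" "c \<in> {1..6}" "d \<in> {1..6}" "a \<noteq> c" "a \<noteq> d" "c \<noteq> d" for a c d
      using skew_C_C[OF g that] unfolding LC_commute[of r s c a] LC_commute[of r s d a] by blast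
    consider "i = k" | "i = l" | "j = k" | "j = l" using c(8) by auto
    then show ?thesis
    proof cases
      case 1 then show ?thesis using C[of i j l] c by auto
    next
      case 2 then show ?thesis using C[of i j k] c by auto
    next
      case 3 then show ?thesis using C[of j i l] c by auto
    next
      case 4 then show ?thesis using C[of j i k] c by auto
    qed
  qed
  have AB: "label_skewness r s (LA i) (LB j) = 0" if "i \<in> {1..6}" "j \<in> {1..6}" "i \<noteq> j" for i j
    using meet_A_B[OF g that] .
  show ?thesis
  proof (cases x)
    case X: (LA i)
    show ?thesis
    proof (cases y)
      case (LA j) then show ?thesis using skew_A_A[OF g, of i j] x X by auto
    next
      case (LB j) then show ?thesis using skew_A_B[OF g, of i] AB[of i j] x X by (cases "i = j") auto
    next
      case (LC j k) then show ?thesis using skew_A_C[OF g, of i j k] meet_A_C[OF g, of i k] AC2[of i j] x X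
        by (cases "i = j"; cases "i = k") auto
    qed
  next
    case X: (LB i)
    show ?thesis
    proof (cases y)
      case (LA j) then show ?thesis unfolding S0[of x y] using skew_A_B[OF g, of i] AB[of j i] x X by (cases "i = j") auto
    next
      case (LB j) then show ?thesis using BB[of i j] x X by auto
    next
      case (LC j k) then show ?thesis using BC'[of i j k] BC[of i k] BC2[of i j] x X
        by (cases "i = j"; cases "i = k") auto
    qed
  next
    case X: (LC i j)
    show ?thesis
    proof (cases y)
      case (LA k) then show ?thesis unfolding S0[of x y] using skew_A_C[OF g, of k i j] meet_A_C[OF g, of k j] AC2[of k i] x X
        by (cases "k = i"; cases "k = j") auto
    next
      case (LB k) then show ?thesis unfolding S0[of x y] using BC'[of k i j] BC[of k j] BC2[of k i] x X
        by (cases "k = i"; cases "k = j") auto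
    next
      case (LC k l)
      then have *: "i \<in> {1..6}" "j \<in> {1..6}" "k \<in> {1..6}" "l \<in> {1..6}" "i \<noteq> j" "k \<noteq> l" using x X by auto
      show ?thesis unfolding X LC schlaefli_pairing.simps
        using CC[OF *] meet_C_C[OF g *(1-4)] *(5,6) by auto
    qed
  qed
qed

section \<open>Completeness of the 27 lines and smoothness\<close>

text \<open>A line meeting the line (u0, b0) lies with it in the plane of slope m, where it is given
  by p = (u - u0) z + (b - b0) w. It lies on the surface but is not the line p = 0, so it is a
  component of the residual conic. The two equations are the coefficients of z w and w^2 in this
  condition; that of z^2 vanishes by the choice of m.\<close>

lemma line_in_plane:
  fixes k :: "nat \<Rightarrow> 'a::field"
  assumes two: "(2::'a) \<noteq> 0" and on0: "on_surface k u0 b0" and on: "on_surface k u b"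
    and sk: "skewness k u0 b0 u b = 0" and ne: "(u, b) \<noteq> (u0, b0)"
    and m: "m = u0^2 + u0 * u + u^2"
  shows "2 * (u - u0) * (b - b0) + 3 * u0 * (b - b0) + conic1 k u0 b0 m * (u - u0) + conic2 k u0 b0 m = 0"
    and "(b - b0)^2 + conic1 k u0 b0 m * (b - b0) + conic0 k u0 b0 m = 0"
proof -
  define k1 where "k1 = u - u0"
  define k2 where "k2 = b - b0"
  define B where "B = 2 * k1 * k2 + 3 * u0 * k2 + conic1 k u0 b0 m * k1 + conic2 k u0 b0 m"
  define C where "C = k2^2 + conic1 k u0 b0 m * k2 + conic0 k u0 b0 m"
  have i: "intercept k u b = intercept k u0 b0 + m * k2"
    using sk unfolding skewness_def m k2_def by (simp add: algebra_simps)
  have P: "(k1 * z + k2 * w) * (B * z * w + C * w^2) = 0" for z w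
  proof -
    define p where "p = k1 * z + k2 * w"
    have 1: "u * z + b * w = u0 * z + b0 * w + p" by (simp add: p_def k1_def k2_def algebra_simps)
    have 2: "u^3 * z + intercept k u b * w = u0^3 * z + intercept k u0 b0 * w + m * p"
      unfolding i unfolding p_def m k1_def by (simp add: algebra_simps power2_eq_square power3_eq_cube)
    have "0 = p * conic k u0 b0 m p z w"
      using on on0 cubic_line[of k u z b w] cubic_line[of k u0 z b0 w] cubic_plane[of k u0 z b0 w p m]
      unfolding on_surface_def 1 2 by simp
    moreover have "conic k u0 b0 m p z w = B * z * w + C * w^2"
      unfolding conic_def B_def C_def p_def k1_def m by (simp add: algebra_simps power2_eq_square)
    ultimately show ?thesis by (simp add: p_def)
  qed
  \<comment> \<open>For w = 1 the product has degree at most 2 in z, so its values at 0, 1, -1,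
    which are distinct because 2 is nonzero, determine its coefficients.\<close>
  have e1: "k2 * C = 0" using P[of 0 1] by simp
  have e2: "(k1 + k2) * (B + C) = 0" using P[of 1 1] by simp
  have e3: "(k2 - k1) * (C - B) = 0" using P[of "-1" 1] by simp
  have "2 * (k1 * B) = (k1 + k2) * (B + C) + (k2 - k1) * (C - B) - 2 * (k2 * C)" by (simp add: algebra_simps)
  then have e4: "k1 * B = 0" using e1 e2 e3 two by simp
  have "k1 * C + k2 * B = (k1 + k2) * (B + C) - k1 * B - k2 * C" by (simp add: algebra_simps)
  then have e5: "k1 * C + k2 * B = 0" using e1 e2 e4 by simp
  have "k1 \<noteq> 0 \<or> k2 \<noteq> 0" using ne by (auto simp: k1_def k2_def)
  then have "B = 0 \<and> C = 0" using e1 e4 e5 by auto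
  then show "2 * (u - u0) * (b - b0) + 3 * u0 * (b - b0) + conic1 k u0 b0 m * (u - u0) + conic2 k u0 b0 m = 0"
    "(b - b0)^2 + conic1 k u0 b0 m * (b - b0) + conic0 k u0 b0 m = 0"
    unfolding B_def C_def k1_def k2_def by auto
qed

text \<open>A conic that contains a line is degenerate. The two equations are solved for
  \<open>conic2\<close> and \<open>conic0\<close>, and the rest is an identity.\<close>

lemma conic_disc_eq_0:
  fixes k :: "nat \<Rightarrow> 'a::comm_ring_1"
  assumes B: "2 * (u - u0) * (b - b0) + 3 * u0 * (b - b0) + conic1 k u0 b0 m * (u - u0) + conic2 k u0 b0 m = 0"
    and C: "(b - b0)^2 + conic1 k u0 b0 m * (b - b0) + conic0 k u0 b0 m = 0"
    and m: "m = u0^2 + u0 * u + u^2"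
  shows "conic_disc k u0 b0 m = 0"
proof -
  have *: "4 * (3 * u0^2 - (u0^2 + u0 * (u0 + p) + (u0 + p)^2)) * (- (q^2) - c * q) + 3 * u0 * c * (- 2 * p * q - 3 * u0 * q - c * p)
     - (- 2 * p * q - 3 * u0 * q - c * p)^2 - (3 * u0^2 - (u0^2 + u0 * (u0 + p) + (u0 + p)^2)) * c^2 - 9 * u0^2 * (- (q^2) - c * q) = 0" for p q c u0 :: 'a
    by (reify ring_reify, rule ring_eqI, simp, code_simp)
  have u: "u = u0 + (u - u0)" by simp
  have c2: "conic2 k u0 b0 m = - 2 * (u - u0) * (b - b0) - 3 * u0 * (b - b0) - conic1 k u0 b0 m * (u - u0)"
    using B by (simp add: algebra_simps eq_neg_iff_add_eq_0)
  have c0: "conic0 k u0 b0 m = - ((b - b0)^2) - conic1 k u0 b0 m * (b - b0)"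
    using C by (simp add: algebra_simps eq_neg_iff_add_eq_0)
  show ?thesis unfolding conic_disc_def c2 c0
    using *[of u0 "u - u0" "b - b0" "conic1 k u0 b0 m"] unfolding m by simp
qed

text \<open>The conic splits into the lines (u1, b1) and (u2, b2), and (u, b) is a component of it.
  The equation \<open>C\<close> forces b to be b1 or b2; a mixed pair such as (u1, b2) satisfies
  \<open>B\<close> only if the two lines agree in one parameter.\<close>

lemma residual_line:
  fixes k :: "nat \<Rightarrow> 'a::field"
  assumes B: "2 * (u - u0) * (b - b0) + 3 * u0 * (b - b0) + conic1 k u0 b0 m * (u - u0) + conic2 k u0 b0 m = 0"
    and C: "(b - b0)^2 + conic1 k u0 b0 m * (b - b0) + conic0 k u0 b0 m = 0"
    and u: "u = u1 \<or> u = u2" and sum: "u0 + u1 + u2 = 0"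
    and f: "conic1 k u0 b0 m = - (b1 - b0) - (b2 - b0)"
      "conic2 k u0 b0 m = (u1 - u0) * (b2 - b0) + (u2 - u0) * (b1 - b0)"
      "conic0 k u0 b0 m = (b1 - b0) * (b2 - b0)"
  shows "(u = u1 \<and> b = b1) \<or> (u = u2 \<and> b = b2)"
proof -
  have "(b - b1) * (b - b2) = 0" using C unfolding f by (simp add: algebra_simps power2_eq_square)
  then have bb: "b = b1 \<or> b = b2" by auto
  have u2: "u2 = - u0 - u1" using sum by (simp add: algebra_simps eq_neg_iff_add_eq_0)
  have *: "b1 = b2 \<or> u1 = u2" if "u = u1" "b = b2"
  proof -
    have "(b2 - b1) * (u1 - u2) = 0"
      using B unfolding f that unfolding u2 by (simp add: algebra_simps)
    then show ?thesis by auto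
  qed
  have **: "b1 = b2 \<or> u1 = u2" if "u = u2" "b = b1"
  proof -
    have "(b2 - b1) * (u1 - u2) = 0"
      using B unfolding f that unfolding u2 by (simp add: algebra_simps)
    then show ?thesis by auto
  qed
  show ?thesis using bb u * ** by auto
qed

lemma plane_A_B:
  assumes g: "generic r s" and ij: "i \<in> {1..6}" "j \<in> {1..6}" "i \<noteq> j"
    and m: "m = (slope r s (LA i))^2 + slope r s (LA i) * slope r s (LB j) + (slope r s (LB j))^2"
  shows "conic1 (surface_coeffs r s) (slope r s (LA i)) (offset r s (LA i)) m
      = - (offset r s (LB j) - offset r s (LA i)) - (offset r s (LC i j) - offset r s (LA i))"
    "conic2 (surface_coeffs r s) (slope r s (LA i)) (offset r s (LA i)) m
      = (slope r s (LB j) - slope r s (LA i)) * (offset r s (LC i j) - offset r s (LA i))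
        + (slope r s (LC i j) - slope r s (LA i)) * (offset r s (LB j) - offset r s (LA i))"
    "conic0 (surface_coeffs r s) (slope r s (LA i)) (offset r s (LA i)) m
      = (offset r s (LB j) - offset r s (LA i)) * (offset r s (LC i j) - offset r s (LA i))"
proof -
  obtain q2 q3 q4 where q: "root_esym r 2 = q2 - (r i + r j)^2 + r i * r j" "root_esym r 3 = q3 + (r i + r j) * q2 - r i * r j * (r i + r j)"
    "root_esym r 4 = q4 + (r i + r j) * q3 + r i * r j * q2" "root_esym r 5 = (r i + r j) * q4 + r i * r j * q3" "root_esym r 6 = r i * r j * q4"
    "\<And>t. t^4 + (r i + r j) * t^3 + q2 * t^2 - q3 * t + q4 = (\<Prod>k\<in>{1..6}-{i,j}. t - r k)"
    by (fact split2[OF genericD(3)[OF g] ij])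
  show "conic1 (surface_coeffs r s) (slope r s (LA i)) (offset r s (LA i)) m
      = - (offset r s (LB j) - offset r s (LA i)) - (offset r s (LC i j) - offset r s (LA i))"
    unfolding m slope.simps offset.simps by (rule tri_ABC1[OF q(1-5)])
  show "conic2 (surface_coeffs r s) (slope r s (LA i)) (offset r s (LA i)) m
      = (slope r s (LB j) - slope r s (LA i)) * (offset r s (LC i j) - offset r s (LA i))
        + (slope r s (LC i j) - slope r s (LA i)) * (offset r s (LB j) - offset r s (LA i))"
    unfolding m slope.simps offset.simps by (rule tri_ABC2[OF q(1-5)])
  show "conic0 (surface_coeffs r s) (slope r s (LA i)) (offset r s (LA i)) m
      = (offset r s (LB j) - offset r s (LA i)) * (offset r s (LC i j) - offset r s (LA i))"
    unfolding m slope.simps offset.simps by (rule tri_ABC0[OF q(1-5)])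
qed

lemma conic_disc_zeros:
  assumes g: "generic r s" and i: "i \<in> {1..6}"
    and m: "m = (r i - s)^2 + (r i - s) * u + u^2"
    and d: "conic_disc (surface_coeffs r s) (r i - s) (offset_A (root_esym r) s (r i)) m = 0"
  shows "\<exists>j\<in>{1..6}-{i}. u = r j + s \<or> u = - r i - r j"
proof -
  obtain g2 g3 g4 g5 where q:
    "root_esym r 2 = g2 - (r i)^2" "root_esym r 3 = g3 + r i * g2" "root_esym r 4 = g4 + r i * g3" "root_esym r 5 = g5 + r i * g4" "root_esym r 6 = r i * g5"
    "\<And>t. t^5 + r i * t^4 + g2 * t^3 - g3 * t^2 + g4 * t - g5 = (\<Prod>k\<in>{1..6}-{i}. t - r k)"
    by (fact split1[OF genericD(3)[OF g] i])
  have "- (\<Prod>k\<in>{1..6}-{i}. (u - s) - r k) * (\<Prod>k\<in>{1..6}-{i}. (- (u - s) - s - r i) - r k) = 0"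
    using conic_disc_A[OF q(1-5), of s "u - s"] d unfolding m q(6) by simp
  then have "(\<exists>j\<in>{1..6}-{i}. (u - s) - r j = 0) \<or> (\<exists>j\<in>{1..6}-{i}. (- (u - s) - s - r i) - r j = 0)"
    unfolding mult_eq_0_iff neg_equal_0_iff_equal by (subst (asm) (1 2) prod_zero_iff) simp_all
  then obtain j where j: "j \<in> {1..6} - {i}" "(u - s) - r j = 0 \<or> (- (u - s) - s - r i) - r j = 0"
    by blast
  from j(2) have "u = r j + s \<or> u = - r i - r j"
  proof
    assume "u - s - r j = 0" then show ?thesis by (simp add: algebra_simps)
  next
    assume "- (u - s) - s - r i - r j = 0"
    then have "- u = r i + r j" by (simp add: algebra_simps)
    then have "u = - (r i + r j)" by (metis minus_minus)
    then show ?thesis by simp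
  qed
  then show ?thesis using j(1) by blast
qed

text \<open>The residual conic of A_i in the plane spanned by the two lines is degenerate, so the
  plane is one of the five that contain some B_j and C_ij, and the line is one of these two.\<close>

lemma line_meeting_A:
  assumes g: "generic r s" and i: "i \<in> {1..6}" and on: "on_surface (surface_coeffs r s) u b"
    and sk: "skewness (surface_coeffs r s) (slope r s (LA i)) (offset r s (LA i)) u b = 0"
  shows "\<exists>x. label x \<and> u = slope r s x \<and> b = offset r s x"
proof (cases "(u, b) = (slope r s (LA i), offset r s (LA i))")
  case True
  then show ?thesis using i by (intro exI[of _ "LA i"]) auto
next
  case False
  let ?u0 = "slope r s (LA i)" and ?b0 = "offset r s (LA i)"
  define m where "m = ?u0^2 + ?u0 * u + u^2"
  have on0: "on_surface (surface_coeffs r s) ?u0 ?b0" using on_surface_line[OF g, of "LA i"] i by simp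
  note BC = line_in_plane[OF genericD(1)[OF g] on0 on sk False m_def]
  have "conic_disc (surface_coeffs r s) ?u0 ?b0 m = 0" by (rule conic_disc_eq_0[OF BC m_def])
  then obtain j where j: "j \<in> {1..6} - {i}" "u = slope r s (LB j) \<or> u = slope r s (LC i j)"
    using conic_disc_zeros[OF g i, of m u] unfolding m_def slope.simps offset.simps by blast
  have sum: "?u0 + slope r s (LB j) + slope r s (LC i j) = 0" by simp
  \<comment> \<open>The plane is the same whether u belongs to B_j or to C_ij, as the three
    parameters add up to 0.\<close>
  have m2: "m = ?u0^2 + ?u0 * slope r s (LB j) + (slope r s (LB j))^2"
    using j(2)
  proof
    assume e: "u = slope r s (LB j)"
    show ?thesis unfolding m_def e ..
  next
    assume e: "u = slope r s (LC i j)"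
    show ?thesis unfolding m_def e by (simp add: power2_eq_square algebra_simps)
  qed
  have ij: "j \<in> {1..6}" "i \<noteq> j" using j by auto
  have "(u = slope r s (LB j) \<and> b = offset r s (LB j)) \<or> (u = slope r s (LC i j) \<and> b = offset r s (LC i j))"
    by (rule residual_line[OF BC j(2) sum plane_A_B[OF g i ij m2]])
  then show ?thesis using i ij by (metis label.simps(2,3))
qed

text \<open>This is the case of A_i for - s, with A and B exchanged back in the answer.\<close>

lemma line_meeting_B:
  assumes g: "generic r s" and i: "i \<in> {1..6}" and on: "on_surface (surface_coeffs r s) u b"
    and sk: "skewness (surface_coeffs r s) (slope r s (LB i)) (offset r s (LB i)) u b = 0"
  shows "\<exists>x. label x \<and> u = slope r s x \<and> b = offset r s x"
proof -
  have "\<exists>x. label x \<and> u = slope r (- s) x \<and> b = offset r (- s) x"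
    using line_meeting_A[OF generic_uminus[OF g] i, of u b] on sk by simp
  then obtain x where x: "label x" "u = slope r (- s) x" "b = offset r (- s) x" by blast
  have "\<exists>y. label y \<and> slope r (- s) x = slope r s y \<and> offset r (- s) x = offset r s y"
  proof (cases x)
    case (LA i) then show ?thesis using x(1) by (intro exI[of _ "LB i"]) simp
  next
    case (LB i) then show ?thesis using x(1) by (intro exI[of _ "LA i"]) simp
  next
    case (LC i j) then show ?thesis using x(1) by (intro exI[of _ "LC i j"]) simp
  qed
  then show ?thesis using x by auto
qed

text \<open>For u = u' the lines share (u, u^3, 1, 0) and the skewness vanishes identically.
  Otherwise w is nonzero, and w times the skewness is a combination of the differences of the
  coordinates.\<close>

lemma skew_eq_0_if_common_point:
  fixes k :: "nat \<Rightarrow> 'a::field"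
  assumes "(z, w) \<noteq> (0, 0)" "u * z + b * w = u' * z + b' * w"
    "u^3 * z + intercept k u b * w = u'^3 * z + intercept k u' b' * w"
  shows "skewness k u b u' b' = 0"
proof (cases "u = u'")
  case True
  then show ?thesis by (simp add: skewness_def intercept_def power2_eq_square algebra_simps)
next
  case False
  have w: "w \<noteq> 0" using assms False by auto
  have "skewness k u b u' b' * w = (u^3 * z + intercept k u b * w) - (u'^3 * z + intercept k u' b' * w)
     - (u^2 + u * u' + u'^2) * ((u * z + b * w) - (u' * z + b' * w))"
    unfolding skewness_def by (simp add: algebra_simps power2_eq_square power3_eq_cube)
  then have "skewness k u b u' b' * w = 0" using assms(2,3) by simp
  then show ?thesis using w by simp
qed

lemma intercept_of_meet:
  assumes "skewness k u b u' b' = 0"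
  shows "intercept k u' b' = intercept k u b + (u^2 + u * u' + u'^2) * (b' - b)"
  using assms unfolding skewness_def by (simp add: algebra_simps)

lemma conic_factors:
  fixes k :: "nat \<Rightarrow> 'a::comm_ring_1"
  assumes sum: "u0 + u1 + u2 = 0" and m: "m = u0^2 + u0 * u1 + u1^2"
    and f: "conic1 k u0 b0 m = - (b1 - b0) - (b2 - b0)"
      "conic2 k u0 b0 m = (u1 - u0) * (b2 - b0) + (u2 - u0) * (b1 - b0)"
      "conic0 k u0 b0 m = (b1 - b0) * (b2 - b0)"
  shows "conic k u0 b0 m p z w = (p - (u1 - u0) * z - (b1 - b0) * w) * (p - (u2 - u0) * z - (b2 - b0) * w)"
proof -
  have u2: "u2 = - u0 - u1" using sum by (simp add: algebra_simps eq_neg_iff_add_eq_0)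
  show ?thesis unfolding conic_def f unfolding u2 m by (simp add: algebra_simps power2_eq_square)
qed

lemma exists_kernel_vector:
  fixes c d :: "'a::field"
  obtains z w where "(z, w) \<noteq> (0, 0)" "c * z + d * w = 0"
proof (cases "c = 0 \<and> d = 0")
  case True then show ?thesis using that[of 1 0] by simp
next
  case False then show ?thesis using that[of d "- c"] by (auto simp: algebra_simps)
qed

text \<open>A line meets every plane in some point. Here that point lies on the surface and in the
  plane of A_i, B_j, C_ij, which cuts the surface exactly in these three lines, so the line meets
  one of them.\<close>

lemma meets_tritangent_plane:
  assumes g: "generic r s" and ij: "i \<in> {1..6}" "j \<in> {1..6}" "i \<noteq> j" and on: "on_surface (surface_coeffs r s) u b"
  shows "skewness (surface_coeffs r s) (slope r s (LA i)) (offset r s (LA i)) u b = 0 \<or>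
    skewness (surface_coeffs r s) (slope r s (LB j)) (offset r s (LB j)) u b = 0 \<or>
    skewness (surface_coeffs r s) (slope r s (LC i j)) (offset r s (LC i j)) u b = 0"
proof -
  define k where "k = surface_coeffs r s"
  define u0 where "u0 = slope r s (LA i)"
  define b0 where "b0 = offset r s (LA i)"
  define u1 where "u1 = slope r s (LB j)"
  define b1 where "b1 = offset r s (LB j)"
  define u2 where "u2 = slope r s (LC i j)"
  define b2 where "b2 = offset r s (LC i j)"
  note defs = k_def u0_def b0_def u1_def b1_def u2_def b2_def
  define m where "m = u0^2 + u0 * u1 + u1^2"
  have sum: "u0 + u1 + u2 = 0" by (simp add: defs)
  have m': "m = u0^2 + u0 * u2 + u2^2" unfolding m_def using sum by (simp add: defs algebra_simps power2_eq_square)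
  have on0: "on_surface k u0 b0" using on_surface_line[OF g, of "LA i"] ij unfolding defs by simp
  have i1: "intercept k u1 b1 = intercept k u0 b0 + m * (b1 - b0)"
    unfolding m_def by (rule intercept_of_meet) (use meet_A_B[OF g ij] in \<open>simp add: defs\<close>)
  have i2: "intercept k u2 b2 = intercept k u0 b0 + m * (b2 - b0)"
    unfolding m' by (rule intercept_of_meet) (use meet_A_C[OF g ij] in \<open>simp add: defs\<close>)
  \<comment> \<open>The equation says that the point of the line with coordinates z, w lies in the
    plane of slope m.\<close>
  obtain z w where zw: "(z, w) \<noteq> (0, 0)"
    "((u^3 - u0^3) - m * (u - u0)) * z + ((intercept k u b - intercept k u0 b0) - m * (b - b0)) * w = 0"
    by (rule exists_kernel_vector)
  define p where "p = (u - u0) * z + (b - b0) * w"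
  have T: "u * z + b * w = u0 * z + b0 * w + p" by (simp add: p_def algebra_simps)
  have Y: "u^3 * z + intercept k u b * w = u0^3 * z + intercept k u0 b0 * w + m * p"
    using zw(2) by (simp add: p_def algebra_simps)
  have "p * conic k u0 b0 m p z w = 0"
    using on on0 cubic_line[of k u z b w] cubic_line[of k u0 z b0 w] cubic_plane[of k u0 z b0 w p m]
    unfolding on_surface_def T Y k_def[symmetric] by simp
  moreover have "conic k u0 b0 m p z w = (p - (u1 - u0) * z - (b1 - b0) * w) * (p - (u2 - u0) * z - (b2 - b0) * w)"
    using sum m_def plane_A_B[OF g ij, of m] by (intro conic_factors) (simp_all add: defs)
  ultimately have "p = 0 \<or> p - (u1 - u0) * z - (b1 - b0) * w = 0 \<or> p - (u2 - u0) * z - (b2 - b0) * w = 0"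
    by simp
  then consider "p = 0" | "p = (u1 - u0) * z + (b1 - b0) * w" | "p = (u2 - u0) * z + (b2 - b0) * w"
    unfolding diff_diff_eq right_minus_eq by blast
  then show ?thesis
    unfolding defs(1)[symmetric] u0_def[symmetric] b0_def[symmetric] u1_def[symmetric] b1_def[symmetric] u2_def[symmetric] b2_def[symmetric]
  proof cases
    case 1
    have "skewness k u0 b0 u b = 0" by (rule skew_eq_0_if_common_point[OF zw(1)]) (simp_all add: T Y 1)
    then show "skewness k u0 b0 u b = 0 \<or> skewness k u1 b1 u b = 0 \<or> skewness k u2 b2 u b = 0" by blast
  next
    case 2
    have "skewness k u1 b1 u b = 0"
    proof (rule skew_eq_0_if_common_point[OF zw(1)])
      show "u1 * z + b1 * w = u * z + b * w" unfolding T 2 by (simp add: algebra_simps)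
      show "u1^3 * z + intercept k u1 b1 * w = u^3 * z + intercept k u b * w" unfolding Y 2 i1 unfolding m_def
        by (simp add: algebra_simps power2_eq_square power3_eq_cube)
    qed
    then show "skewness k u0 b0 u b = 0 \<or> skewness k u1 b1 u b = 0 \<or> skewness k u2 b2 u b = 0" by blast
  next
    case 3
    have "skewness k u2 b2 u b = 0"
    proof (rule skew_eq_0_if_common_point[OF zw(1)])
      show "u2 * z + b2 * w = u * z + b * w" unfolding T 3 by (simp add: algebra_simps)
      show "u2^3 * z + intercept k u2 b2 * w = u^3 * z + intercept k u b * w" unfolding Y 3 i2 unfolding m'
        by (simp add: algebra_simps power2_eq_square power3_eq_cube)
    qed
    then show "skewness k u0 b0 u b = 0 \<or> skewness k u1 b1 u b = 0 \<or> skewness k u2 b2 u b = 0" by blast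
  qed
qed

section \<open>Exclusion of lines that meet no A_i and no B_i\<close>

text \<open>Three lines that meet in pairs are coplanar or concurrent. The first alternative says
  that their traces on the cuspidal cubic are collinear, the second that they have a common point;
  the product of both conditions is a combination of the skewnesses.\<close>

lemma three_meeting_lines:
  fixes k :: "nat \<Rightarrow> 'a::field"
  assumes "skewness k u0 b0 u1 b1 = 0" "skewness k u1 b1 u b = 0" "skewness k u0 b0 u b = 0"
  shows "u0 + u1 + u = 0 \<or> (b1 - b0) * (u - u0) = (b - b0) * (u1 - u0)"
proof -
  have "(u0 + u1 + u) * ((b1 - b0) * (u - u0) - (b - b0) * (u1 - u0)) =
    skewness k u0 b0 u b - skewness k u0 b0 u1 b1 - skewness k u1 b1 u b"
    unfolding skewness_def by (simp add: algebra_simps power2_eq_square)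
  then show ?thesis using assms by simp
qed

text \<open>The same identity read backwards: two lines through one point of a third line
  meet.\<close>

lemma skew_of_concurrent:
  fixes k :: "nat \<Rightarrow> 'a::field"
  assumes "skewness k u0 b0 u1 b1 = 0" "skewness k u0 b0 u2 b2 = 0" "(u1 - u0) * (b2 - b0) = (u2 - u0) * (b1 - b0)"
  shows "skewness k u1 b1 u2 b2 = 0"
proof -
  have "skewness k u1 b1 u2 b2 = - skewness k u0 b0 u1 b1 + skewness k u0 b0 u2 b2
     + (u0 + u1 + u2) * ((u1 - u0) * (b2 - b0) - (u2 - u0) * (b1 - b0))"
    unfolding skewness_def by (simp add: algebra_simps power2_eq_square)
  then show ?thesis using assms by simp
qed

lemma plane_C_C:
  fixes r :: "nat \<Rightarrow> 'a::field"
  assumes g: "generic r s" and i: "i \<in> {1..6}" "j \<in> {1..6}" "k \<in> {1..6}" "l \<in> {1..6}" "distinct [i,j,k,l]"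
    and m: "m = (slope r s (LC i j))^2 + slope r s (LC i j) * slope r s (LC k l) + (slope r s (LC k l))^2"
  obtains n n' where "n \<in> {1..6}" "n' \<in> {1..6}" "n \<noteq> n'"
    "slope r s (LC i j) + slope r s (LC k l) + slope r s (LC n n') = 0"
    "conic1 (surface_coeffs r s) (slope r s (LC i j)) (offset r s (LC i j)) m
      = - (offset r s (LC k l) - offset r s (LC i j)) - (offset r s (LC n n') - offset r s (LC i j))"
    "conic2 (surface_coeffs r s) (slope r s (LC i j)) (offset r s (LC i j)) m
      = (slope r s (LC k l) - slope r s (LC i j)) * (offset r s (LC n n') - offset r s (LC i j))
        + (slope r s (LC n n') - slope r s (LC i j)) * (offset r s (LC k l) - offset r s (LC i j))"
    "conic0 (surface_coeffs r s) (slope r s (LC i j)) (offset r s (LC i j)) m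
      = (offset r s (LC k l) - offset r s (LC i j)) * (offset r s (LC n n') - offset r s (LC i j))"
proof (rule split4[OF genericD(3)[OF g] i])
  fix n n'
  assume n: "n \<in> {1..6}" "n' \<in> {1..6}" "distinct [i,j,k,l,n,n']" and sum: "r n + r n' = - (r i + r j + r k + r l)"
    and e: "root_esym r 2 = r n * r n' + r i * r j + r k * r l + (r i + r j) * (r k + r l) - (r i + r j + r k + r l)^2"
    "root_esym r 3 = (r i + r j + r k + r l) * (r n * r n') - (r i + r j + r k + r l) * (r i * r j + r k * r l + (r i + r j) * (r k + r l)) + (r i + r j) * r k * r l + (r k + r l) * r i * r j"
    "root_esym r 4 = r n * r n' * (r i * r j + r k * r l + (r i + r j) * (r k + r l)) - (r i + r j + r k + r l) * ((r i + r j) * r k * r l + (r k + r l) * r i * r j) + r i * r j * r k * r l"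
    "root_esym r 5 = r n * r n' * ((r i + r j) * r k * r l + (r k + r l) * r i * r j) - (r i + r j + r k + r l) * r i * r j * r k * r l"
    "root_esym r 6 = r i * r j * r k * r l * (r n * r n')"
  have b: "offset r s (LC n n') = root_esym r 4 - (r n * r n') * root_esym r 2 - (r n * r n') * s^2 + (r n * r n')^2
     + (r i + r j + r k + r l)^2 * root_esym r 2 - 2 * (r i + r j + r k + r l)^2 * (r n * r n') + (r i + r j + r k + r l)^4"
  proof -
    have p4: "(- x)^4 = x^4" for x :: 'a by simp
    show ?thesis unfolding offset.simps offset_C_def sum power2_minus p4 by (simp add: power_mult_distrib mult.assoc)
  qed
  have u: "slope r s (LC n n') = r i + r j + r k + r l"
    using sum unfolding slope.simps by (metis add.inverse_inverse minus_add_distrib diff_conv_add_uminus)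
  show thesis
  proof (rule that[of n n'])
    show "n \<in> {1..6}" "n' \<in> {1..6}" "n \<noteq> n'" using n by auto
    show "slope r s (LC i j) + slope r s (LC k l) + slope r s (LC n n') = 0" unfolding u by simp
    show "conic1 (surface_coeffs r s) (slope r s (LC i j)) (offset r s (LC i j)) m
      = - (offset r s (LC k l) - offset r s (LC i j)) - (offset r s (LC n n') - offset r s (LC i j))"
      unfolding m b u unfolding slope.simps offset.simps by (rule tri_CCC1[OF e])
    show "conic2 (surface_coeffs r s) (slope r s (LC i j)) (offset r s (LC i j)) m
      = (slope r s (LC k l) - slope r s (LC i j)) * (offset r s (LC n n') - offset r s (LC i j))
        + (slope r s (LC n n') - slope r s (LC i j)) * (offset r s (LC k l) - offset r s (LC i j))"
      unfolding m b u unfolding slope.simps offset.simps by (rule tri_CCC2[OF e])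
    show "conic0 (surface_coeffs r s) (slope r s (LC i j)) (offset r s (LC i j)) m
      = (offset r s (LC k l) - offset r s (LC i j)) * (offset r s (LC n n') - offset r s (LC i j))"
      unfolding m b u unfolding slope.simps offset.simps by (rule tri_CCC0[OF e])
  qed
qed

text \<open>If the line missed the intersection of C_ij and C_kl it would lie in their plane, and
  the only lines there are these two and C_nn' for the two remaining indices.\<close>

lemma line_meeting_two_C:
  assumes g: "generic r s" and i: "i \<in> {1..6}" "j \<in> {1..6}" "k \<in> {1..6}" "l \<in> {1..6}" "distinct [i,j,k,l]"
    and on: "on_surface (surface_coeffs r s) u b"
    and sk: "skewness (surface_coeffs r s) (slope r s (LC i j)) (offset r s (LC i j)) u b = 0"
    and sk': "skewness (surface_coeffs r s) (slope r s (LC k l)) (offset r s (LC k l)) u b = 0"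
    and nl: "\<nexists>x. label x \<and> u = slope r s x \<and> b = offset r s x"
  shows "(offset r s (LC k l) - offset r s (LC i j)) * (u - slope r s (LC i j)) = (b - offset r s (LC i j)) * (slope r s (LC k l) - slope r s (LC i j))"
proof (rule ccontr)
  let ?u0 = "slope r s (LC i j)" and ?b0 = "offset r s (LC i j)"
  let ?u1 = "slope r s (LC k l)" and ?b1 = "offset r s (LC k l)"
  assume nc: "\<not> ?thesis"
  have s0: "?u0 + ?u1 + u = 0"
    using three_meeting_lines[OF meet_C_C[OF g i] sk' sk] nc by blast
  have on0: "on_surface (surface_coeffs r s) ?u0 ?b0" using on_surface_line[OF g, of "LC i j"] i by simp
  have ne: "(u, b) \<noteq> (?u0, ?b0)" using nl i label.simps(3)[of i j] by (metis distinct_length_2_or_more prod.inject)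
  obtain n n' where n: "n \<in> {1..6}" "n' \<in> {1..6}" "n \<noteq> n'" "?u0 + ?u1 + slope r s (LC n n') = 0"
    "conic1 (surface_coeffs r s) ?u0 ?b0 (?u0^2 + ?u0 * ?u1 + ?u1^2) = - (?b1 - ?b0) - (offset r s (LC n n') - ?b0)"
    "conic2 (surface_coeffs r s) ?u0 ?b0 (?u0^2 + ?u0 * ?u1 + ?u1^2)
      = (?u1 - ?u0) * (offset r s (LC n n') - ?b0) + (slope r s (LC n n') - ?u0) * (?b1 - ?b0)"
    "conic0 (surface_coeffs r s) ?u0 ?b0 (?u0^2 + ?u0 * ?u1 + ?u1^2) = (?b1 - ?b0) * (offset r s (LC n n') - ?b0)"
    by (rule plane_C_C[OF g i refl])
  have u: "u = slope r s (LC n n')" using s0 n(4) by (metis add_left_cancel)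
  have "?u0^2 + ?u0 * ?u1 + ?u1^2 = ?u0^2 + ?u0 * (- ?u0 - ?u1) + (- ?u0 - ?u1)^2"
    by (simp only: power2_eq_square) (simp only: ring_distribs diff_conv_add_uminus minus_mult_left[symmetric] minus_mult_right[symmetric] minus_minus, simp only: ac_simps, simp)
  moreover have "u = - ?u0 - ?u1" using s0 by (metis add.commute add_diff_cancel_right' diff_0 diff_conv_add_uminus minus_add_distrib add.right_inverse add.assoc)
  ultimately have m: "?u0^2 + ?u0 * ?u1 + ?u1^2 = ?u0^2 + ?u0 * u + u^2" by metis
  have "(u = ?u1 \<and> b = ?b1) \<or> (u = slope r s (LC n n') \<and> b = offset r s (LC n n'))"
    by (rule residual_line[OF line_in_plane[OF genericD(1)[OF g] on0 on sk ne m] _ n(4-7)]) (use u in blast)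
  moreover have "label (LC k l)" "label (LC n n')" using i n by auto
  ultimately show False using nl by blast
qed

text \<open>A line other than the 27 meets no A_i and no B_i, hence every C_ij. It passes through
  the point where C_12 meets C_34 and through the point where C_12 meets C_35. As it meets C_12 only
  once, C_34 and C_35 have a point in common, but they are skew.\<close>

theorem all_lines:
  assumes g: "generic r s" and on: "on_surface (surface_coeffs r s) u b"
  shows "\<exists>x. label x \<and> u = slope r s x \<and> b = offset r s x"
proof (rule ccontr)
  assume nl: "\<not> ?thesis"
  have C: "skewness (surface_coeffs r s) (slope r s (LC i j)) (offset r s (LC i j)) u b = 0" if "i \<in> {1..6}" "j \<in> {1..6}" "i \<noteq> j" for i j
    using meets_tritangent_plane[OF g that on] line_meeting_A[OF g that(1) on] line_meeting_B[OF g that(2) on] nl by blast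
  have r: "(1::nat) \<in> {1..6}" "(2::nat) \<in> {1..6}" "(3::nat) \<in> {1..6}" "(4::nat) \<in> {1..6}" "(5::nat) \<in> {1..6}" by auto
  let ?u0 = "slope r s (LC 1 2)" and ?b0 = "offset r s (LC 1 2)"
  have c4: "(offset r s (LC 3 4) - ?b0) * (u - ?u0) = (b - ?b0) * (slope r s (LC 3 4) - ?u0)"
    by (rule line_meeting_two_C[OF g _ _ _ _ _ on _ _ nl]) (use C r in simp_all)
  have c5: "(offset r s (LC 3 5) - ?b0) * (u - ?u0) = (b - ?b0) * (slope r s (LC 3 5) - ?u0)"
    by (rule line_meeting_two_C[OF g _ _ _ _ _ on _ _ nl]) (use C r in simp_all)
  have ne: "u \<noteq> ?u0 \<or> b \<noteq> ?b0" using nl r label.simps(3)[of 1 2] by (metis numeral_eq_one_iff semiring_norm(85))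
  have "(slope r s (LC 3 4) - ?u0) * (offset r s (LC 3 5) - ?b0) = (slope r s (LC 3 5) - ?u0) * (offset r s (LC 3 4) - ?b0)"
  proof -
    define x1 where "x1 = slope r s (LC 3 4) - ?u0"
    define x2 where "x2 = slope r s (LC 3 5) - ?u0"
    define y1 where "y1 = offset r s (LC 3 4) - ?b0"
    define y2 where "y2 = offset r s (LC 3 5) - ?b0"
    define p where "p = u - ?u0"
    define q where "q = b - ?b0"
    have e: "y1 * p = q * x1" "y2 * p = q * x2" using c4 c5 by (simp_all only: x1_def x2_def y1_def y2_def p_def q_def)
    have "p \<noteq> 0 \<or> q \<noteq> 0" using ne by (simp add: p_def q_def)
    moreover have "p * (x1 * y2 - x2 * y1) = x1 * (y2 * p) - x2 * (y1 * p)" by (simp add: algebra_simps)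
    then have "p * (x1 * y2 - x2 * y1) = 0" unfolding e by simp
    moreover have "q * (x1 * y2 - x2 * y1) = (q * x1) * y2 - (q * x2) * y1" by (simp add: algebra_simps)
    then have "q * (x1 * y2 - x2 * y1) = 0" unfolding e[symmetric] by simp
    ultimately have "x1 * y2 - x2 * y1 = 0" by auto
    then show ?thesis unfolding x1_def[symmetric] x2_def[symmetric] y1_def[symmetric] y2_def[symmetric] by simp
  qed
  then have "label_skewness r s (LC 3 4) (LC 3 5) = 0"
    by (rule skew_of_concurrent[rotated 2]) (use r meet_C_C[OF g] in auto)
  then show False using skew_C_C[OF g, of 3 4 5] by auto
qed

section \<open>Smoothness\<close>

definition cubic_dT :: "(nat \<Rightarrow> 'a::comm_ring_1) \<Rightarrow> 'a \<Rightarrow> 'a \<Rightarrow> 'a \<Rightarrow> 'a \<Rightarrow> 'a" where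
  "cubic_dT k T Y z w = 3 * T^2 + k 2 * Y * w + 2 * k 4 * T * w + k 5 * z * w + k 8 * w^2"
definition cubic_dY :: "(nat \<Rightarrow> 'a::comm_ring_1) \<Rightarrow> 'a \<Rightarrow> 'a \<Rightarrow> 'a \<Rightarrow> 'a \<Rightarrow> 'a" where
  "cubic_dY k T Y z w = - (z^2) - 2 * Y * w + k 2 * T * w + k 3 * z * w"
definition cubic_dz :: "(nat \<Rightarrow> 'a::comm_ring_1) \<Rightarrow> 'a \<Rightarrow> 'a \<Rightarrow> 'a \<Rightarrow> 'a \<Rightarrow> 'a" where
  "cubic_dz k T Y z w = - (2 * Y * z) + k 3 * Y * w + k 5 * T * w + 2 * k 6 * z * w + k 9 * w^2"
definition cubic_dw :: "(nat \<Rightarrow> 'a::comm_ring_1) \<Rightarrow> 'a \<Rightarrow> 'a \<Rightarrow> 'a \<Rightarrow> 'a \<Rightarrow> 'a" where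
  "cubic_dw k T Y z w = - (Y^2) + k 2 * Y * T + k 3 * Y * z + k 4 * T^2 + k 5 * T * z + k 6 * z^2
     + 2 * k 8 * T * w + 2 * k 9 * z * w + 3 * k 12 * w^2"

text \<open>Derivatives along (1, m, 0, 0), (u, u^3, 1, 0) and (b, \<open>intercept k u b\<close>,
  0, 1), the directions of the coordinates p, z, w of a plane, as they result from
  \<open>cubic_plane\<close>. If the line lies on the surface, a singular point with p nonzero is
  therefore singular on the residual conic.\<close>

lemma chain_rule_plane:
  fixes k :: "nat \<Rightarrow> 'a::comm_ring_1"
  assumes T: "T = u * z + b * w + p" and Y: "Y = u^3 * z + intercept k u b * w + m * p"
  shows "cubic_dT k T Y z w + m * cubic_dY k T Y z w = conic k u b m p z w + p * (2 * p + 3 * u * z + conic1 k u b m * w)"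
    "u * cubic_dT k T Y z w + u^3 * cubic_dY k T Y z w + cubic_dz k T Y z w
      = line_eq1 k u b * w^2 + p * (3 * u * p + 2 * (3 * u^2 - m) * z + conic2 k u b m * w)"
    "b * cubic_dT k T Y z w + intercept k u b * cubic_dY k T Y z w + cubic_dw k T Y z w
      = 2 * line_eq1 k u b * z * w + 3 * line_eq0 k u b * w^2 + p * (conic1 k u b m * p + conic2 k u b m * z + 2 * conic0 k u b m * w)"
proof -
  have 1: "(3 * T^2 + k2 * Y * w + 2 * k4 * T * w + k5 * z * w + k8 * w^2) + m * (- (z^2) - 2 * Y * w + k2 * T * w + k3 * z * w)
    = (p^2 + 3 * u * p * z + (3 * u^2 - m) * z^2 + (3 * b - m^2 + k2 * m + k4) * p * w
      + (6 * u * b - 2 * m * u^3 + k2 * (m * u + u^3) + k3 * m + 2 * k4 * u + k5) * z * w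
      + (3 * b^2 - 2 * m * i + k2 * (m * b + i) + 2 * k4 * b + k8) * w^2)
      + p * (2 * p + 3 * u * z + (3 * b - m^2 + k2 * m + k4) * w)"
    if "T = u * z + b * w + p" "Y = u^3 * z + i * w + m * p" for T Y i u b m z w p k2 k3 k4 k5 k8 :: 'a
    unfolding that by (reify ring_reify, rule ring_eqI, simp, code_simp)
  show "cubic_dT k T Y z w + m * cubic_dY k T Y z w = conic k u b m p z w + p * (2 * p + 3 * u * z + conic1 k u b m * w)"
    unfolding cubic_dT_def cubic_dY_def conic_def conic_coeff_defs by (rule 1) (fact T Y)+
  have 2: "u * (3 * T^2 + k2 * Y * w + 2 * k4 * T * w + k5 * z * w + k8 * w^2) + u^3 * (- (z^2) - 2 * Y * w + k2 * T * w + k3 * z * w)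
     + (- (2 * Y * z) + k3 * Y * w + k5 * T * w + 2 * k6 * z * w + k9 * w^2)
    = (3 * u * b^2 - 2 * u^3 * i + k2 * (u^3 * b + u * i) + k3 * i + 2 * k4 * u * b + k5 * b + k8 * u + k9) * w^2
      + p * (3 * u * p + 2 * (3 * u^2 - m) * z + (6 * u * b - 2 * m * u^3 + k2 * (m * u + u^3) + k3 * m + 2 * k4 * u + k5) * w)"
    if "T = u * z + b * w + p" "Y = u^3 * z + i * w + m * p" "i = 3 * u^2 * b - u^6 + k2 * u^4 + k3 * u^3 + k4 * u^2 + k5 * u + k6"
    for T Y i u b m z w p k2 k3 k4 k5 k6 k8 k9 :: 'a
    unfolding that by (reify ring_reify, rule ring_eqI, simp, code_simp)
  show "u * cubic_dT k T Y z w + u^3 * cubic_dY k T Y z w + cubic_dz k T Y z w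
      = line_eq1 k u b * w^2 + p * (3 * u * p + 2 * (3 * u^2 - m) * z + conic2 k u b m * w)"
    unfolding cubic_dT_def cubic_dY_def cubic_dz_def line_eq1_def conic_coeff_defs by (rule 2) (fact T Y intercept_def)+
  have 3: "b * (3 * T^2 + k2 * Y * w + 2 * k4 * T * w + k5 * z * w + k8 * w^2) + i * (- (z^2) - 2 * Y * w + k2 * T * w + k3 * z * w)
     + (- (Y^2) + k2 * Y * T + k3 * Y * z + k4 * T^2 + k5 * T * z + k6 * z^2
     + 2 * k8 * T * w + 2 * k9 * z * w + 3 * k12 * w^2)
    = 2 * (3 * u * b^2 - 2 * u^3 * i + k2 * (u^3 * b + u * i) + k3 * i + 2 * k4 * u * b + k5 * b + k8 * u + k9) * z * w
      + 3 * (b^3 - i^2 + k2 * i * b + k4 * b^2 + k8 * b + k12) * w^2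
      + p * ((3 * b - m^2 + k2 * m + k4) * p + (6 * u * b - 2 * m * u^3 + k2 * (m * u + u^3) + k3 * m + 2 * k4 * u + k5) * z
          + 2 * (3 * b^2 - 2 * m * i + k2 * (m * b + i) + 2 * k4 * b + k8) * w)"
    if "T = u * z + b * w + p" "Y = u^3 * z + i * w + m * p" "i = 3 * u^2 * b - u^6 + k2 * u^4 + k3 * u^3 + k4 * u^2 + k5 * u + k6"
    for T Y i u b m z w p k2 k3 k4 k5 k6 k8 k9 k12 :: 'a
    unfolding that by (reify ring_reify, rule ring_eqI, simp, code_simp)
  show "b * cubic_dT k T Y z w + intercept k u b * cubic_dY k T Y z w + cubic_dw k T Y z w
      = 2 * line_eq1 k u b * z * w + 3 * line_eq0 k u b * w^2 + p * (conic1 k u b m * p + conic2 k u b m * z + 2 * conic0 k u b m * w)"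
    unfolding cubic_dT_def cubic_dY_def cubic_dw_def line_eq1_def line_eq0_def conic_coeff_defs by (rule 3) (fact T Y intercept_def)+
qed

definition on_line :: "(nat \<Rightarrow> 'a::comm_ring_1) \<Rightarrow> 'a \<Rightarrow> 'a \<Rightarrow> 'a \<Rightarrow> 'a \<Rightarrow> 'a \<Rightarrow> 'a \<Rightarrow> bool" where
  "on_line k u b T Y z w \<longleftrightarrow> T = u * z + b * w \<and> Y = u^3 * z + intercept k u b * w"

lemma quadratic_root:
  fixes p q :: "'a::alg_closed_field"
  shows "\<exists>u. u^2 + p * u + q = 0"
proof -
  have "\<exists>x. poly [:q, p, 1:] x = 0"
    by (rule alg_closed_imp_poly_has_root) simp
  then show ?thesis by (simp add: algebra_simps power2_eq_square)
qed

text \<open>A singular point of the surface off A_i is singular on the residual conic in the plane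
  it spans with A_i. So this plane is one of the five with a degenerate conic, and the point is
  where B_j and C_ij meet.\<close>

lemma singular_point_on_lines:
  fixes r :: "nat \<Rightarrow> 'a::alg_closed_field"
  assumes g: "generic r s" and i: "i \<in> {1..6}" and k: "k = surface_coeffs r s" and w: "w \<noteq> 0"
    and F: "cubic k T Y z w = 0"
    and D: "cubic_dT k T Y z w = 0" "cubic_dY k T Y z w = 0" "cubic_dz k T Y z w = 0" "cubic_dw k T Y z w = 0"
    and no: "\<not> on_line k (slope r s (LA i)) (offset r s (LA i)) T Y z w"
  shows "\<exists>j\<in>{1..6}-{i}. on_line k (slope r s (LB j)) (offset r s (LB j)) T Y z w \<and> on_line k (slope r s (LC i j)) (offset r s (LC i j)) T Y z w"
proof -
  define u0 where "u0 = slope r s (LA i)"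
  define b0 where "b0 = offset r s (LA i)"
  have on0: "line_eq1 k u0 b0 = 0" "line_eq0 k u0 b0 = 0"
    using on_surface_line[OF g, of "LA i"] i unfolding on_surface_def u0_def b0_def k by auto
  define p where "p = T - u0 * z - b0 * w"
  define q where "q = Y - u0^3 * z - intercept k u0 b0 * w"
  have Tp: "T = u0 * z + b0 * w + p" and Yq: "Y = u0^3 * z + intercept k u0 b0 * w + q"
    by (simp_all add: p_def q_def)
  \<comment> \<open>Otherwise the point lies in the plane of A_i and the cusp. There the cubic
    differs from its value on A_i by q times the sum of its \<open>Y\<close>-derivative and q w, so
    that q^2 w = 0.\<close>
  have p: "p \<noteq> 0"
  proof
    assume p0: "p = 0"
    then have q0: "q \<noteq> 0" using no Tp Yq unfolding on_line_def u0_def b0_def by auto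
    define Y0 where "Y0 = u0^3 * z + intercept k u0 b0 * w"
    have T0: "T = u0 * z + b0 * w" using Tp p0 by simp
    have "cubic k T (Y0 + q) z w = cubic k T Y0 z w + q * (cubic_dY k T (Y0 + q) z w + q * w)"
      unfolding cubic_def cubic_dY_def by (simp add: algebra_simps power2_eq_square)
    moreover have "cubic k T Y0 z w = 0" unfolding T0 Y0_def cubic_line on0 by simp
    ultimately have "q * (q * w) = 0" using F D(2) Yq unfolding Y0_def[symmetric] by simp
    then show False using q0 w by simp
  qed
  define m where "m = q / p"
  have Ym: "Y = u0^3 * z + intercept k u0 b0 * w + m * p" using Yq p by (simp add: m_def)
  have K0: "conic k u0 b0 m p z w = 0"
    using cubic_plane[of k u0 z b0 w p m] F p on0 unfolding Tp[symmetric] Ym[symmetric] cubic_line by simp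
  note ch = chain_rule_plane[OF Tp Ym]
  have K1: "2 * p + 3 * u0 * z + conic1 k u0 b0 m * w = 0" using ch(1) D K0 p by simp
  have K2: "3 * u0 * p + 2 * (3 * u0^2 - m) * z + conic2 k u0 b0 m * w = 0" using ch(2) D on0 p by simp
  have K3: "conic1 k u0 b0 m * p + conic2 k u0 b0 m * z + 2 * conic0 k u0 b0 m * w = 0" using ch(3) D on0 p by simp
  have "2 * conic_disc k u0 b0 m * p = 0"
  proof -
    \<comment> \<open>The multipliers are the cofactors of the first column of the Hessian matrix,
      so this combination of its rows is its determinant, twice the discriminant, times p.\<close>
    have *: "2 * (4 * a * c0 + 3 * u * c1 * c2 - c2^2 - a * c1^2 - 9 * u^2 * c0) * p
      = (4 * a * c0 - c2^2) * (2 * p + 3 * u * z + c1 * w) - (6 * u * c0 - c1 * c2) * (3 * u * p + 2 * a * z + c2 * w)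
        + (3 * u * c2 - 2 * a * c1) * (c1 * p + c2 * z + 2 * c0 * w)" for a c0 c1 c2 u p z w :: 'a
      by (reify ring_reify, rule ring_eqI, simp, code_simp)
    show ?thesis
      using *[of "3 * u0^2 - m" "conic0 k u0 b0 m" u0 "conic1 k u0 b0 m" "conic2 k u0 b0 m" p z w]
      unfolding K1 K2 K3 conic_disc_def by simp
  qed
  then have disc: "conic_disc k u0 b0 m = 0" using p genericD(1)[OF g] by simp
  \<comment> \<open>Algebraic closedness expresses the slope m through a further point u of the
    cuspidal cubic, the form in which the zeros of the discriminant are known.\<close>
  obtain u where "u^2 + u0 * u + (u0^2 - m) = 0" using quadratic_root by blast
  then have mu: "m = u0^2 + u0 * u + u^2" by (simp add: algebra_simps)
  obtain j where j: "j \<in> {1..6} - {i}" "u = slope r s (LB j) \<or> u = slope r s (LC i j)"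
    using conic_disc_zeros[OF g i, of m u] disc mu unfolding k u0_def b0_def slope.simps offset.simps by blast
  define u1 where "u1 = slope r s (LB j)"
  define b1 where "b1 = offset r s (LB j)"
  define u2 where "u2 = slope r s (LC i j)"
  define b2 where "b2 = offset r s (LC i j)"
  note defs = k u0_def b0_def u1_def b1_def u2_def b2_def
  have sum: "u0 + u1 + u2 = 0" by (simp add: defs)
  then have u2: "u2 = - u0 - u1" by (simp add: algebra_simps eq_neg_iff_add_eq_0)
  have m1: "m = u0^2 + u0 * u1 + u1^2"
    using j(2) unfolding u1_def[symmetric] u2_def[symmetric]
  proof
    assume "u = u1" then show ?thesis using mu by simp
  next
    assume e: "u = u2"
    show ?thesis unfolding mu e u2 by (simp add: algebra_simps power2_eq_square)
  qed
  have m2: "m = u0^2 + u0 * u2 + u2^2" unfolding m1 u2 by (simp add: algebra_simps power2_eq_square)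
  have ij: "j \<in> {1..6}" "i \<noteq> j" using j by auto
  have i1: "intercept k u1 b1 = intercept k u0 b0 + m * (b1 - b0)"
    unfolding m1 by (rule intercept_of_meet) (use meet_A_B[OF g i ij] in \<open>simp add: defs\<close>)
  have i2: "intercept k u2 b2 = intercept k u0 b0 + m * (b2 - b0)"
    unfolding m2 by (rule intercept_of_meet) (use meet_A_C[OF g i ij] in \<open>simp add: defs\<close>)
  define l1 where "l1 = p - (u1 - u0) * z - (b1 - b0) * w"
  define l2 where "l2 = p - (u2 - u0) * z - (b2 - b0) * w"
  have pl: "conic1 k u0 b0 m = - (b1 - b0) - (b2 - b0)"
      "conic2 k u0 b0 m = (u1 - u0) * (b2 - b0) + (u2 - u0) * (b1 - b0)"
      "conic0 k u0 b0 m = (b1 - b0) * (b2 - b0)"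
    using m1 plane_A_B[OF g i ij, of m] by (simp_all add: defs)
  have "l1 * l2 = 0" using K0 conic_factors[OF sum m1 pl, of p z w] unfolding l1_def l2_def by simp
  \<comment> \<open>\<open>K1\<close> is the derivative of the product l1 l2 with respect to
    p.\<close>
  moreover have "l1 + l2 = 0" using K1 unfolding pl unfolding l1_def l2_def u2 by (simp add: algebra_simps)
  ultimately have l: "l1 = 0" "l2 = 0" by auto
  have p1: "p = (u1 - u0) * z + (b1 - b0) * w" and p2: "p = (u2 - u0) * z + (b2 - b0) * w"
    using l unfolding l1_def l2_def by (simp_all add: algebra_simps)
  have "on_line k u1 b1 T Y z w"
    unfolding on_line_def i1 unfolding Tp Ym unfolding p1 unfolding m1
    by (simp add: algebra_simps power2_eq_square power3_eq_cube)
  moreover have "on_line k u2 b2 T Y z w"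
    unfolding on_line_def i2 unfolding Tp Ym unfolding p2 unfolding m2
    by (simp add: algebra_simps power2_eq_square power3_eq_cube)
  ultimately show ?thesis using j(1) unfolding u1_def b1_def u2_def b2_def by blast
qed

lemma on_line_skew:
  fixes k :: "nat \<Rightarrow> 'a::field"
  assumes "on_line k u b T Y z w" "on_line k u' b' T Y z w" "(z, w) \<noteq> (0, 0)"
  shows "skewness k u b u' b' = 0"
  using assms unfolding on_line_def by (intro skew_eq_0_if_common_point[of z w]) auto

text \<open>A singular point with \<open>w\<close> nonzero lies on at most one of the skew lines
  A_1, A_2, A_3, hence off two of them, A_i and A_j. It then lies on some B_i' and C_ii' and on some
  B_j' and C_jj'. The B are skew, so i' = j', but then C_ii' and C_ji' are skew as well.\<close>

theorem gradient_nonzero: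
  fixes r :: "nat \<Rightarrow> 'a::alg_closed_field"
  assumes g: "generic r s" and F: "cubic (surface_coeffs r s) T Y z w = 0" and ne: "(T, Y, z, w) \<noteq> (0, 0, 0, 0)"
    and D: "cubic_dT (surface_coeffs r s) T Y z w = 0" "cubic_dY (surface_coeffs r s) T Y z w = 0" "cubic_dz (surface_coeffs r s) T Y z w = 0" "cubic_dw (surface_coeffs r s) T Y z w = 0"
  shows False
proof (cases "w = 0")
  case True
  have z: "z = 0" using D(2) True by (simp add: cubic_dY_def)
  have "T = 0" using F True z by (simp add: cubic_def)
  moreover have "Y = 0" using D(4) True z \<open>T = 0\<close> by (simp add: cubic_dw_def)
  ultimately show False using ne True z by simp
next
  case w: False
  define k where "k = surface_coeffs r s"
  define on where "on x \<longleftrightarrow> on_line k (slope r s x) (offset r s x) T Y z w" for x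
  have meet: "label_skewness r s x y = 0" if "on x" "on y" for x y
    using on_line_skew[of k] that w unfolding on_def k_def by blast
  have r: "(1::nat) \<in> {1..6}" "(2::nat) \<in> {1..6}" "(3::nat) \<in> {1..6}" by auto
  have S: "\<exists>j\<in>{1..6}-{i}. on (LB j) \<and> on (LC i j)" if "i \<in> {1..6}" "\<not> on (LA i)" for i
    using singular_point_on_lines[OF g that(1) k_def w] F D that(2) unfolding k_def[symmetric] on_def by blast
  have A: "\<not> (on (LA i) \<and> on (LA j))" if "i \<in> {1..6}" "j \<in> {1..6}" "i \<noteq> j" for i j
    using meet skew_A_A[OF g that] by blast
  have K: False if c: "i \<in> {1..6}" "j \<in> {1..6}" "i \<noteq> j" "\<not> on (LA i)" "\<not> on (LA j)" for i j
  proof -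
    obtain i' where i': "i' \<in> {1..6} - {i}" "on (LB i')" "on (LC i i')" using S[OF c(1,4)] by blast
    obtain j' where j': "j' \<in> {1..6} - {j}" "on (LB j')" "on (LC j j')" using S[OF c(2,5)] by blast
    have "i' = j'"
    proof (rule ccontr)
      assume "i' \<noteq> j'"
      then have "label_skewness r s (LB i') (LB j') \<noteq> 0"
        using skew_A_A[OF generic_uminus[OF g], of i' j'] i' j' by simp
      then show False using meet i' j' by blast
    qed
    then have "on (LC i' i)" "on (LC i' j)" using i' j' LC_commute[of r s] unfolding on_def by metis+
    moreover have "label_skewness r s (LC i' i) (LC i' j) \<noteq> 0" using skew_C_C[OF g, of i' i j] i' j' c \<open>i' = j'\<close> by blast
    ultimately show False using meet by blast
  qed
  show False using K[of 1 2] K[of 1 3] K[of 2 3] A[of 1 2] A[of 1 3] A[of 2 3] r by auto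
qed

section \<open>Galois theory\<close>

lemma field_embedding_simps:
  assumes "field_embedding \<sigma>"
  shows "\<sigma> 0 = 0" "\<sigma> 1 = 1" "\<sigma> (x + y) = \<sigma> x + \<sigma> y" "\<sigma> (x * y) = \<sigma> x * \<sigma> y"
    "\<sigma> (- x) = - \<sigma> x" "\<sigma> (x - y) = \<sigma> x - \<sigma> y" "\<sigma> (x ^ n) = \<sigma> x ^ n" "\<sigma> (numeral m) = numeral m"
    "\<sigma> (of_nat n) = of_nat n"
proof -
  show 1: "\<sigma> 1 = 1" and add: "\<And>x y. \<sigma> (x + y) = \<sigma> x + \<sigma> y" and mult: "\<And>x y. \<sigma> (x * y) = \<sigma> x * \<sigma> y"
    using assms unfolding field_embedding_def by auto
  show 0: "\<sigma> 0 = 0" using add[of 0 0] by (metis add.right_neutral add_left_cancel)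
  show m: "\<sigma> (- x) = - \<sigma> x" for x using add[of x "- x"] 0 by (simp add: eq_neg_iff_add_eq_0 add.commute)
  show "\<sigma> (x - y) = \<sigma> x - \<sigma> y" for x y using add[of x "- y"] m by simp
  show "\<sigma> (x ^ n) = \<sigma> x ^ n" for x n by (induction n) (simp_all add: 1 mult)
  show n: "\<sigma> (of_nat n) = of_nat n" for n by (induction n) (simp_all add: 0 1 add)
  show "\<sigma> (numeral m) = numeral m" using n[of "numeral m"] by simp
qed

lemma field_embedding_sum:
  assumes "field_embedding \<sigma>"
  shows "\<sigma> (\<Sum>x\<in>A. f x) = (\<Sum>x\<in>A. \<sigma> (f x))"
  by (induction A rule: infinite_finite_induct) (simp_all add: field_embedding_simps[OF assms])

lemma field_embedding_eq_iff:
  assumes "field_embedding \<sigma>"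
  shows "\<sigma> x = \<sigma> y \<longleftrightarrow> x = y"
proof
  assume e: "\<sigma> x = \<sigma> y"
  show "x = y"
  proof (rule ccontr)
    assume "x \<noteq> y"
    then have "\<sigma> (x - y) * \<sigma> (inverse (x - y)) = 1"
      by (metis assms field_embedding_simps(2,4) right_inverse right_minus_eq)
    then show False using e by (simp add: field_embedding_simps[OF assms])
  qed
qed simp

lemma field_embedding_eq_0_iff: "field_embedding \<sigma> \<Longrightarrow> \<sigma> x = 0 \<longleftrightarrow> x = 0"
  by (metis field_embedding_eq_iff field_embedding_simps(1))

lemma field_embedding_comp: "field_embedding \<sigma> \<Longrightarrow> field_embedding \<tau> \<Longrightarrow> field_embedding (\<sigma> \<circ> \<tau>)"
  unfolding field_embedding_def by auto

lemma field_embedding_poly: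
  assumes "field_embedding \<sigma>"
  shows "poly (map_poly \<sigma> p) (\<sigma> x) = \<sigma> (poly p x)"
  by (induction p) (simp_all add: field_embedding_simps[OF assms] map_poly_pCons)

lemma field_embedding_map_poly:
  assumes "field_embedding \<sigma>"
  shows "map_poly \<sigma> (p + q) = map_poly \<sigma> p + map_poly \<sigma> q"
    "map_poly \<sigma> (p * q) = map_poly \<sigma> p * map_poly \<sigma> q"
    "map_poly \<sigma> (p - q) = map_poly \<sigma> p - map_poly \<sigma> q"
    "map_poly \<sigma> (Polynomial.smult c p) = Polynomial.smult (\<sigma> c) (map_poly \<sigma> p)"
    "degree (map_poly \<sigma> p) = degree p"
    "map_poly \<sigma> p = 0 \<longleftrightarrow> p = 0"
    "map_poly \<sigma> (pderiv p) = pderiv (map_poly \<sigma> p)"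
proof -
  note h = field_embedding_simps[OF assms] field_embedding_eq_0_iff[OF assms]
  show 1: "map_poly \<sigma> (p + q) = map_poly \<sigma> p + map_poly \<sigma> q" for p q
    by (rule poly_eqI) (simp add: coeff_map_poly h)
  show "map_poly \<sigma> (p - q) = map_poly \<sigma> p - map_poly \<sigma> q"
    by (rule poly_eqI) (simp add: coeff_map_poly h)
  show 2: "map_poly \<sigma> (Polynomial.smult c p) = Polynomial.smult (\<sigma> c) (map_poly \<sigma> p)" for c p
    by (rule poly_eqI) (simp add: coeff_map_poly h)
  show "map_poly \<sigma> (p * q) = map_poly \<sigma> p * map_poly \<sigma> q"
    by (rule poly_eqI) (simp add: coeff_map_poly h coeff_mult field_embedding_sum[OF assms])
  show "degree (map_poly \<sigma> p) = degree p"
    by (rule degree_map_poly) (simp add: h)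
  show "map_poly \<sigma> p = 0 \<longleftrightarrow> p = 0"
    by (simp add: poly_eq_iff coeff_map_poly h)
  show "map_poly \<sigma> (pderiv p) = pderiv (map_poly \<sigma> p)"
    by (rule poly_eqI) (simp add: coeff_map_poly coeff_pderiv h)
qed

lemma Dedekind_independence:
  fixes c :: "('l::field \<Rightarrow> 'l) \<Rightarrow> 'l"
  assumes "finite A" "\<And>\<sigma>. \<sigma> \<in> A \<Longrightarrow> field_embedding \<sigma>" "\<And>x. (\<Sum>\<sigma>\<in>A. c \<sigma> * \<sigma> x) = 0"
  shows "\<forall>\<sigma>\<in>A. c \<sigma> = 0"
  using assms
proof (induction A arbitrary: c rule: finite_induct)
  case (insert \<tau> A)
  have sum: "(\<Sum>\<sigma>\<in>A. c \<sigma> * \<sigma> x) = - (c \<tau> * \<tau> x)" for x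
    using insert.prems(2)[of x] insert.hyps by (simp add: eq_neg_iff_add_eq_0 add.commute)
  have A: "c \<sigma> = 0" if "\<sigma> \<in> A" for \<sigma>
  proof -
    have "\<sigma> \<noteq> \<tau>" using that insert.hyps by auto
    \<comment> \<open>Subtracting \<tau> y times the relation at x from the relation at y x removes
      the term of \<tau> and multiplies the others by \<sigma> y - \<tau> y.\<close>
    then obtain y where y: "\<sigma> y \<noteq> \<tau> y" by auto
    have "(\<Sum>\<sigma>\<in>A. (c \<sigma> * (\<sigma> y - \<tau> y)) * \<sigma> x) = 0" for x
    proof -
      have "(\<Sum>\<sigma>\<in>A. (c \<sigma> * (\<sigma> y - \<tau> y)) * \<sigma> x) = (\<Sum>\<sigma>\<in>A. c \<sigma> * \<sigma> (y * x)) - \<tau> y * (\<Sum>\<sigma>\<in>A. c \<sigma> * \<sigma> x)"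
        using insert.prems(1) by (auto simp: sum_subtractf[symmetric] sum_distrib_left field_embedding_simps algebra_simps intro!: sum.cong)
      also have "\<dots> = 0" unfolding sum using insert.prems(1)[of \<tau>] by (simp add: field_embedding_simps)
      finally show ?thesis .
    qed
    then have "\<forall>\<sigma>\<in>A. c \<sigma> * (\<sigma> y - \<tau> y) = 0"
      using insert.IH[of "\<lambda>\<sigma>. c \<sigma> * (\<sigma> y - \<tau> y)"] insert.prems(1) by auto
    then show ?thesis using that y by auto
  qed
  moreover have "c \<tau> = 0"
    using sum[of 1] A insert.prems(1)[of \<tau>] by (simp add: field_embedding_simps)
  ultimately show ?case by auto
qed simp

text \<open>A partial \<open>k\<close>-homomorphism of \<open>'l\<close> into itself, given by its graph.\<close>

definition partial_hom :: "('k::field \<Rightarrow> 'l::field) \<Rightarrow> ('l \<times> 'l) set \<Rightarrow> bool" where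
  "partial_hom \<iota> R \<longleftrightarrow> (\<forall>a. (\<iota> a, \<iota> a) \<in> R) \<and>
     (\<forall>x x' y y'. (x, x') \<in> R \<longrightarrow> (y, y') \<in> R \<longrightarrow> (x + y, x' + y') \<in> R \<and> (x - y, x' - y') \<in> R \<and> (x * y, x' * y') \<in> R) \<and>
     (\<forall>y. (0, y) \<in> R \<longrightarrow> y = 0)"

text \<open>The polynomials over the domain of \<open>R\<close>, paired with the results of applying
  the homomorphism to their coefficients.\<close>

definition rel_polys :: "('l::field \<times> 'l) set \<Rightarrow> ('l poly \<times> 'l poly) set" where
  "rel_polys R = {(P, Q). \<forall>n. (Polynomial.coeff P n, Polynomial.coeff Q n) \<in> R}"

lemma partial_homD:
  assumes "partial_hom \<iota> R"
  shows "(\<iota> a, \<iota> a) \<in> R"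
    "(x, x') \<in> R \<Longrightarrow> (y, y') \<in> R \<Longrightarrow> (x + y, x' + y') \<in> R"
    "(x, x') \<in> R \<Longrightarrow> (y, y') \<in> R \<Longrightarrow> (x - y, x' - y') \<in> R"
    "(x, x') \<in> R \<Longrightarrow> (y, y') \<in> R \<Longrightarrow> (x * y, x' * y') \<in> R"
    "(0, y) \<in> R \<Longrightarrow> y = 0"
  using assms[unfolded partial_hom_def, THEN conjunct1, rule_format, of a]
    assms[unfolded partial_hom_def, THEN conjunct2, THEN conjunct1, rule_format, of x x' y y']
    assms[unfolded partial_hom_def, THEN conjunct2, THEN conjunct2, rule_format, of y]
  by simp_all

context
  fixes \<iota> :: "'k::field \<Rightarrow> 'l::field" and R :: "('l \<times> 'l) set"
  assumes emb: "field_embedding \<iota>" and R: "partial_hom \<iota> R"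
begin

lemma rel_0 [simp]: "(0, 0) \<in> R" and rel_1 [simp]: "(1, 1) \<in> R"
  using partial_homD(1)[OF R, of 0] partial_homD(1)[OF R, of 1] by (simp_all add: field_embedding_simps[OF emb])

lemma rel_functional: "(x, y) \<in> R \<Longrightarrow> (x, y') \<in> R \<Longrightarrow> y = y'"
  using partial_homD(3,5)[OF R] by (metis diff_self right_minus_eq)

lemma rel_sum: "(\<And>i. i \<in> A \<Longrightarrow> (f i, g i) \<in> R) \<Longrightarrow> (\<Sum>i\<in>A. f i, \<Sum>i\<in>A. g i) \<in> R"
  by (induction A rule: infinite_finite_induct) (auto intro: partial_homD[OF R])

lemma rel_polys_add: "(P, Q) \<in> rel_polys R \<Longrightarrow> (P', Q') \<in> rel_polys R \<Longrightarrow> (P + P', Q + Q') \<in> rel_polys R"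
  and rel_polys_diff: "(P, Q) \<in> rel_polys R \<Longrightarrow> (P', Q') \<in> rel_polys R \<Longrightarrow> (P - P', Q - Q') \<in> rel_polys R"
  by (auto simp: rel_polys_def intro: partial_homD[OF R])

lemma rel_polys_mult: "(P, Q) \<in> rel_polys R \<Longrightarrow> (P', Q') \<in> rel_polys R \<Longrightarrow> (P * P', Q * Q') \<in> rel_polys R"
  by (auto simp: rel_polys_def coeff_mult intro!: rel_sum partial_homD(4)[OF R])

lemma rel_polys_monom: "(c, d) \<in> R \<Longrightarrow> (monom c n, monom d n) \<in> rel_polys R"
  by (auto simp: rel_polys_def)

lemma rel_polys_base: "(map_poly \<iota> p, map_poly \<iota> p) \<in> rel_polys R"
  by (auto simp: rel_polys_def coeff_map_poly field_embedding_simps[OF emb] intro: partial_homD(1)[OF R])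

lemma rel_polys_0: "(0, Q) \<in> rel_polys R \<Longrightarrow> Q = 0"
  by (auto simp: rel_polys_def poly_eq_iff intro: partial_homD(5)[OF R])

text \<open>Long division by a monic polynomial, with the same steps on both components; being
  monic, it needs no inverses in the domain of \<open>R\<close>. The degree of the first component
  governs the recursion.\<close>

lemma rel_polys_division:
  assumes M: "(M, N) \<in> rel_polys R" "lead_coeff M = 1" "degree N = degree M" "lead_coeff N = 1" "degree M > 0"
    and P: "(P, Q) \<in> rel_polys R"
  shows "\<exists>H H' S S'. (H, H') \<in> rel_polys R \<and> (S, S') \<in> rel_polys R \<and> P = M * H + S \<and> Q = N * H' + S' \<and> degree S < degree M"
  using P
proof (induction "degree P" arbitrary: P Q rule: less_induct)
  case less
  show ?case
  proof (cases "degree P < degree M")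
    case True
    then show ?thesis using less.prems
      by (intro exI[of _ 0] exI[of _ P] exI[of _ Q]) (auto simp: rel_polys_def)
  next
    case False
    define n where "n = degree P - degree M"
    define c where "c = Polynomial.coeff P (degree P)"
    define d where "d = Polynomial.coeff Q (degree P)"
    have cd: "(c, d) \<in> R" using less.prems by (auto simp: rel_polys_def c_def d_def)
    have m: "(monom c n, monom d n) \<in> rel_polys R" by (rule rel_polys_monom[OF cd])
    define P' where "P' = P - M * monom c n"
    define Q' where "Q' = Q - N * monom d n"
    have PQ: "(P', Q') \<in> rel_polys R" unfolding P'_def Q'_def
      by (intro rel_polys_diff less.prems rel_polys_mult M(1) m)
    have "degree P' < degree P"
    proof (rule degree_lessI)
      show "P' \<noteq> 0 \<or> degree P > 0" using False M(5) by auto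
      show "\<forall>k\<ge>degree P. Polynomial.coeff P' k = 0"
      proof (intro allI impI)
        fix k assume k: "degree P \<le> k"
        show "Polynomial.coeff P' k = 0"
        proof (cases "k = degree P")
          case True
          have "Polynomial.coeff (M * monom c n) (degree P) = Polynomial.coeff M (degree M) * c"
            using \<open>\<not> degree P < degree M\<close> by (simp add: mult.commute[of M] coeff_monom_mult n_def)
          then show ?thesis using M(2) True by (simp add: P'_def c_def)
        next
          case False
          have "degree (M * monom c n) \<le> degree P"
            using \<open>\<not> degree P < degree M\<close> degree_mult_le[of M "monom c n"] degree_monom_le[of c n] by (simp add: n_def)
          then show ?thesis using False k by (simp add: P'_def coeff_eq_0)
        qed
      qed
    qed
    then obtain H H' S S' where IH: "(H, H') \<in> rel_polys R" "(S, S') \<in> rel_polys R" "P' = M * H + S" "Q' = N * H' + S'" "degree S < degree M"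
      using less.hyps[OF _ PQ] by blast
    have "P = M * (H + monom c n) + S" "Q = N * (H' + monom d n) + S'"
      using IH(3,4) unfolding P'_def Q'_def by (simp_all add: algebra_simps)
    moreover have "(H + monom c n, H' + monom d n) \<in> rel_polys R" by (rule rel_polys_add[OF IH(1) m])
    ultimately show ?thesis using IH by blast
  qed
qed

lemma rel_poly_eval:
  assumes "(P, Q) \<in> rel_polys R" "(a, b) \<in> R"
  shows "(poly P a, poly Q b) \<in> R"
proof -
  define n where "n = max (degree P) (degree Q)"
  have e: "poly P x = (\<Sum>i\<le>n. Polynomial.coeff P i * x ^ i)" "poly Q x = (\<Sum>i\<le>n. Polynomial.coeff Q i * x ^ i)" for x
    unfolding poly_altdef by (intro sum.mono_neutral_left; auto simp: n_def coeff_eq_0)+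
  have "(a ^ i, b ^ i) \<in> R" for i by (induction i) (auto intro: partial_homD(4)[OF R assms(2)])
  then show ?thesis unfolding e using assms(1)
    by (intro rel_sum partial_homD(4)[OF R]) (auto simp: rel_polys_def)
qed

end

lemma exists_minimal_poly:
  assumes "algebraic_extension \<iota>"
  obtains p where "Factorial_Ring.irreducible p" "poly (map_poly \<iota> p) x = 0" "p \<noteq> 0"
    "\<And>q. poly (map_poly \<iota> q) x = 0 \<Longrightarrow> p dvd q"
proof -
  have emb: "field_embedding \<iota>" using assms unfolding algebraic_extension_def by blast
  note mp = field_embedding_map_poly[OF emb]
  have "\<exists>p. p \<noteq> 0 \<and> poly (map_poly \<iota> p) x = 0" using assms unfolding algebraic_extension_def by blast
  then obtain p where p: "p \<noteq> 0" "poly (map_poly \<iota> p) x = 0"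
    and min: "\<And>q. q \<noteq> 0 \<Longrightarrow> poly (map_poly \<iota> q) x = 0 \<Longrightarrow> degree p \<le> degree q"
    using ex_has_least_nat[of "\<lambda>p. p \<noteq> 0 \<and> poly (map_poly \<iota> p) x = 0" _ degree] by blast
  have dvd: "p dvd q" if q: "poly (map_poly \<iota> q) x = 0" for q
  proof -
    have "q = p * (q div p) + q mod p" by simp
    then have "map_poly \<iota> q = map_poly \<iota> p * map_poly \<iota> (q div p) + map_poly \<iota> (q mod p)" by (metis mp(1,2))
    then have "poly (map_poly \<iota> (q mod p)) x = 0" using q p(2) by (metis add_0 mult_zero_left poly_add poly_mult)
    then have "q mod p = 0" using min[of "q mod p"] degree_mod_less'[OF p(1), of q] by (meson leD)
    then show ?thesis by auto
  qed
  have "Factorial_Ring.irreducible p"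
  proof (rule Factorial_Ring.irreducibleI)
    show "p \<noteq> 0" by (rule p(1))
    show "\<not> is_unit p"
    proof
      assume "is_unit p"
      then obtain c where "p = [:c:]" "c \<noteq> 0" by (metis is_unit_poly_iff is_unit_iff_degree p(1) degree_eq_zeroE pCons_0_0)
      then have "map_poly \<iota> p = [:\<iota> c:]" by (simp add: map_poly_pCons field_embedding_simps[OF emb])
      then show False using p(2) \<open>c \<noteq> 0\<close> field_embedding_eq_0_iff[OF emb] by simp
    qed
    fix a b assume ab: "p = a * b"
    then have nz: "a \<noteq> 0" "b \<noteq> 0" using p(1) by auto
    have "poly (map_poly \<iota> a) x = 0 \<or> poly (map_poly \<iota> b) x = 0"
      using p(2) unfolding ab mp(2) by simp
    then have "degree p \<le> degree a \<or> degree p \<le> degree b" using min nz by blast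
    then have "degree b = 0 \<or> degree a = 0" unfolding ab using nz by (simp add: degree_mult_eq)
    then show "is_unit a \<or> is_unit b" using nz is_unit_iff_degree by blast
  qed
  then show ?thesis using that p dvd by blast
qed

text \<open>The root of each linear factor is either a root of \<open>N\<close> or one of the
  cofactor \<open>H\<close>; in the second case the factor is cancelled.\<close>

lemma root_of_split_divisor:
  fixes N H :: "'l::field poly"
  assumes "N * H = Polynomial.smult c (\<Prod>x\<leftarrow>xs. [:- x, 1:])" "c \<noteq> 0" "degree N > 0"
  shows "\<exists>b. poly N b = 0"
  using assms(1)
proof (induction xs arbitrary: H)
  case Nil
  then have "N * H = [:c:]" by (simp add: one_pCons)
  then have "degree (N * H) = 0" "N * H \<noteq> 0" using assms(2) by auto
  then show ?case using assms(3) by (metis add_is_0 degree_mult_eq mult_eq_0_iff not_less_zero)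
next
  case (Cons x xs)
  show ?case
  proof (cases "poly N x = 0")
    case False
    have "poly (N * H) x = 0" unfolding Cons.prems by simp
    then have "poly H x = 0" using False by simp
    then obtain H' where H: "H = [:- x, 1:] * H'" by (metis dvdE poly_eq_0_iff_dvd)
    have "[:- x, 1:] * (N * H') = [:- x, 1:] * Polynomial.smult c (\<Prod>x\<leftarrow>xs. [:- x, 1:])"
      using Cons.prems unfolding H by (simp only: list.map prod_list.Cons mult.left_commute mult_smult_right)
    then have "N * H' = Polynomial.smult c (\<Prod>x\<leftarrow>xs. [:- x, 1:])"
      by (metis mult_cancel_left pCons_eq_0_iff one_neq_zero)
    then show ?thesis by (rule Cons.IH)
  qed blast
qed

text \<open>If p0 + c q(c) = 0 comes from the minimal polynomial of c, then p0 is nonzero and the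
  inverse of c is - q(c) / p0, a polynomial in c over the base field. So the domain of
  \<open>R\<close>, given as a ring, is a field.\<close>

lemma rel_inverse:
  assumes alg: "algebraic_extension \<iota>" and R: "partial_hom \<iota> R" and cd: "(c, d) \<in> R" "c \<noteq> 0"
  shows "\<exists>d'. (inverse c, d') \<in> R"
proof -
  have emb: "field_embedding \<iota>" using alg unfolding algebraic_extension_def by blast
  note h = field_embedding_simps[OF emb] field_embedding_eq_0_iff[OF emb]
  obtain p where p: "Factorial_Ring.irreducible p" "poly (map_poly \<iota> p) c = 0" "p \<noteq> 0"
    "\<And>q. poly (map_poly \<iota> q) c = 0 \<Longrightarrow> p dvd q" by (fact exists_minimal_poly[OF alg])
  obtain p0 q where pq: "p = pCons p0 q" by (cases p)
  have e: "\<iota> p0 + c * poly (map_poly \<iota> q) c = 0" using p(2) unfolding pq by (simp add: map_poly_pCons h)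
  have "p0 \<noteq> 0"
  proof
    assume p0: "p0 = 0"
    then have "poly (map_poly \<iota> q) c = 0" using e cd(2) by (simp add: h)
    then have "p dvd q" by (rule p(4))
    moreover have "q \<noteq> 0" using p(3) pq p0 by auto
    ultimately have "degree p \<le> degree q" by (rule dvd_imp_degree_le)
    then show False using \<open>q \<noteq> 0\<close> unfolding pq by simp
  qed
  then have "inverse c = \<iota> (- inverse p0) * poly (map_poly \<iota> q) c"
  proof -
    have "\<iota> p0 * \<iota> (inverse p0) = 1" using \<open>p0 \<noteq> 0\<close> by (metis h(4,2) right_inverse)
    moreover have "c * poly (map_poly \<iota> q) c = - \<iota> p0" using e by (simp add: eq_neg_iff_add_eq_0 add.commute)
    moreover have "c * (\<iota> (- inverse p0) * poly (map_poly \<iota> q) c) = - \<iota> (inverse p0) * (c * poly (map_poly \<iota> q) c)"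
      by (simp add: h)
    ultimately have "c * (\<iota> (- inverse p0) * poly (map_poly \<iota> q) c) = 1" by (simp add: mult.commute)
    then show ?thesis using cd(2) by (metis inverse_unique)
  qed
  moreover have "(\<iota> (- inverse p0) * poly (map_poly \<iota> q) c, \<iota> (- inverse p0) * poly (map_poly \<iota> q) d) \<in> R"
    by (intro partial_homD[OF R] rel_poly_eval[OF emb R] rel_polys_base[OF emb R] cd(1))
  ultimately show ?thesis by auto
qed

text \<open>Let M be the minimal polynomial of a over the domain of \<open>R\<close> and N its
  image. As M divides the minimal polynomial p of a over the base, N divides the image of p, which
  is p itself and splits by normality. So N has a root b, and P(a) is sent to Q(b) for corresponding
  polynomials P and Q.\<close>

lemma partial_hom_extend:
  assumes nor: "normal_extension \<iota>" and R: "partial_hom \<iota> R"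
  shows "\<exists>R' b. partial_hom \<iota> R' \<and> R \<subseteq> R' \<and> (a, b) \<in> R'"
proof -
  have alg: "algebraic_extension \<iota>" using nor unfolding normal_extension_def by blast
  have emb: "field_embedding \<iota>" using alg unfolding algebraic_extension_def by blast
  note RP = rel_polys_base[OF emb R] rel_polys_0[OF emb R] rel_polys_mult[OF emb R] rel_polys_monom[OF emb R]
  obtain p where p: "Factorial_Ring.irreducible p" "poly (map_poly \<iota> p) a = 0" "p \<noteq> 0"
    by (metis exists_minimal_poly[OF alg])
  have mp0: "map_poly \<iota> p \<noteq> 0" using p(3) field_embedding_map_poly(6)[OF emb] by blast
  define Z where "Z PQ \<longleftrightarrow> PQ \<in> rel_polys R \<and> fst PQ \<noteq> 0 \<and> poly (fst PQ) a = 0" for PQ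
  have "Z (map_poly \<iota> p, map_poly \<iota> p)" using RP(1) p(2) mp0 by (simp add: Z_def)
  then obtain M0 N0 where MN0: "Z (M0, N0)" and min0: "\<And>PQ. Z PQ \<Longrightarrow> degree M0 \<le> degree (fst PQ)"
    using ex_has_least_nat[of Z _ "\<lambda>PQ. degree (fst PQ)"] by (metis fst_conv prod.exhaust_sel)
  have MN0': "(M0, N0) \<in> rel_polys R" "M0 \<noteq> 0" "poly M0 a = 0" using MN0 by (auto simp: Z_def)
  define c where "c = lead_coeff M0"
  define d where "d = Polynomial.coeff N0 (degree M0)"
  have cd: "(c, d) \<in> R" "c \<noteq> 0" using MN0' by (auto simp: rel_polys_def c_def d_def)
  obtain d' where d': "(inverse c, d') \<in> R" using rel_inverse[OF alg R cd] by blast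
  \<comment> \<open>The image d of the leading coefficient is invertible, so that N keeps the degree
    of M and is monic with it.\<close>
  have dd: "d' * d = 1"
    using partial_homD(4)[OF R d' cd(1)] cd(2) rel_functional[OF emb R] rel_1[OF emb R] by simp
  define M where "M = Polynomial.smult (inverse c) M0"
  define N where "N = Polynomial.smult d' N0"
  have degM: "degree M = degree M0" using cd(2) by (simp add: M_def)
  have MN: "(M, N) \<in> rel_polys R"
    using MN0'(1) d' unfolding M_def N_def rel_polys_def by (auto intro: partial_homD(4)[OF R])
  have M1: "lead_coeff M = 1" using cd(2) by (simp add: M_def c_def)
  have Nz: "Polynomial.coeff N n = 0" if "n > degree M" for n
  proof -
    have "(Polynomial.coeff M n, Polynomial.coeff N n) \<in> R" using MN by (auto simp: rel_polys_def)
    then show ?thesis using that partial_homD(5)[OF R] by (simp add: coeff_eq_0)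
  qed
  have Nl: "Polynomial.coeff N (degree M) = 1" using dd by (simp add: N_def degM d_def)
  have degN: "degree N = degree M"
    by (intro antisym degree_le le_degree) (use Nz Nl in auto)
  have N1: "lead_coeff N = 1" using Nl degN by simp
  have Ma: "poly M a = 0" using MN0'(3) by (simp add: M_def)
  have Mpos: "degree M > 0"
  proof (rule ccontr)
    assume "\<not> ?thesis"
    then obtain e where "M = [:e:]" by (metis degree_eq_zeroE neq0_conv)
    then show False using M1 Ma by simp
  qed
  have min: "P = 0" if "(P, Q) \<in> rel_polys R" "poly P a = 0" "degree P < degree M" for P Q
    using min0[of "(P, Q)"] that degM by (auto simp: Z_def)
  have div: "\<exists>H'. Q = N * H'" if PQ: "(P, Q) \<in> rel_polys R" and P: "poly P a = 0" for P Q
  proof -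
    obtain H H' S S' where H: "(S, S') \<in> rel_polys R" "P = M * H + S" "Q = N * H' + S'" "degree S < degree M"
      using rel_polys_division[OF emb R MN M1 degN N1 Mpos PQ] by blast
    have "poly S a = 0" using P Ma unfolding H(2) by simp
    then have "S = 0" using min[OF H(1)] H(4) by blast
    then have "S' = 0" using H(1) RP(2) by blast
    then show ?thesis using H(3) by auto
  qed
  obtain H' where "map_poly \<iota> p = N * H'" using div[OF RP(1) p(2)] by blast
  moreover have "splits_into_linear_factors (map_poly \<iota> p)"
    using nor p unfolding normal_extension_def by blast
  then obtain e xs where "map_poly \<iota> p = Polynomial.smult e (\<Prod>x\<leftarrow>xs. [:- x, 1:])"
    unfolding splits_into_linear_factors_def by blast
  moreover from this have "e \<noteq> 0" using mp0 by auto
  ultimately obtain b where b: "poly N b = 0"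
    using root_of_split_divisor[of N H' e xs] Mpos degN by auto
  \<comment> \<open>The new relation is functional because, by \<open>div\<close>, a polynomial
    vanishing at a has an image divisible by N, hence vanishing at b.\<close>
  define R' where "R' = {(poly P a, poly Q b) |P Q. (P, Q) \<in> rel_polys R}"
  have "partial_hom \<iota> R'"
    unfolding partial_hom_def
  proof (intro conjI allI impI)
    fix y
    have "(monom (\<iota> y) 0, monom (\<iota> y) 0) \<in> rel_polys R" by (rule RP(4)[OF partial_homD(1)[OF R]])
    then show "(\<iota> y, \<iota> y) \<in> R'" unfolding R'_def by (force simp: poly_monom)
  next
    fix x x' y y' assume "(x, x') \<in> R'" "(y, y') \<in> R'"
    then obtain P Q P' Q' where PQ: "(P, Q) \<in> rel_polys R" "(P', Q') \<in> rel_polys R"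
      "x = poly P a" "x' = poly Q b" "y = poly P' a" "y' = poly Q' b" unfolding R'_def by blast
    show "(x + y, x' + y') \<in> R'" using rel_polys_add[OF emb R PQ(1,2)] unfolding R'_def PQ(3-6) poly_add[symmetric] by blast
    show "(x - y, x' - y') \<in> R'" using rel_polys_diff[OF emb R PQ(1,2)] unfolding R'_def PQ(3-6) poly_diff[symmetric] by blast
    show "(x * y, x' * y') \<in> R'" using rel_polys_mult[OF emb R PQ(1,2)] unfolding R'_def PQ(3-6) poly_mult[symmetric] by blast
  next
    fix y assume "(0, y) \<in> R'"
    then obtain P Q where PQ: "(P, Q) \<in> rel_polys R" "poly P a = 0" "y = poly Q b" unfolding R'_def by auto
    then show "y = 0" using div[OF PQ(1,2)] b by auto
  qed
  moreover have "R \<subseteq> R'"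
  proof
    fix xy assume xy: "xy \<in> R"
    have "(monom (fst xy) 0, monom (snd xy) 0) \<in> rel_polys R" by (rule RP(4)) (use xy in simp)
    then show "xy \<in> R'" unfolding R'_def by (force simp: poly_monom intro: prod_eqI)
  qed
  moreover have "(a, b) \<in> R'"
  proof -
    have "(monom 1 1, monom 1 1) \<in> rel_polys R" by (rule RP(4)[OF rel_1[OF emb R]])
    then show ?thesis unfolding R'_def by (force simp: poly_monom)
  qed
  ultimately show ?thesis by blast
qed

text \<open>Zorn's lemma gives a maximal extension, which is defined everywhere by
  \<open>partial_hom_extend\<close>. It is surjective because it maps the finite set of roots of any
  nonzero polynomial over the base injectively into itself.\<close>

lemma extend_to_automorphism:
  assumes nor: "normal_extension \<iota>" and R0: "partial_hom \<iota> R0"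
  shows "\<exists>\<sigma>\<in>carrier (Gal \<iota>). \<forall>(x, y)\<in>R0. \<sigma> x = y"
proof -
  have alg: "algebraic_extension \<iota>" using nor unfolding normal_extension_def by blast
  have emb: "field_embedding \<iota>" using alg unfolding algebraic_extension_def by blast
  define A where "A = {R. partial_hom \<iota> R \<and> R0 \<subseteq> R}"
  have "\<exists>R\<in>A. \<forall>U\<in>A. R \<subseteq> U \<longrightarrow> U = R"
  proof (rule subset_Zorn_nonempty)
    show "A \<noteq> {}" using R0 by (auto simp: A_def)
    fix C assume C: "C \<noteq> {}" "subset.chain A C"
    have CA: "U \<in> A" if "U \<in> C" for U using C(2) that by (auto simp: subset.chain_def)
    have two: "\<exists>Z\<in>C. u \<in> Z \<and> v \<in> Z" if uv: "u \<in> \<Union>C" "v \<in> \<Union>C" for u v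
    proof -
      obtain U Y where "U \<in> C" "Y \<in> C" "u \<in> U" "v \<in> Y" using uv by blast
      moreover have "U \<subseteq> Y \<or> Y \<subseteq> U" using C(2) \<open>U \<in> C\<close> \<open>Y \<in> C\<close> by (auto simp: subset.chain_def)
      ultimately show ?thesis by blast
    qed
    have "partial_hom \<iota> (\<Union>C)"
      unfolding partial_hom_def
    proof (intro conjI allI impI)
      fix a
      obtain U where U: "U \<in> C" using C(1) by blast
      then have "partial_hom \<iota> U" using CA by (simp add: A_def)
      then show "(\<iota> a, \<iota> a) \<in> \<Union>C" using U partial_homD(1) by blast
    next
      fix x x' y y' assume "(x, x') \<in> \<Union>C" "(y, y') \<in> \<Union>C"
      then obtain Z where Z: "Z \<in> C" "(x, x') \<in> Z" "(y, y') \<in> Z" using two by blast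
      then have "partial_hom \<iota> Z" using CA by (auto simp: A_def)
      note D = partial_homD[OF this]
      show "(x + y, x' + y') \<in> \<Union>C" using D(2)[OF Z(2,3)] Z(1) by blast
      show "(x - y, x' - y') \<in> \<Union>C" using D(3)[OF Z(2,3)] Z(1) by blast
      show "(x * y, x' * y') \<in> \<Union>C" using D(4)[OF Z(2,3)] Z(1) by blast
    next
      fix y assume "(0, y) \<in> \<Union>C"
      then obtain Z where "Z \<in> C" "(0, y) \<in> Z" by blast
      then show "y = 0" using CA partial_homD(5) unfolding A_def by blast
    qed
    moreover have "R0 \<subseteq> \<Union>C" using C(1) CA unfolding A_def by blast
    ultimately show "\<Union>C \<in> A" by (simp add: A_def)
  qed
  then obtain R where RA: "R \<in> A" "\<forall>U\<in>A. R \<subseteq> U \<longrightarrow> U = R" by blast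
  then have R: "partial_hom \<iota> R" "R0 \<subseteq> R" by (simp_all add: A_def)
  have max: "U = R" if "partial_hom \<iota> U" "R \<subseteq> U" for U
  proof -
    have "U \<in> A" using that R(2) by (simp add: A_def)
    then show ?thesis using RA(2) that(2) by blast
  qed
  have total: "\<exists>y. (x, y) \<in> R" for x
    using partial_hom_extend[OF nor R(1), of x] max by blast
  define \<sigma> where "\<sigma> x = (SOME y. (x, y) \<in> R)" for x
  have \<sigma>R: "(x, \<sigma> x) \<in> R" for x unfolding \<sigma>_def by (rule someI_ex) (rule total)
  have \<sigma>: "\<sigma> x = y" if "(x, y) \<in> R" for x y
    using rel_functional[OF emb R(1) \<sigma>R that] .
  have e: "field_embedding \<sigma>"
    unfolding field_embedding_def
    by (intro conjI allI; rule \<sigma>)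
      (rule rel_1[OF emb R(1)] partial_homD(2)[OF R(1) \<sigma>R \<sigma>R] partial_homD(4)[OF R(1) \<sigma>R \<sigma>R])+
  have base: "\<sigma> (\<iota> a) = \<iota> a" for a by (rule \<sigma>[OF partial_homD(1)[OF R(1)]])
  have "surj \<sigma>"
    unfolding surj_def
  proof
    fix y
    obtain p where p: "p \<noteq> 0" "poly (map_poly \<iota> p) y = 0"
      using alg unfolding algebraic_extension_def by blast
    define Z where "Z = {x. poly (map_poly \<iota> p) x = 0}"
    have fin: "finite Z" unfolding Z_def
      by (rule poly_roots_finite) (use p(1) field_embedding_map_poly(6)[OF emb] in blast)
    have mm: "map_poly \<sigma> (map_poly \<iota> p) = map_poly \<iota> p"
      by (rule poly_eqI) (simp add: coeff_map_poly field_embedding_simps[OF emb] field_embedding_simps[OF e] base)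
    have "\<sigma> ` Z \<subseteq> Z"
    proof (clarsimp simp: Z_def)
      fix x assume "poly (map_poly \<iota> p) x = 0"
      then show "poly (map_poly \<iota> p) (\<sigma> x) = 0"
        using field_embedding_poly[OF e, of "map_poly \<iota> p" x] unfolding mm by (simp add: field_embedding_simps[OF e])
    qed
    moreover have "inj_on \<sigma> Z" using field_embedding_eq_iff[OF e] by (auto intro: inj_onI)
    ultimately have "\<sigma> ` Z = Z" using fin by (metis endo_inj_surj)
    moreover have "y \<in> Z" using p(2) by (simp add: Z_def)
    ultimately show "\<exists>x. y = \<sigma> x" by (metis imageE)
  qed
  moreover have "inj \<sigma>" using field_embedding_eq_iff[OF e] by (auto intro: injI)
  ultimately have "\<sigma> \<in> carrier (Gal \<iota>)" using e base by (simp add: Gal_def bij_def)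
  moreover have "\<forall>(x, y)\<in>R0. \<sigma> x = y" using \<sigma> R(2) by blast
  ultimately show ?thesis by blast
qed

text \<open>If x were the only root then, by normality, the image of p would be c (X - x)^n, with n
  at least 2 as x is outside the base field. The minimal polynomial of x, which has the degree of p,
  would divide the derivative of p; so this derivative would be 0 and p not separable.\<close>

lemma exists_conjugate_root:
  fixes \<iota> :: "'k::field \<Rightarrow> 'l::field"
  assumes nor: "normal_extension \<iota>" and sep: "separable_extension \<iota>"
    and p: "Factorial_Ring.irreducible p" "poly (map_poly \<iota> p) x = 0" and x: "x \<notin> range \<iota>"
  shows "\<exists>y. y \<noteq> x \<and> poly (map_poly \<iota> p) y = 0"
proof (rule ccontr)
  assume no: "\<nexists>y. y \<noteq> x \<and> poly (map_poly \<iota> p) y = 0"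
  have alg: "algebraic_extension \<iota>" using nor unfolding normal_extension_def by blast
  have emb: "field_embedding \<iota>" using alg unfolding algebraic_extension_def by blast
  note h = field_embedding_simps[OF emb] field_embedding_eq_0_iff[OF emb]
  note mp = field_embedding_map_poly[OF emb]
  obtain q where q: "Factorial_Ring.irreducible q" "poly (map_poly \<iota> q) x = 0" "q \<noteq> 0"
    "\<And>q'. poly (map_poly \<iota> q') x = 0 \<Longrightarrow> q dvd q'" by (metis exists_minimal_poly[OF alg])
  have p0: "p \<noteq> 0" using p(1) by auto
  have qp: "degree q = degree p"
  proof -
    have "q dvd p" by (rule q(4)[OF p(2)])
    then obtain u where u: "p = q * u" by (elim dvdE)
    then have "is_unit u" using p(1) q(1) by (metis Factorial_Ring.irreducible_def)
    then show ?thesis using u p0 by (metis degree_mult_eq add.right_neutral is_unit_iff_degree mult_eq_0_iff)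
  qed
  obtain c xs where cx: "map_poly \<iota> p = Polynomial.smult c (\<Prod>x\<leftarrow>xs. [:- x, 1:])"
    using nor p unfolding normal_extension_def splits_into_linear_factors_def by blast
  have c: "c \<noteq> 0" using cx p0 mp(6)[of p] by auto
  have "y = x" if "y \<in> set xs" for y
  proof -
    have "poly (map_poly \<iota> p) y = 0"
    proof -
      have "poly (\<Prod>x\<leftarrow>xs. [:- x, 1:]) y = 0" using that by (induction xs) auto
      then show ?thesis unfolding cx by simp
    qed
    then show ?thesis using no by blast
  qed
  then have xs: "xs = replicate (length xs) x" by (metis replicate_eqI)
  have P: "map_poly \<iota> p = Polynomial.smult c ([:- x, 1:] ^ length xs)"
    unfolding cx by (subst xs) (simp add: prod_list_replicate)
  have deg: "degree p = length xs"
    using mp(5)[of p] unfolding P using c by (simp add: degree_power_eq)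
  have "length xs \<noteq> 0" using p(2) c unfolding P by auto
  moreover have "length xs \<noteq> 1"
  proof
    assume "length xs = 1"
    then have e: "map_poly \<iota> p = Polynomial.smult c [:- x, 1:]" using P by simp
    have "Polynomial.coeff (map_poly \<iota> p) 0 = - c * x" "Polynomial.coeff (map_poly \<iota> p) 1 = c"
      unfolding e by simp_all
    then have "\<iota> (Polynomial.coeff p 0) = - \<iota> (Polynomial.coeff p 1) * x" "\<iota> (Polynomial.coeff p 1) \<noteq> 0"
      using c by (simp_all add: coeff_map_poly h)
    then have "x = \<iota> (- Polynomial.coeff p 0 * inverse (Polynomial.coeff p 1))"
    proof -
      assume a: "\<iota> (Polynomial.coeff p 0) = - \<iota> (Polynomial.coeff p 1) * x" "\<iota> (Polynomial.coeff p 1) \<noteq> 0"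
      then have "\<iota> (Polynomial.coeff p 1) * \<iota> (inverse (Polynomial.coeff p 1)) = 1"
        by (metis h(4,2,10) right_inverse)
      then show ?thesis using a by (simp add: h algebra_simps)
    qed
    then show False using x by blast
  qed
  ultimately have len: "length xs \<ge> 2" by linarith
  then obtain n where n: "length xs = Suc (Suc n)" by (metis Suc_le_D numeral_2_eq_2 le_Suc_ex add_2_eq_Suc)
  have "poly (pderiv (map_poly \<iota> p)) x = 0"
  proof -
    define L where "L = [:- x, 1:]"
    have L: "poly L x = 0" by (simp add: L_def)
    have "map_poly \<iota> p = L * (L * Polynomial.smult c (L ^ n))"
      unfolding P n L_def[symmetric] by simp
    then show ?thesis using L by (simp add: pderiv_mult pderiv_smult)
  qed
  then have "poly (map_poly \<iota> (pderiv p)) x = 0" by (simp add: mp)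
  then have "q dvd pderiv p" by (rule q(4))
  moreover have "degree (pderiv p) \<le> degree p - 1"
    by (rule degree_le) (auto simp: coeff_pderiv coeff_eq_0)
  ultimately have d0: "pderiv p = 0"
    using qp deg len by (metis One_nat_def Suc_le_lessD diff_less dvd_imp_degree_le leD le_less_trans less_2_cases_iff not_less zero_less_one)
  have "separable_polynomial p" using sep p unfolding separable_extension_def by blast
  then have rsf: "rsquarefree (map_poly to_ac p)" unfolding separable_polynomial_def .
  have ace: "field_embedding (to_ac :: 'k \<Rightarrow> 'k alg_closure)" unfolding field_embedding_def by simp
  note ma = field_embedding_map_poly[OF ace]
  have "degree (map_poly to_ac p) > 0" using deg len by (auto simp: ma)
  then obtain a where a: "poly (map_poly to_ac p :: 'k alg_closure poly) a = 0"
    using alg_closed_imp_poly_has_root by blast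
  then obtain g where g: "map_poly to_ac p = [:- a, 1:] * g" by (metis dvdE poly_eq_0_iff_dvd)
  have "pderiv (map_poly to_ac p :: 'k alg_closure poly) = 0" using d0 ma(7)[of p] by simp
  \<comment> \<open>At a, the vanishing derivative of (X - a) g takes the value g(a), so a is a
    multiple root.\<close>
  then have "g + [:- a, 1:] * pderiv g = 0" unfolding g pderiv_mult by (simp add: pderiv_pCons algebra_simps)
  then have "poly (g + [:- a, 1:] * pderiv g) a = 0" by simp
  then have "poly g a = 0" by simp
  then obtain g' where g': "g = [:- a, 1:] * g'" by (metis dvdE poly_eq_0_iff_dvd)
  have "[:- a, 1:]^2 dvd map_poly to_ac p"
    unfolding g g' power2_eq_square mult.assoc[symmetric] by (rule dvd_triv_left)
  moreover have nz: "map_poly (to_ac :: 'k \<Rightarrow> 'k alg_closure) p \<noteq> 0" using p0 ma(6) by blast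
  ultimately have "2 \<le> order a (map_poly to_ac p)" by (simp add: order_divides)
  moreover have "order a (map_poly to_ac p) = 0 \<or> order a (map_poly to_ac p) = 1"
    using rsf unfolding rsquarefree_def by blast
  ultimately show False by linarith
qed

text \<open>Sending q(x) to q(y), for y another root of the minimal polynomial p of x, is well
  defined because p divides every q with q(x) = 0. An automorphism extending this map moves
  x.\<close>

theorem fixed_field_of_Gal:
  assumes nor: "normal_extension \<iota>" and sep: "separable_extension \<iota>"
    and fixed: "\<And>\<sigma>. \<sigma> \<in> carrier (Gal \<iota>) \<Longrightarrow> \<sigma> x = x"
  shows "x \<in> range \<iota>"
proof (rule ccontr)
  assume x: "x \<notin> range \<iota>"
  have alg: "algebraic_extension \<iota>" using nor unfolding normal_extension_def by blast
  have emb: "field_embedding \<iota>" using alg unfolding algebraic_extension_def by blast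
  note mp = field_embedding_map_poly[OF emb]
  obtain p where p: "Factorial_Ring.irreducible p" "poly (map_poly \<iota> p) x = 0" "p \<noteq> 0"
    "\<And>q. poly (map_poly \<iota> q) x = 0 \<Longrightarrow> p dvd q" by (fact exists_minimal_poly[OF alg])
  obtain y where y: "y \<noteq> x" "poly (map_poly \<iota> p) y = 0" using exists_conjugate_root[OF nor sep p(1,2) x] by blast
  define R where "R = {(poly (map_poly \<iota> q) x, poly (map_poly \<iota> q) y) |q. True}"
  have "partial_hom \<iota> R"
    unfolding partial_hom_def
  proof (intro conjI allI impI)
    fix a
    have "map_poly \<iota> [:a:] = [:\<iota> a:]" by (simp add: map_poly_pCons field_embedding_simps[OF emb])
    then have "\<iota> a = poly (map_poly \<iota> [:a:]) z" for z by simp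
    then show "(\<iota> a, \<iota> a) \<in> R" unfolding R_def by blast
  next
    fix u u' v v' assume "(u, u') \<in> R" "(v, v') \<in> R"
    then obtain q q' where q: "u = poly (map_poly \<iota> q) x" "u' = poly (map_poly \<iota> q) y"
      "v = poly (map_poly \<iota> q') x" "v' = poly (map_poly \<iota> q') y" unfolding R_def by blast
    show "(u + v, u' + v') \<in> R" unfolding R_def q poly_add[symmetric] mp(1)[symmetric] by blast
    show "(u - v, u' - v') \<in> R" unfolding R_def q poly_diff[symmetric] mp(3)[symmetric] by blast
    show "(u * v, u' * v') \<in> R" unfolding R_def q poly_mult[symmetric] mp(2)[symmetric] by blast
  next
    fix v assume "(0, v) \<in> R"
    then obtain q where q: "poly (map_poly \<iota> q) x = 0" "v = poly (map_poly \<iota> q) y" unfolding R_def by auto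
    obtain d where "q = p * d" using p(4)[OF q(1)] by (elim dvdE)
    then show "v = 0" using q(2) y(2) by (simp add: mp)
  qed
  then obtain \<sigma> where \<sigma>: "\<sigma> \<in> carrier (Gal \<iota>)" "\<forall>(u, v)\<in>R. \<sigma> u = v"
    using extend_to_automorphism[OF nor] by blast
  have "map_poly \<iota> [:0, 1:] = [:0, 1:]" by (simp add: map_poly_pCons field_embedding_simps[OF emb])
  then have "z = poly (map_poly \<iota> [:0, 1:]) z" for z by simp
  then have "(x, y) \<in> R" unfolding R_def by blast
  then have "\<sigma> x = y" using \<sigma>(2) by fastforce
  then show False using fixed[OF \<sigma>(1)] y(1) by simp
qed

lemma Gal_carrier: "\<sigma> \<in> carrier (Gal \<iota>) \<longleftrightarrow> bij \<sigma> \<and> field_embedding \<sigma> \<and> (\<forall>a. \<sigma> (\<iota> a) = \<iota> a)"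
  by (simp add: Gal_def)

lemma Gal_comp:
  assumes "\<sigma> \<in> carrier (Gal \<iota>)" "\<tau> \<in> carrier (Gal \<iota>)"
  shows "\<sigma> \<circ> \<tau> \<in> carrier (Gal \<iota>)"
  using assms by (auto simp: Gal_carrier field_embedding_comp bij_comp)

lemma Gal_id: "id \<in> carrier (Gal \<iota>)"
  by (simp add: Gal_carrier field_embedding_def)

lemma Gal_inv:
  assumes "\<sigma> \<in> carrier (Gal \<iota>)"
  shows "inv_into UNIV \<sigma> \<in> carrier (Gal \<iota>)" "\<sigma> \<circ> inv_into UNIV \<sigma> = id" "inv_into UNIV \<sigma> \<circ> \<sigma> = id"
proof -
  have s: "bij \<sigma>" "field_embedding \<sigma>" "\<And>a. \<sigma> (\<iota> a) = \<iota> a" using assms by (auto simp: Gal_carrier)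
  have e: "\<sigma> (inv_into UNIV \<sigma> x) = x" "inv_into UNIV \<sigma> (\<sigma> x) = x" for x
    using s(1) by (simp_all add: bij_is_surj bij_is_inj surj_f_inv_f)
  note h = field_embedding_simps[OF s(2)]
  have "inv_into UNIV \<sigma> (x + y) = inv_into UNIV \<sigma> x + inv_into UNIV \<sigma> y" "inv_into UNIV \<sigma> (x * y) = inv_into UNIV \<sigma> x * inv_into UNIV \<sigma> y" "inv_into UNIV \<sigma> 1 = 1" "inv_into UNIV \<sigma> (\<iota> a) = \<iota> a" for x y a
    by (metis e h(3), metis e h(4), metis e(2) h(2), metis e(2) s(3))
  then show "inv_into UNIV \<sigma> \<in> carrier (Gal \<iota>)" using s(1) by (simp add: Gal_carrier field_embedding_def bij_imp_bij_inv)
  show "\<sigma> \<circ> inv_into UNIV \<sigma> = id" "inv_into UNIV \<sigma> \<circ> \<sigma> = id" using e by auto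
qed

lemma sum_Gal_shift:
  assumes "\<tau> \<in> carrier (Gal \<iota>)"
  shows "(\<Sum>\<sigma>\<in>carrier (Gal \<iota>). f (\<tau> \<circ> \<sigma>)) = (\<Sum>\<sigma>\<in>carrier (Gal \<iota>). f \<sigma>)"
proof (rule sum.reindex_bij_witness[where i = "\<lambda>\<sigma>. inv_into UNIV \<tau> \<circ> \<sigma>" and j = "\<lambda>\<sigma>. \<tau> \<circ> \<sigma>"])
  note i = Gal_inv[OF assms]
  fix \<sigma> assume s: "\<sigma> \<in> carrier (Gal \<iota>)"
  show "inv_into UNIV \<tau> \<circ> (\<tau> \<circ> \<sigma>) = \<sigma>" "\<tau> \<circ> (inv_into UNIV \<tau> \<circ> \<sigma>) = \<sigma>" using i(2,3) by (metis comp_assoc id_comp)+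
  show "\<tau> \<circ> \<sigma> \<in> carrier (Gal \<iota>)" "inv_into UNIV \<tau> \<circ> \<sigma> \<in> carrier (Gal \<iota>)" using s i(1) assms Gal_comp by blast+
qed simp

section \<open>Equivariant points in general position\<close>

text \<open>Each condition is affine in c and not identically satisfied, so it excludes at most one
  c. This is how an infinite base field yields general position.\<close>

lemma finite_bad_scalars:
  assumes emb: "field_embedding \<iota>" and "finite I" and "\<And>x. x \<in> I \<Longrightarrow> g x = 0 \<Longrightarrow> f x \<noteq> 0"
  shows "finite {c. \<exists>x\<in>I. f x + \<iota> c * g x = 0}"
proof -
  have "{c. \<exists>x\<in>I. f x + \<iota> c * g x = 0} = (\<Union>x\<in>I. {c. f x + \<iota> c * g x = 0})" by auto
  moreover have "finite {c. f x + \<iota> c * g x = 0}" if "x \<in> I" for x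
  proof (rule finite_subset)
    show "{c. f x + \<iota> c * g x = 0} \<subseteq> (if g x = 0 then {} else \<iota> -` {- f x / g x})"
      using assms(3)[OF that] by (auto simp: field_simps eq_neg_iff_add_eq_0 add.commute)
    show "finite (if g x = 0 then {} else \<iota> -` {- f x / g x})"
      using field_embedding_eq_iff[OF emb] by (auto intro: finite_vimageI injI)
  qed
  ultimately show ?thesis using assms(2) by simp
qed

text \<open>The data that a homomorphism into U_ds amounts to: an action \<open>p\<close> on the six
  indices and a sign character \<open>\<psi>\<close>, whose values are taken in the extension field
  so that they can multiply s.\<close>

locale galois_sextic =
  fixes \<iota> :: "'k::field \<Rightarrow> 'l::field" and p :: "('l \<Rightarrow> 'l) \<Rightarrow> nat \<Rightarrow> nat" and \<psi> :: "('l \<Rightarrow> 'l) \<Rightarrow> 'l"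
  assumes inf: "infinite (UNIV :: 'k set)" and emb: "field_embedding \<iota>" and fin: "finite (carrier (Gal \<iota>))"
    and perm: "\<And>\<sigma>. \<sigma> \<in> carrier (Gal \<iota>) \<Longrightarrow> p \<sigma> permutes {1..6}"
    and hom: "\<And>\<sigma> \<tau>. \<sigma> \<in> carrier (Gal \<iota>) \<Longrightarrow> \<tau> \<in> carrier (Gal \<iota>) \<Longrightarrow> p (\<sigma> \<circ> \<tau>) = p \<sigma> \<circ> p \<tau>"
    and sign: "\<And>\<sigma>. \<sigma> \<in> carrier (Gal \<iota>) \<Longrightarrow> \<psi> \<sigma> = 1 \<or> \<psi> \<sigma> = -1"
    and hom': "\<And>\<sigma> \<tau>. \<sigma> \<in> carrier (Gal \<iota>) \<Longrightarrow> \<tau> \<in> carrier (Gal \<iota>) \<Longrightarrow> \<psi> (\<sigma> \<circ> \<tau>) = \<psi> \<sigma> * \<psi> \<tau>"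
begin

abbreviation "G \<equiv> carrier (Gal \<iota>)"

lemma Gal_D: "\<sigma> \<in> G \<Longrightarrow> field_embedding \<sigma>" "\<sigma> \<in> G \<Longrightarrow> \<sigma> (\<iota> a) = \<iota> a"
  by (auto simp: Gal_carrier)

lemma p_id: "p id = id"
  using hom[OF Gal_id Gal_id] perm[OF Gal_id]
  by (metis comp_id permutes_inv_o(2) comp_assoc id_comp)

text \<open>The vectors of sum 0 that are fixed when the Galois group acts on entries and positions
  at once; they form a vector space over the base field.\<close>

definition equivariant :: "(nat \<Rightarrow> 'l) \<Rightarrow> bool" where
  "equivariant r \<longleftrightarrow> (\<Sum>i\<in>{1..6}. r i) = 0 \<and> (\<forall>\<sigma>\<in>G. \<forall>m\<in>{1..6}. \<sigma> (r m) = r (p \<sigma> m))"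

lemma equivariant_combination:
  assumes "equivariant r" "equivariant r'"
  shows "equivariant (\<lambda>m. r m + \<iota> c * r' m)"
  using assms by (auto simp: equivariant_def field_embedding_simps[OF Gal_D(1)] Gal_D(2) sum.distrib sum_distrib_left[symmetric])

lemma equivariant_average:
  assumes x: "(\<Sum>i\<in>{1..6}. x i) = 0"
  shows "equivariant (\<lambda>m. \<Sum>\<sigma>\<in>G. \<sigma> (x (inv_into UNIV (p \<sigma>) m)))"
  unfolding equivariant_def
proof (intro conjI ballI)
  have "(\<Sum>i\<in>{1..6}. \<Sum>\<sigma>\<in>G. \<sigma> (x (inv_into UNIV (p \<sigma>) i))) = (\<Sum>\<sigma>\<in>G. \<Sum>i\<in>{1..6}. \<sigma> (x (inv_into UNIV (p \<sigma>) i)))"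
    by (rule sum.swap)
  also have "\<dots> = (\<Sum>\<sigma>\<in>G. \<sigma> (\<Sum>i\<in>{1..6}. x i))"
  proof (rule sum.cong[OF refl])
    fix \<sigma> assume s: "\<sigma> \<in> G"
    have "(\<Sum>i\<in>{1..6}. x (inv_into UNIV (p \<sigma>) i)) = (\<Sum>i\<in>{1..6}. x i)"
      using sum.permute[OF permutes_inv[OF perm[OF s]], of x] by (simp add: o_def)
    then show "(\<Sum>i\<in>{1..6}. \<sigma> (x (inv_into UNIV (p \<sigma>) i))) = \<sigma> (\<Sum>i\<in>{1..6}. x i)"
      by (simp add: field_embedding_sum[OF Gal_D(1)[OF s], symmetric])
  qed
  also have "\<dots> = 0" unfolding x by (rule sum.neutral) (simp add: field_embedding_simps[OF Gal_D(1)])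
  finally show "(\<Sum>i\<in>{1..6}. \<Sum>\<sigma>\<in>G. \<sigma> (x (inv_into UNIV (p \<sigma>) i))) = 0" .
next
  fix \<tau> m assume t: "\<tau> \<in> G" and m: "m \<in> {1..6::nat}"
  have "\<tau> (\<Sum>\<sigma>\<in>G. \<sigma> (x (inv_into UNIV (p \<sigma>) m))) = (\<Sum>\<sigma>\<in>G. (\<tau> \<circ> \<sigma>) (x (inv_into UNIV (p (\<tau> \<circ> \<sigma>)) (p \<tau> m))))"
    unfolding field_embedding_sum[OF Gal_D(1)[OF t]]
  proof (rule sum.cong[OF refl])
    fix \<sigma> assume s: "\<sigma> \<in> G"
    have "inv_into UNIV (p (\<tau> \<circ> \<sigma>)) (p \<tau> m) = inv_into UNIV (p \<sigma>) m"
    proof (rule inv_f_eq)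
      show "inj (p (\<tau> \<circ> \<sigma>))" using perm[OF Gal_comp[OF t s]] permutes_inj by blast
      show "p (\<tau> \<circ> \<sigma>) (inv_into UNIV (p \<sigma>) m) = p \<tau> m"
        using permutes_inverses(1)[OF perm[OF s]] by (simp add: hom[OF t s])
    qed
    then show "\<tau> (\<sigma> (x (inv_into UNIV (p \<sigma>) m))) = (\<tau> \<circ> \<sigma>) (x (inv_into UNIV (p (\<tau> \<circ> \<sigma>)) (p \<tau> m)))" by simp
  qed
  also have "\<dots> = (\<Sum>\<sigma>\<in>G. \<sigma> (x (inv_into UNIV (p \<sigma>) (p \<tau> m))))"
    by (rule sum_Gal_shift[OF t, of "\<lambda>\<sigma>. \<sigma> (x (inv_into UNIV (p \<sigma>) (p \<tau> m)))"])
  finally show "\<tau> (\<Sum>\<sigma>\<in>G. \<sigma> (x (inv_into UNIV (p \<sigma>) m))) = (\<Sum>\<sigma>\<in>G. \<sigma> (x (inv_into UNIV (p \<sigma>) (p \<tau> m))))" .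
qed

text \<open>For an average r, the difference r a - r b is a linear combination of automorphisms
  applied to l; by their independence it is nonzero for some l as soon as one coefficient is
  nonzero.\<close>

lemma equivariant_separating:
  assumes a: "a \<in> {1..6}" and b: "b \<in> {1..6}" "a \<noteq> b"
  shows "\<exists>r. equivariant r \<and> r a \<noteq> r b"
proof -
  have "\<exists>d\<in>{1..6}. d \<noteq> a \<and> d \<noteq> b"
  proof (rule ccontr)
    assume "\<not> ?thesis"
    then have "{1..6} \<subseteq> {a, b}" by blast
    then have "card {1..6::nat} \<le> card {a, b}" by (intro card_mono) auto
    then show False using card_insert_le_m1[of 2 "{b}" a] by (auto simp: card_insert_if split: if_splits)
  qed
  then obtain d where d: "d \<in> {1..6}" "d \<noteq> a" "d \<noteq> b" by blast
  \<comment> \<open>The third index d makes the sum 0 without touching b, so that the coefficient of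
    the identity in r a - r b is 1.\<close>
  define \<epsilon> :: "nat \<Rightarrow> 'l" where "\<epsilon> n = (if n = a then 1 else if n = d then -1 else 0)" for n
  define c where "c \<sigma> = \<epsilon> (inv_into UNIV (p \<sigma>) a) - \<epsilon> (inv_into UNIV (p \<sigma>) b)" for \<sigma>
  have "c id = 1" using a b d by (simp add: c_def p_id \<epsilon>_def)
  then have "\<not> (\<forall>\<sigma>\<in>G. c \<sigma> = 0)" using Gal_id[of \<iota>] by (metis zero_neq_one)
  then obtain l where l: "(\<Sum>\<sigma>\<in>G. c \<sigma> * \<sigma> l) \<noteq> 0"
    using Dedekind_independence[OF fin Gal_D(1)] by blast
  define x where "x n = \<epsilon> n * l" for n
  have eps: "\<sigma> (\<epsilon> n * y) = \<epsilon> n * \<sigma> y" if "\<sigma> \<in> G" for \<sigma> n y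
    by (simp add: \<epsilon>_def field_embedding_simps[OF Gal_D(1)[OF that]])
  define r where "r = (\<lambda>m. \<Sum>\<sigma>\<in>G. \<sigma> (x (inv_into UNIV (p \<sigma>) m)))"
  have "(\<Sum>i\<in>{1..6}. \<epsilon> i) = (\<Sum>i\<in>{a, d}. \<epsilon> i)"
    using a d by (intro sum.mono_neutral_right) (auto simp: \<epsilon>_def)
  then have "(\<Sum>i\<in>{1..6}. x i) = 0" using d by (simp add: x_def sum_distrib_right[symmetric] \<epsilon>_def)
  then have "equivariant r" unfolding r_def by (rule equivariant_average)
  moreover have "r a - r b = (\<Sum>\<sigma>\<in>G. c \<sigma> * \<sigma> l)"
    unfolding r_def sum_subtractf[symmetric] c_def
    by (rule sum.cong[OF refl]) (simp add: x_def eps left_diff_distrib)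
  ultimately show ?thesis using l by (intro exI[of _ r]) auto
qed

text \<open>Separating vectors are added one pair at a time, with nonzero scalars from the base
  field that avoid the finitely many values destroying a pair separated before.\<close>

lemma equivariant_injective: "\<exists>r. equivariant r \<and> inj_on r {1..6}"
proof -
  have "\<exists>r. equivariant r \<and> (\<forall>(a, b)\<in>I. r a \<noteq> r b)"
    if "finite I" "\<And>a b. (a, b) \<in> I \<Longrightarrow> a \<in> {1..6} \<and> b \<in> {1..6} \<and> a \<noteq> b" for I
    using that
  proof (induction I rule: finite_induct)
    case empty
    have "equivariant (\<lambda>_. 0)" by (auto simp: equivariant_def field_embedding_simps[OF Gal_D(1)])
    then show ?case by blast
  next
    case (insert ab I)
    obtain r where r: "equivariant r" "\<forall>(a, b)\<in>I. r a \<noteq> r b" using insert by auto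
    obtain a0 b0 where ab: "ab = (a0, b0)" by (cases ab)
    obtain r' where r': "equivariant r'" "r' a0 \<noteq> r' b0" using equivariant_separating[of a0 b0] insert.prems ab by blast
    show ?case
    proof (cases "r a0 = r b0")
      case False then show ?thesis using r ab by blast
    next
      case True
      have "finite {c. \<exists>x\<in>I. (r (fst x) - r (snd x)) + \<iota> c * (r' (fst x) - r' (snd x)) = 0}"
        by (rule finite_bad_scalars[OF emb insert.hyps(1)]) (use r(2) in auto)
      then have "finite (insert 0 {c. \<exists>x\<in>I. (r (fst x) - r (snd x)) + \<iota> c * (r' (fst x) - r' (snd x)) = 0})" by simp
      then obtain c where c: "c \<notin> insert 0 {c. \<exists>x\<in>I. (r (fst x) - r (snd x)) + \<iota> c * (r' (fst x) - r' (snd x)) = 0}"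
        using inf ex_new_if_finite by blast
      have "equivariant (\<lambda>m. r m + \<iota> c * r' m)" by (rule equivariant_combination[OF r(1) r'(1)])
      moreover have "r a0 + \<iota> c * r' a0 \<noteq> r b0 + \<iota> c * r' b0"
        using True c r'(2) field_embedding_eq_0_iff[OF emb] by auto
      moreover have "r a + \<iota> c * r' a \<noteq> r b + \<iota> c * r' b" if "(a, b) \<in> I" for a b
        using c that by (force simp: algebra_simps)
      ultimately show ?thesis unfolding ab by (intro exI[of _ "\<lambda>m. r m + \<iota> c * r' m"]) auto
    qed
  qed
  note sep = this
  define J where "J = {ab \<in> {1..6::nat} \<times> {1..6}. fst ab \<noteq> snd ab}"
  have "finite J" unfolding J_def by simp
  then have "\<exists>r. equivariant r \<and> (\<forall>(a, b)\<in>J. r a \<noteq> r b)"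
    by (rule sep) (simp add: J_def)
  then obtain r where r: "equivariant r" "\<forall>(a, b)\<in>J. r a \<noteq> r b" by blast
  have "inj_on r {1..6}"
  proof (rule inj_onI, rule ccontr)
    fix a b assume ab: "a \<in> {1..6}" "b \<in> {1..6}" "r a = r b" "a \<noteq> b"
    then have "(a, b) \<in> J" by (simp add: J_def)
    then show False using r(2) ab(3) by fast
  qed
  then show ?thesis using r(1) by blast
qed

text \<open>A resolvent: the sum of \<open>\<psi> \<sigma> * \<sigma> l\<close> is multiplied by
  \<open>\<psi> \<tau>\<close> under \<tau>, and independence provides an l for which it is
  nonzero.\<close>

lemma semi_invariant: "\<exists>s. s \<noteq> 0 \<and> (\<forall>\<sigma>\<in>G. \<sigma> s = \<psi> \<sigma> * s)"
proof -
  have sq: "\<psi> \<sigma> * \<psi> \<sigma> = 1" if "\<sigma> \<in> G" for \<sigma> using sign[OF that] by auto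
  have "\<psi> id \<noteq> 0" using sign[OF Gal_id] by auto
  then have "\<not> (\<forall>\<sigma>\<in>G. \<psi> \<sigma> = 0)" using Gal_id[of \<iota>] by blast
  then obtain l where l: "(\<Sum>\<sigma>\<in>G. \<psi> \<sigma> * \<sigma> l) \<noteq> 0"
    using Dedekind_independence[OF fin Gal_D(1)] by blast
  have "\<tau> (\<Sum>\<sigma>\<in>G. \<psi> \<sigma> * \<sigma> l) = \<psi> \<tau> * (\<Sum>\<sigma>\<in>G. \<psi> \<sigma> * \<sigma> l)" if t: "\<tau> \<in> G" for \<tau>
  proof -
    note h = field_embedding_simps[OF Gal_D(1)[OF t]]
    have "\<tau> (\<Sum>\<sigma>\<in>G. \<psi> \<sigma> * \<sigma> l) = (\<Sum>\<sigma>\<in>G. \<psi> \<tau> * (\<psi> (\<tau> \<circ> \<sigma>) * (\<tau> \<circ> \<sigma>) l))"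
      unfolding field_embedding_sum[OF Gal_D(1)[OF t]]
    proof (rule sum.cong[OF refl])
      fix \<sigma> assume s: "\<sigma> \<in> G"
      have "\<tau> (\<psi> \<sigma>) = \<psi> \<sigma>" using sign[OF s] h by auto
      then show "\<tau> (\<psi> \<sigma> * \<sigma> l) = \<psi> \<tau> * (\<psi> (\<tau> \<circ> \<sigma>) * (\<tau> \<circ> \<sigma>) l)"
        unfolding hom'[OF t s] using sq[OF t] by (simp add: h mult.assoc[symmetric])
    qed
    also have "\<dots> = \<psi> \<tau> * (\<Sum>\<sigma>\<in>G. \<psi> (\<tau> \<circ> \<sigma>) * (\<tau> \<circ> \<sigma>) l)" by (rule sum_distrib_left[symmetric])
    also have "(\<Sum>\<sigma>\<in>G. \<psi> (\<tau> \<circ> \<sigma>) * (\<tau> \<circ> \<sigma>) l) = (\<Sum>\<sigma>\<in>G. \<psi> \<sigma> * \<sigma> l)"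
      by (rule sum_Gal_shift[OF t, of "\<lambda>\<sigma>. \<psi> \<sigma> * \<sigma> l"])
    finally show ?thesis .
  qed
  then show ?thesis using l by blast
qed

theorem exists_generic:
  assumes two: "(2::'l) \<noteq> 0"
  shows "\<exists>r s. generic r s \<and> (\<forall>\<sigma>\<in>G. (\<forall>m\<in>{1..6}. \<sigma> (r m) = r (p \<sigma> m)) \<and> \<sigma> s = \<psi> \<sigma> * s)"
proof -
  obtain r where r: "equivariant r" "inj_on r {1..6}" using equivariant_injective by blast
  obtain s where s: "s \<noteq> 0" "\<And>\<sigma>. \<sigma> \<in> G \<Longrightarrow> \<sigma> s = \<psi> \<sigma> * s" using semi_invariant by blast
  \<comment> \<open>Replacing s by a nonzero multiple from the base field keeps its Galois
    behaviour. Both signs e are included; repeated indices do no harm because s is nonzero.\<close>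
  define I where "I = {1..6::nat} \<times> {1..6::nat} \<times> {1..6::nat} \<times> {1, -1::'l}"
  have "finite {c. \<exists>x\<in>I. (case x of (i, j, k, e) \<Rightarrow> r i + r j + r k) + \<iota> c * (case x of (i, j, k, e) \<Rightarrow> e * s) = 0}"
    by (rule finite_bad_scalars[OF emb]) (use s(1) in \<open>auto simp: I_def\<close>)
  then have "finite (insert 0 {c. \<exists>x\<in>I. (case x of (i, j, k, e) \<Rightarrow> r i + r j + r k) + \<iota> c * (case x of (i, j, k, e) \<Rightarrow> e * s) = 0})"
    by simp
  then obtain c where c: "c \<notin> insert 0 {c. \<exists>x\<in>I. (case x of (i, j, k, e) \<Rightarrow> r i + r j + r k) + \<iota> c * (case x of (i, j, k, e) \<Rightarrow> e * s) = 0}"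
    using inf ex_new_if_finite by blast
  have ce: "r i + r j + r k + \<iota> c * (e * s) \<noteq> 0" if "i \<in> {1..6}" "j \<in> {1..6}" "k \<in> {1..6}" "e = 1 \<or> e = -1" for i j k e
  proof
    assume "r i + r j + r k + \<iota> c * (e * s) = 0"
    moreover have "(i, j, k, e) \<in> I" using that by (auto simp: I_def)
    ultimately show False using c by force
  qed
  have ne: "r i + r j + r k \<noteq> \<iota> c * s \<and> r i + r j + r k \<noteq> - (\<iota> c * s)" if "i \<in> {1..6}" "j \<in> {1..6}" "k \<in> {1..6}" for i j k
    using ce[OF that, of 1] ce[OF that, of "-1"] by auto
  have "generic r (\<iota> c * s)"
    unfolding generic_def using two r s(1) c ne field_embedding_eq_0_iff[OF emb] by (auto simp: equivariant_def)
  moreover have "\<sigma> (\<iota> c * s) = \<psi> \<sigma> * (\<iota> c * s)" if "\<sigma> \<in> G" for \<sigma>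
    using s(2)[OF that] Gal_D(2)[OF that] by (simp add: field_embedding_simps[OF Gal_D(1)[OF that]])
  ultimately show ?thesis using r(1) unfolding equivariant_def by blast
qed

end

section \<open>Double-sixes\<close>

definition mkC :: "nat \<Rightarrow> nat \<Rightarrow> schlaefli" where
  "mkC i j = LC (min i j) (max i j)"

definition normal_label :: "schlaefli \<Rightarrow> bool" where
  "normal_label x \<longleftrightarrow> x \<in> set schlaefli_lines"

lemma normal_label_simps [simp]:
  "normal_label (LA i) \<longleftrightarrow> i \<in> {1..6}" "normal_label (LB i) \<longleftrightarrow> i \<in> {1..6}"
  "normal_label (LC i j) \<longleftrightarrow> i \<in> {1..6} \<and> j \<in> {1..6} \<and> i < j"
proof -
  show "normal_label (LA i) \<longleftrightarrow> i \<in> {1..6}"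
    unfolding normal_label_def schlaefli_lines_def by (simp, presburger)
  show "normal_label (LB i) \<longleftrightarrow> i \<in> {1..6}"
    unfolding normal_label_def schlaefli_lines_def by (simp, presburger)
  show "normal_label (LC i j) \<longleftrightarrow> i \<in> {1..6} \<and> j \<in> {1..6} \<and> i < j"
    unfolding normal_label_def schlaefli_lines_def by (simp, presburger)
qed

lemma normal_label_mkC: "i \<in> {1..6} \<Longrightarrow> j \<in> {1..6} \<Longrightarrow> i \<noteq> j \<Longrightarrow> normal_label (mkC i j)"
  by (auto simp: mkC_def min_def max_def)

lemma mkC_commute: "mkC i j = mkC j i"
  by (simp add: mkC_def min.commute max.commute)

lemma pairing_commute: "schlaefli_pairing x y = schlaefli_pairing y x"
  by (cases x; cases y) auto

lemma pairing_mkC: "schlaefli_pairing (mkC i j) y = schlaefli_pairing (LC i j) y"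
  by (cases y) (auto simp: mkC_def min_def max_def insert_commute)

lemma pairing_eq_minus_1:
  assumes "normal_label x" "normal_label y"
  shows "schlaefli_pairing x y = -1 \<longleftrightarrow> x = y"
  using assms by (cases x; cases y) (auto simp: doubleton_eq_iff)

lemma pairing_LC_LC:
  assumes "i \<noteq> j" "k \<noteq> l"
  shows "schlaefli_pairing (LC i j) (LC k l) = 1 - (if i \<in> {k, l} then 1 else 0) - (if j \<in> {k, l} then 1 else 0)"
  using assms by (auto simp: doubleton_eq_iff)

lemma complement_pair:
  assumes "i \<in> {1..6::nat}" "j \<in> {1..6}" "k \<in> {1..6}" "l \<in> {1..6}" "distinct [i,j,k,l]"
  obtains m n where "{1..6} = {i,j,k,l,m,n}" "distinct [i,j,k,l,m,n]"
proof -
  have "card ({1..6} - {i,j,k,l}) = 2" using assms by (subst card_Diff_subset) auto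
  then obtain m n where mn: "{1..6} - {i,j,k,l} = {m, n}" "m \<noteq> n" by (meson card_2_iff)
  then have "{1..6} = {i,j,k,l} \<union> {m,n}" "m \<notin> {i,j,k,l}" "n \<notin> {i,j,k,l}" using assms(1-4) by blast+
  then show ?thesis using that[of m n] mn(2) assms(5) by auto
qed

text \<open>z is the third line in the plane of x and y, and the equation says that x + y + z is the
  hyperplane class. The planes are those of A_i, B_j, C_ij and those of C_ij, C_kl, C_mn with six
  distinct indices.\<close>

lemma third_line:
  assumes "normal_label x" "normal_label y" "schlaefli_pairing x y = 1"
  shows "\<exists>z. normal_label z \<and> (\<forall>w. normal_label w \<longrightarrow>
    schlaefli_pairing z w = 1 - schlaefli_pairing x w - schlaefli_pairing y w)"
proof -
  have AB: "schlaefli_pairing (mkC i j) w = 1 - schlaefli_pairing (LA i) w - schlaefli_pairing (LB j) w"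
    if "i \<noteq> j" "normal_label w" for i j w
    using that unfolding pairing_mkC by (cases w) (auto simp: pairing_LC_LC simp del: schlaefli_pairing.simps(9))
  have AC: "schlaefli_pairing (LB j) w = 1 - schlaefli_pairing (LA i) w - schlaefli_pairing (mkC i j) w"
    and BC: "schlaefli_pairing (LA i) w = 1 - schlaefli_pairing (LB j) w - schlaefli_pairing (mkC i j) w"
    if "i \<noteq> j" "normal_label w" for i j w
    using AB[OF that] by simp_all
  have CC: "\<exists>z. normal_label z \<and> (\<forall>w. normal_label w \<longrightarrow>
    schlaefli_pairing z w = 1 - schlaefli_pairing (LC i j) w - schlaefli_pairing (LC k l) w)"
    if i: "i \<in> {1..6}" "j \<in> {1..6}" "k \<in> {1..6}" "l \<in> {1..6}" and d: "distinct [i,j,k,l]" for i j k l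
  proof -
    obtain m n where mn: "{1..6} = {i,j,k,l,m,n}" "distinct [i,j,k,l,m,n]"
      using complement_pair[OF i d] .
    define \<delta> :: "nat \<Rightarrow> nat \<Rightarrow> nat \<Rightarrow> int" where "\<delta> a b q = (if q \<in> {a, b} then 1 else 0)" for a b q
    \<comment> \<open>The three pairs partition the six indices, so exactly one of the three
      indicators is 1.\<close>
    have one: "\<delta> m n q = 1 - \<delta> i j q - \<delta> k l q" if "q \<in> {1..6}" for q
    proof -
      have "q \<in> {i,j,k,l,m,n}" using that mn(1) by blast
      then show ?thesis using mn(2) unfolding \<delta>_def by (elim insertE) auto
    qed
    have "schlaefli_pairing (mkC m n) w = 1 - schlaefli_pairing (LC i j) w - schlaefli_pairing (LC k l) w"
      if w: "normal_label w" for w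
    proof (cases w)
      case (LA q) then show ?thesis using w one[of q] unfolding pairing_mkC \<delta>_def by simp
    next
      case (LB q) then show ?thesis using w one[of q] unfolding pairing_mkC \<delta>_def by simp
    next
      case (LC p q)
      then have pq: "p \<noteq> q" "p \<in> {1..6}" "q \<in> {1..6}" using w by auto
      have ne: "m \<noteq> n" "i \<noteq> j" "k \<noteq> l" using mn(2) by auto
      have S: "schlaefli_pairing (LC a b) (LC p q) = 1 - \<delta> a b p - \<delta> a b q"
        if "a \<noteq> b" for a b using pairing_LC_LC[OF pq(1) that] unfolding \<delta>_def by (simp only: pairing_commute[of "LC a b"])
      show ?thesis unfolding pairing_mkC LC S[OF ne(1)] S[OF ne(2)] S[OF ne(3)] one[OF pq(2)] one[OF pq(3)] by simp
    qed
    moreover have "normal_label (mkC m n)" using mn by (intro normal_label_mkC) auto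
    ultimately show ?thesis by blast
  qed
  have main: "\<exists>z. normal_label z \<and> (\<forall>w. normal_label w \<longrightarrow> schlaefli_pairing z w = 1 - schlaefli_pairing x w - schlaefli_pairing y w)"
    if "normal_label x" "normal_label y" "schlaefli_pairing x y = 1"
      "(\<exists>i j. x = LA i \<and> y = LB j) \<or> (\<exists>i j k. x = LA i \<and> y = LC j k) \<or> (\<exists>i j k. x = LB i \<and> y = LC j k) \<or> (\<exists>i j k l. x = LC i j \<and> y = LC k l)"
    for x y
    using that(4)
  proof (elim disjE exE conjE)
    fix i j assume e: "x = LA i" "y = LB j"
    then have "i \<noteq> j" "normal_label (mkC i j)" using that(1-3) normal_label_mkC[of i j] by (auto split: if_splits)
    then show ?thesis using AB unfolding e by blast
  next
    fix i j k assume e: "x = LA i" "y = LC j k"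
    then have n: "mkC j k = y" using that by (simp add: mkC_def)
    have "i = j \<or> i = k" "j \<noteq> k" "j \<in> {1..6}" "k \<in> {1..6}" using e that(1-3) by (auto split: if_splits)
    then obtain l where l: "i \<noteq> l" "l \<in> {1..6}" "mkC i l = y" using n mkC_commute by metis
    have "normal_label (LB l)" using l by simp
    then show ?thesis using AC[OF l(1)] unfolding l(3) e(1) by blast
  next
    fix i j k assume e: "x = LB i" "y = LC j k"
    then have n: "mkC j k = y" using that by (simp add: mkC_def)
    have "i = j \<or> i = k" "j \<noteq> k" "j \<in> {1..6}" "k \<in> {1..6}" using e that(1-3) by (auto split: if_splits)
    then obtain l where l: "l \<noteq> i" "l \<in> {1..6}" "mkC l i = y" using n mkC_commute by metis
    have "normal_label (LA l)" using l by simp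
    then show ?thesis using BC[OF l(1)] unfolding l(3) e(1) by blast
  next
    fix i j k l assume e: "x = LC i j" "y = LC k l"
    have n: "i \<in> {1..6}" "j \<in> {1..6}" "i < j" "k \<in> {1..6}" "l \<in> {1..6}" "k < l"
      using that(1,2) unfolding e normal_label_simps by blast+
    have "{i, j} \<inter> {k, l} = {}" using that(3) unfolding e by (simp split: if_splits)
    then have d: "distinct [i,j,k,l]" using n(3,6) by auto
    show ?thesis unfolding e by (rule CC[OF n(1,2,4,5) d])
  qed
  have sw: "schlaefli_pairing y x = 1" using assms(3) pairing_commute by metis
  have sym: "(1::int) - a - b = 1 - b - a" for a b by simp
  have swapped: ?thesis if "\<exists>z. normal_label z \<and> (\<forall>w. normal_label w \<longrightarrow> schlaefli_pairing z w = 1 - schlaefli_pairing y w - schlaefli_pairing x w)"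
    using that by (simp only: sym)
  show ?thesis
  proof (cases x)
    case X: (LA i)
    show ?thesis
    proof (cases y)
      case (LA j) then show ?thesis using assms(3) X by (simp split: if_splits)
    next
      case (LB j) show ?thesis by (rule main[OF assms]) (use X LB in blast)
    next
      case (LC j k) show ?thesis by (rule main[OF assms]) (use X LC in blast)
    qed
  next
    case X: (LB i)
    show ?thesis
    proof (cases y)
      case (LA j) show ?thesis by (rule swapped, rule main[OF assms(2,1) sw]) (use X LA in blast)
    next
      case (LB j) then show ?thesis using assms(3) X by (simp split: if_splits)
    next
      case (LC j k) show ?thesis by (rule main[OF assms]) (use X LC in blast)
    qed
  next
    case X: (LC i l)
    show ?thesis
    proof (cases y)
      case (LA j) show ?thesis by (rule swapped, rule main[OF assms(2,1) sw]) (use X LA in blast)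
    next
      case (LB j) show ?thesis by (rule swapped, rule main[OF assms(2,1) sw]) (use X LB in blast)
    next
      case (LC j k) show ?thesis by (rule main[OF assms]) (use X LC in blast)
    qed
  qed
qed

section \<open>The labelling determined by a double-six, and its stabiliser\<close>

definition num_label :: "nat \<Rightarrow> schlaefli" where
  "num_label n = schlaefli_lines ! (n - 1)"

lemma length_schlaefli_lines: "length schlaefli_lines = 27"
  by (simp add: schlaefli_lines_def)

lemma distinct_schlaefli_lines: "distinct schlaefli_lines"
  by (simp add: schlaefli_lines_def)

lemma num_label_bij: "bij_betw num_label {1..27} {x. normal_label x}"
proof -
  have "bij_betw (\<lambda>n. schlaefli_lines ! n) {..<27} (set schlaefli_lines)"
    by (rule bij_betw_nth[OF distinct_schlaefli_lines]) (simp_all add: length_schlaefli_lines)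
  moreover have "bij_betw (\<lambda>n. n - 1) {1..27::nat} {..<27}"
    by (rule bij_betw_byWitness[where f' = Suc]) auto
  ultimately have "bij_betw ((\<lambda>n. schlaefli_lines ! n) \<circ> (\<lambda>n. n - 1)) {1..27} (set schlaefli_lines)"
    by (rule bij_betw_trans[rotated])
  then show ?thesis by (simp add: o_def num_label_def[abs_def] normal_label_def)
qed

lemma pairing27_label: "pairing27 m n = schlaefli_pairing (num_label m) (num_label n)"
  by (simp add: pairing27_def num_label_def)

lemma num_label_normal: "n \<in> {1..27} \<Longrightarrow> normal_label (num_label n)"
  using num_label_bij by (auto simp: bij_betw_def)

lemma num_label_surj: "normal_label x \<Longrightarrow> \<exists>n\<in>{1..27}. num_label n = x"
  using bij_betw_imp_surj_on[OF num_label_bij] by (metis imageE mem_Collect_eq)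

lemma pairing27_commute: "pairing27 m n = pairing27 n m"
  unfolding pairing27_label by (rule pairing_commute)

lemma pairing27_eq_minus_1: "m \<in> {1..27} \<Longrightarrow> n \<in> {1..27} \<Longrightarrow> pairing27 m n = -1 \<longleftrightarrow> m = n"
  using num_label_bij pairing_eq_minus_1[OF num_label_normal num_label_normal]
  by (auto simp: pairing27_label bij_betw_def inj_on_def)

lemma third27:
  assumes "m \<in> {1..27}" "n \<in> {1..27}" "pairing27 m n = 1"
  shows "\<exists>t\<in>{1..27}. \<forall>w\<in>{1..27}. pairing27 t w = 1 - pairing27 m w - pairing27 n w"
proof -
  obtain z where z: "normal_label z"
    "\<And>w. normal_label w \<Longrightarrow> schlaefli_pairing z w = 1 - schlaefli_pairing (num_label m) w - schlaefli_pairing (num_label n) w"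
    using third_line[OF num_label_normal[OF assms(1)] num_label_normal[OF assms(2)]] assms(3) unfolding pairing27_label by blast
  obtain t where "t \<in> {1..27}" "num_label t = z" using num_label_surj[OF z(1)] by blast
  then show ?thesis using z(2) num_label_normal unfolding pairing27_label by metis
qed

text \<open>Fixes an ordering of the two sixes, where \<open>double_six\<close> only asserts that
  one exists; this ordered datum determines the labels of all 27 lines.\<close>

definition sixes :: "(nat \<Rightarrow> nat) \<Rightarrow> (nat \<Rightarrow> nat) \<Rightarrow> bool" where
  "sixes E E' \<longleftrightarrow> E ` {1..6} \<union> E' ` {1..6} \<subseteq> {1..27} \<and>
     (\<forall>i\<in>{1..6}. \<forall>j\<in>{1..6}. i \<noteq> j \<longrightarrow>
        pairing27 (E i) (E j) = 0 \<and> pairing27 (E' i) (E' j) = 0 \<and> pairing27 (E i) (E' j) = 1) \<and>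
     (\<forall>i\<in>{1..6}. pairing27 (E i) (E' i) = 0)"

lemma sixesD:
  assumes "sixes E E'"
  shows "i \<in> {1..6} \<Longrightarrow> E i \<in> {1..27}" "i \<in> {1..6} \<Longrightarrow> E' i \<in> {1..27}"
    "i \<in> {1..6} \<Longrightarrow> j \<in> {1..6} \<Longrightarrow> pairing27 (E i) (E j) = (if i = j then -1 else 0)"
    "i \<in> {1..6} \<Longrightarrow> j \<in> {1..6} \<Longrightarrow> pairing27 (E' i) (E' j) = (if i = j then -1 else 0)"
    "i \<in> {1..6} \<Longrightarrow> j \<in> {1..6} \<Longrightarrow> pairing27 (E i) (E' j) = (if i = j then 0 else 1)"
    "i \<in> {1..6} \<Longrightarrow> j \<in> {1..6} \<Longrightarrow> pairing27 (E' i) (E j) = (if i = j then 0 else 1)"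
proof -
  show E: "i \<in> {1..6} \<Longrightarrow> E i \<in> {1..27}" "i \<in> {1..6} \<Longrightarrow> E' i \<in> {1..27}" for i
    using assms unfolding sixes_def by blast+
  note p = pairing27_eq_minus_1[OF E(1) E(1)] pairing27_eq_minus_1[OF E(2) E(2)]
  show "i \<in> {1..6} \<Longrightarrow> j \<in> {1..6} \<Longrightarrow> pairing27 (E i) (E j) = (if i = j then -1 else 0)"
    "i \<in> {1..6} \<Longrightarrow> j \<in> {1..6} \<Longrightarrow> pairing27 (E' i) (E' j) = (if i = j then -1 else 0)"
    "i \<in> {1..6} \<Longrightarrow> j \<in> {1..6} \<Longrightarrow> pairing27 (E i) (E' j) = (if i = j then 0 else 1)"
    "i \<in> {1..6} \<Longrightarrow> j \<in> {1..6} \<Longrightarrow> pairing27 (E' i) (E j) = (if i = j then 0 else 1)"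
    using assms p unfolding sixes_def by (auto simp: pairing27_commute[of "E' i"])
qed

lemma sixes_swap: "sixes E E' \<Longrightarrow> sixes E' E"
  unfolding sixes_def by (auto simp: pairing27_commute)

text \<open>
  The three lines in a plane add up to the hyperplane class, whose pairing with every line is 1.
\<close>

definition third :: "(nat \<Rightarrow> nat) \<Rightarrow> (nat \<Rightarrow> nat) \<Rightarrow> nat \<Rightarrow> nat \<Rightarrow> nat" where
  "third E E' i j = (SOME t. t \<in> {1..27} \<and> (\<forall>w\<in>{1..27}. pairing27 t w = 1 - pairing27 (E i) w - pairing27 (E' j) w))"

fun place :: "(nat \<Rightarrow> nat) \<Rightarrow> (nat \<Rightarrow> nat) \<Rightarrow> schlaefli \<Rightarrow> nat" where
  "place E E' (LA i) = E i"
| "place E E' (LB i) = E' i"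
| "place E E' (LC i j) = third E E' i j"

lemma third:
  assumes "sixes E E'" "i \<in> {1..6}" "j \<in> {1..6}" "i \<noteq> j"
  shows "third E E' i j \<in> {1..27}"
    "w \<in> {1..27} \<Longrightarrow> pairing27 (third E E' i j) w = 1 - pairing27 (E i) w - pairing27 (E' j) w"
proof -
  have "\<exists>t. t \<in> {1..27} \<and> (\<forall>w\<in>{1..27}. pairing27 t w = 1 - pairing27 (E i) w - pairing27 (E' j) w)"
    using third27[of "E i" "E' j"] sixesD[OF assms(1)] assms(2-4) by auto
  from someI_ex[OF this] show "third E E' i j \<in> {1..27}"
    "w \<in> {1..27} \<Longrightarrow> pairing27 (third E E' i j) w = 1 - pairing27 (E i) w - pairing27 (E' j) w"
    unfolding third_def by blast+
qed

lemma place_in: "sixes E E' \<Longrightarrow> normal_label x \<Longrightarrow> place E E' x \<in> {1..27}"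
  using third(1) sixesD(1,2) by (cases x) auto

lemma place_pairing:
  assumes s: "sixes E E'" and x: "normal_label x" "normal_label y"
  shows "pairing27 (place E E' x) (place E E' y) = schlaefli_pairing x y"
proof -
  note D = sixesD[OF s] and T = third[OF s]
  have TA: "pairing27 (third E E' i j) (E k) = (if k \<in> {i, j} then 1 else 0)"
    and TB: "pairing27 (third E E' i j) (E' k) = (if k \<in> {i, j} then 1 else 0)"
    if "i \<in> {1..6}" "j \<in> {1..6}" "i \<noteq> j" "k \<in> {1..6}" for i j k
    using T(2)[OF that(1-3)] D that by auto
  have TT: "pairing27 (third E E' i j) (third E E' k l) = schlaefli_pairing (LC i j) (LC k l)"
    if "i \<in> {1..6}" "j \<in> {1..6}" "i \<noteq> j" "k \<in> {1..6}" "l \<in> {1..6}" "k \<noteq> l" for i j k l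
    unfolding pairing_LC_LC[OF that(3,6)] T(2)[OF that(1-3) T(1)[OF that(4-6)]]
    using TA[OF that(4-6) that(1)] TB[OF that(4-6) that(2)] by (simp add: pairing27_commute)
  show ?thesis
    using x D TA TB TT by (cases x; cases y) (auto simp: pairing27_commute[of "E _" "third _ _ _ _"] pairing27_commute[of "E' _" "third _ _ _ _"] simp del: schlaefli_pairing.simps(9))
qed

text \<open>Preserving the pairing gives injectivity, since the value -1 detects equality, and both
  sides have 27 elements. So every double-six arises from a labelling in Schlaefli's
  notation.\<close>

lemma place_bij:
  assumes s: "sixes E E'"
  shows "bij_betw (place E E') {x. normal_label x} {1..27}"
proof -
  have inj: "inj_on (place E E') {x. normal_label x}"
  proof (rule inj_onI)
    fix x y assume xy: "x \<in> {x. normal_label x}" "y \<in> {x. normal_label x}" "place E E' x = place E E' y"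
    have "schlaefli_pairing x y = pairing27 (place E E' x) (place E E' x)"
      using place_pairing[OF s, of x y] xy by simp
    also have "\<dots> = -1" using pairing27_eq_minus_1 place_in[OF s] xy(1) by simp
    finally show "x = y" using pairing_eq_minus_1 xy by simp
  qed
  have card: "card {x. normal_label x} = 27" "finite {x. normal_label x}"
    using bij_betw_same_card[OF num_label_bij] bij_betw_finite[OF num_label_bij] by auto
  have "place E E' ` {x. normal_label x} = {1..27}"
    by (rule card_subset_eq) (use place_in[OF s] card inj in \<open>auto simp: card_image\<close>)
  then show ?thesis using inj by (simp add: bij_betw_def)
qed

text \<open>For i different from j the images of E i and E' j meet, while lines of the same half
  never do; hence these images lie in different halves. Starting from E 1 this decides the half for
  all twelve lines, and the pairing 0 between partners then makes the permutation the same on both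
  halves.\<close>

lemma sixes_map:
  assumes s: "sixes E E'" and s': "sixes F F'"
    and \<pi>: "\<And>m. m \<in> {1..27} \<Longrightarrow> \<pi> m \<in> {1..27}"
      "\<And>m n. m \<in> {1..27} \<Longrightarrow> n \<in> {1..27} \<Longrightarrow> pairing27 (\<pi> m) (\<pi> n) = pairing27 m n"
    and D: "\<pi> ` (E ` {1..6} \<union> E' ` {1..6}) \<subseteq> F ` {1..6} \<union> F' ` {1..6}"
    and 1: "\<pi> (E 1) \<in> F ` {1..6}"
  shows "\<exists>p. p permutes {1..6} \<and> (\<forall>i\<in>{1..6}. \<pi> (E i) = F (p i) \<and> \<pi> (E' i) = F' (p i))"
proof -
  note D1 = sixesD[OF s] and D2 = sixesD[OF s']
  have P: "pairing27 (\<pi> (E i)) (\<pi> (E' j)) = (if i = j then 0 else 1)" if "i \<in> {1..6}" "j \<in> {1..6}" for i j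
    using that D1 \<pi>(2) by simp
  have DD: "\<pi> (E i) \<in> F ` {1..6} \<union> F' ` {1..6}" "\<pi> (E' i) \<in> F ` {1..6} \<union> F' ` {1..6}" if "i \<in> {1..6}" for i
    by (rule subsetD[OF D], rule imageI, use that in blast)+
  have step: "\<pi> (E' j) \<in> F' ` {1..6}" if c: "i \<in> {1..6}" "j \<in> {1..6}" "i \<noteq> j" "\<pi> (E i) \<in> F ` {1..6}" for i j
  proof (rule ccontr)
    assume "\<not> ?thesis"
    then have "\<pi> (E' j) \<in> F ` {1..6}" using DD[OF c(2)] by blast
    then obtain a where a: "\<pi> (E' j) = F a" "a \<in> {1..6}" by (elim imageE)
    obtain b where b: "\<pi> (E i) = F b" "b \<in> {1..6}" using c(4) by (elim imageE)
    note ab = a b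
    show False using P[OF c(1,2)] c(3) D2(3)[OF ab(4,2)] unfolding ab by (simp split: if_splits)
  qed
  have step': "\<pi> (E i) \<in> F ` {1..6}" if c: "i \<in> {1..6}" "j \<in> {1..6}" "i \<noteq> j" "\<pi> (E' j) \<in> F' ` {1..6}" for i j
  proof (rule ccontr)
    assume "\<not> ?thesis"
    then have "\<pi> (E i) \<in> F' ` {1..6}" using DD[OF c(1)] by blast
    then obtain b where b: "\<pi> (E i) = F' b" "b \<in> {1..6}" by (elim imageE)
    obtain a where a: "\<pi> (E' j) = F' a" "a \<in> {1..6}" using c(4) by (elim imageE)
    note ab = a b
    show False using P[OF c(1,2)] c(3) D2(4)[OF ab(4,2)] unfolding ab by (simp split: if_splits)
  qed
  have r: "(1::nat) \<in> {1..6}" "(2::nat) \<in> {1..6}" "(3::nat) \<in> {1..6}" by auto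
  \<comment> \<open>E 1 decides about all E' j except its partner E' 1, which is reached afterwards
    through E 2.\<close>
  have 2: "\<pi> (E' 2) \<in> F' ` {1..6}" "\<pi> (E' 3) \<in> F' ` {1..6}" using step[of 1 2] step[of 1 3] r 1 by auto
  have EF: "\<pi> (E i) \<in> F ` {1..6}" if "i \<in> {1..6}" for i
    using step'[of i 2] step'[of i 3] r that 2 by (cases "i = 2") auto
  have EF': "\<pi> (E' j) \<in> F' ` {1..6}" if "j \<in> {1..6}" for j
    using step[of 1 j] step[of 2 j] r that EF by (cases "j = 1") auto
  have "\<forall>i\<in>{1..6}. \<exists>k\<in>{1..6}. \<pi> (E i) = F k" using EF by blast
  then obtain p0 where p0: "\<And>i. i \<in> {1..6} \<Longrightarrow> p0 i \<in> {1..6} \<and> \<pi> (E i) = F (p0 i)" by metis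
  define p where "p i = (if i \<in> {1..6} then p0 i else i)" for i
  have p: "p i \<in> {1..6}" "\<pi> (E i) = F (p i)" if "i \<in> {1..6}" for i using p0[OF that] that by (auto simp: p_def)
  have "inj_on p {1..6}"
  proof (rule inj_onI)
    fix i j assume ij: "i \<in> {1..6}" "j \<in> {1..6}" "p i = p j"
    have "pairing27 (E i) (E j) = pairing27 (F (p i)) (F (p j))" using \<pi>(2) D1(1) p ij by metis
    also have "\<dots> = -1" using D2(3) p(1) ij by simp
    finally show "i = j" using D1(3)[OF ij(1,2)] by (simp split: if_splits)
  qed
  then have "p ` {1..6} = {1..6}" using p(1) by (intro endo_inj_surj) auto
  then have perm: "p permutes {1..6}"
    using \<open>inj_on p {1..6}\<close> by (intro bij_imp_permutes) (auto simp: bij_betw_def p_def)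
  moreover have "\<pi> (E' i) = F' (p i)" if i: "i \<in> {1..6}" for i
  proof -
    obtain k where k: "k \<in> {1..6}" "\<pi> (E' i) = F' k" using EF'[OF i] by blast
    have "pairing27 (F (p i)) (F' k) = 0" using P[OF i i] p(2)[OF i] k(2) by simp
    then show ?thesis using D2(5)[OF p(1)[OF i] k(1)] k(2) by (simp split: if_splits)
  qed
  ultimately show ?thesis using p by blast
qed

fun relabel :: "(nat \<Rightarrow> nat) \<Rightarrow> bool \<Rightarrow> schlaefli \<Rightarrow> schlaefli" where
  "relabel p sw (LA i) = (if sw then LB (p i) else LA (p i))"
| "relabel p sw (LB i) = (if sw then LA (p i) else LB (p i))"
| "relabel p sw (LC i j) = mkC (p i) (p j)"

lemma normal_label_relabel:
  assumes p: "p permutes {1..6}" and x: "normal_label x"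
  shows "normal_label (relabel p sw x)"
proof -
  have "p i \<in> {1..6}" if "i \<in> {1..6}" for i using permutes_in_image[OF p] that by blast
  moreover have "p i \<noteq> p j" if "i \<noteq> j" for i j using permutes_inj[OF p] that by (auto simp: inj_def)
  ultimately show ?thesis using x normal_label_mkC by (cases x) (auto simp del: atLeastAtMost_iff)
qed

text \<open>An element of the stabiliser either preserves or exchanges the two sixes, with one
  permutation of the indices for both. The image of C_ij is then forced, as C_ij is the third line
  in the plane of E i and E' j.\<close>

theorem U_ds_relabel:
  assumes s: "sixes E E'" and D: "D = E ` {1..6} \<union> E' ` {1..6}" and u: "\<pi> \<in> U_ds D"
  shows "\<exists>p sw. p permutes {1..6} \<and> (\<forall>x. normal_label x \<longrightarrow> \<pi> (place E E' x) = place E E' (relabel p sw x))"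
proof -
  have pi: "\<pi> permutes {1..27}" "\<And>m n. m \<in> {1..27} \<Longrightarrow> n \<in> {1..27} \<Longrightarrow> pairing27 (\<pi> m) (\<pi> n) = pairing27 m n"
    and \<pi>D: "\<pi> ` D = D"
    using u unfolding U_ds_def G_max_def pairing_group_def by auto
  have in27: "\<pi> m \<in> {1..27}" if "m \<in> {1..27}" for m using permutes_in_image[OF pi(1)] that by blast
  have "\<exists>p sw. p permutes {1..6} \<and> (\<forall>i\<in>{1..6}. \<pi> (E i) = place E E' (relabel p sw (LA i)) \<and> \<pi> (E' i) = place E E' (relabel p sw (LB i)))"
  proof (cases "\<pi> (E 1) \<in> E ` {1..6}")
    case True
    obtain p where "p permutes {1..6}" "\<forall>i\<in>{1..6}. \<pi> (E i) = E (p i) \<and> \<pi> (E' i) = E' (p i)"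
      using sixes_map[OF s s in27 pi(2) _ True] \<pi>D D by blast
    then show ?thesis by (intro exI[of _ p] exI[of _ False]) simp
  next
    case False
    have "E 1 \<in> D" unfolding D by auto
    then have "\<pi> (E 1) \<in> D" using \<pi>D by blast
    then have T: "\<pi> (E 1) \<in> E' ` {1..6}" using False D by blast
    have sub: "\<pi> ` (E ` {1..6} \<union> E' ` {1..6}) \<subseteq> E' ` {1..6} \<union> E ` {1..6}" using \<pi>D D by blast
    obtain p where "p permutes {1..6}" "\<forall>i\<in>{1..6}. \<pi> (E i) = E' (p i) \<and> \<pi> (E' i) = E (p i)"
      using sixes_map[OF s sixes_swap[OF s] in27 pi(2) sub T] by blast
    then show ?thesis by (intro exI[of _ p] exI[of _ True]) simp
  qed
  then obtain p sw where p: "p permutes {1..6}"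
    and AB: "\<And>i. i \<in> {1..6} \<Longrightarrow> \<pi> (E i) = place E E' (relabel p sw (LA i)) \<and> \<pi> (E' i) = place E E' (relabel p sw (LB i))"
    by blast
  have C: "\<pi> (place E E' (LC i j)) = place E E' (relabel p sw (LC i j))" if ij: "normal_label (LC i j)" for i j
  proof -
    have i: "i \<in> {1..6}" "j \<in> {1..6}" "i \<noteq> j" using ij by auto
    have pij: "p i \<in> {1..6}" "p j \<in> {1..6}" "p i \<noteq> p j"
      using permutes_in_image[OF p] i permutes_inj[OF p] by (auto simp: inj_def)
    define t where "t = place E E' (relabel p sw (LC i j))"
    have nt: "normal_label (relabel p sw (LC i j))" by (rule normal_label_relabel[OF p ij])
    have t27: "t \<in> {1..27}" unfolding t_def by (rule place_in[OF s nt])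
    have "t \<in> \<pi> ` {1..27}" unfolding permutes_image[OF pi(1)] by (rule t27)
    then obtain w where w: "\<pi> w = t" "w \<in> {1..27}" by (elim imageE) simp
    have tA: "pairing27 (place E E' x) t = schlaefli_pairing x (mkC (p i) (p j))" if "normal_label x" for x
      using place_pairing[OF s that nt] unfolding t_def by simp
    have "pairing27 (\<pi> (third E E' i j)) t = pairing27 (third E E' i j) w"
      using pi(2)[OF third(1)[OF s i] w(2)] w(1) by simp
    also have "\<dots> = 1 - pairing27 (E i) w - pairing27 (E' j) w" by (rule third(2)[OF s i w(2)])
    also have "\<dots> = 1 - pairing27 (\<pi> (E i)) t - pairing27 (\<pi> (E' j)) t"
      using pi(2)[OF sixesD(1)[OF s i(1)] w(2)] pi(2)[OF sixesD(2)[OF s i(2)] w(2)] w(1) by simp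
    \<comment> \<open>The expected image t meets the images of both lines, so the value is 1 - 1 -
      1, and -1 means equality.\<close>
    also have "\<dots> = -1"
    proof -
      have "pairing27 (\<pi> (E i)) t = 1"
        using AB[OF i(1)] tA[OF normal_label_relabel[OF p, of "LA i" sw]] i pij
        by (simp add: pairing_commute[of _ "mkC (p i) (p j)"] pairing_mkC)
      moreover have "pairing27 (\<pi> (E' j)) t = 1"
        using AB[OF i(2)] tA[OF normal_label_relabel[OF p, of "LB j" sw]] i pij
        by (simp add: pairing_commute[of _ "mkC (p i) (p j)"] pairing_mkC)
      ultimately show ?thesis by simp
    qed
    finally have "pairing27 (\<pi> (third E E' i j)) t = -1" .
    then have "\<pi> (third E E' i j) = t" using pairing27_eq_minus_1[OF in27[OF third(1)[OF s i]] t27] by simp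
    then show ?thesis by (simp add: t_def)
  qed
  have "\<pi> (place E E' x) = place E E' (relabel p sw x)" if "normal_label x" for x
  proof (cases x)
    case (LA i) then show ?thesis using AB[of i] that by simp
  next
    case (LB i) then show ?thesis using AB[of i] that by simp
  next
    case (LC i j) then show ?thesis using C[of i j] that by blast
  qed
  then show ?thesis using p by blast
qed

section \<open>Multivariate polynomials\<close>

definition mon_eval :: "('v \<Rightarrow> 'b::comm_monoid_mult) \<Rightarrow> ('v \<Rightarrow>\<^sub>0 nat) \<Rightarrow> 'b" where
  "mon_eval x m = (\<Prod>v\<in>Poly_Mapping.keys m. x v ^ Poly_Mapping.lookup m v)"

lemma mon_eval_superset:
  assumes "finite A" "Poly_Mapping.keys m \<subseteq> A"
  shows "mon_eval x m = (\<Prod>v\<in>A. x v ^ Poly_Mapping.lookup m v)"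
  unfolding mon_eval_def
  by (rule prod.mono_neutral_left[OF assms]) (auto simp: in_keys_iff)

lemma mon_eval_add: "mon_eval x (m + m') = mon_eval x m * mon_eval x m'"
proof -
  let ?A = "Poly_Mapping.keys m \<union> Poly_Mapping.keys m'"
  have "mon_eval x (m + m') = (\<Prod>v\<in>?A. x v ^ Poly_Mapping.lookup (m + m') v)"
    by (rule mon_eval_superset) (auto simp: keys_add)
  also have "\<dots> = (\<Prod>v\<in>?A. x v ^ Poly_Mapping.lookup m v) * (\<Prod>v\<in>?A. x v ^ Poly_Mapping.lookup m' v)"
    by (simp add: lookup_add power_add prod.distrib)
  also have "\<dots> = mon_eval x m * mon_eval x m'"
    by (simp add: mon_eval_superset[of ?A])
  finally show ?thesis .
qed

lemma mon_eval_0 [simp]: "mon_eval x 0 = 1"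
  by (simp add: mon_eval_def)

lemma mon_eval_single: "mon_eval x (Poly_Mapping.single v n) = x v ^ n"
  by (cases "n = 0") (simp_all add: mon_eval_def)

lemma poly_mapping_sum_singles:
  "p = (\<Sum>m\<in>Poly_Mapping.keys p. Poly_Mapping.single m (Poly_Mapping.lookup p m))"
proof (rule poly_mapping_eqI)
  fix n
  have "(\<Sum>m\<in>Poly_Mapping.keys p. Poly_Mapping.lookup (Poly_Mapping.single m (Poly_Mapping.lookup p m)) n)
      = (\<Sum>m\<in>Poly_Mapping.keys p. if m = n then Poly_Mapping.lookup p m else 0)"
    by (rule sum.cong) (auto simp: lookup_single when_def)
  also have "\<dots> = Poly_Mapping.lookup p n"
    by (auto simp: in_keys_iff)
  finally show "Poly_Mapping.lookup p n
      = Poly_Mapping.lookup (\<Sum>m\<in>Poly_Mapping.keys p. Poly_Mapping.single m (Poly_Mapping.lookup p m)) n"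
    by (simp add: lookup_sum)
qed

lemma poly_mapping_induct_single [case_names single add]:
  fixes p :: "'m \<Rightarrow>\<^sub>0 'a::comm_monoid_add"
  assumes s: "\<And>m c. P (Poly_Mapping.single m c)" and a: "\<And>p q. P p \<Longrightarrow> P q \<Longrightarrow> P (p + q)"
  shows "P p"
proof -
  have "P (\<Sum>m\<in>A. Poly_Mapping.single m (f m))" if "finite A" for A and f :: "'m \<Rightarrow> 'a"
    using that
  proof (induction A rule: finite_induct)
    case empty
    show ?case using s[of undefined 0] by simp
  qed (simp add: s a)
  from this[OF finite_keys] show ?thesis by (subst poly_mapping_sum_singles)
qed

lemma mp_eval_superset:
  assumes "j 0 = 0" "finite A" "Poly_Mapping.keys p \<subseteq> A"
  shows "mp_eval j p x = (\<Sum>m\<in>A. j (Poly_Mapping.lookup p m) * mon_eval x m)"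
  unfolding mp_eval_def mon_eval_def[symmetric]
  by (rule sum.mono_neutral_left[OF assms(2,3)]) (auto simp: in_keys_iff assms(1))

lemma mp_eval_0 [simp]: "mp_eval j 0 x = 0"
  by (simp add: mp_eval_def)

lemma mp_eval_single:
  assumes "j 0 = 0"
  shows "mp_eval j (Poly_Mapping.single m c) x = j c * mon_eval x m"
  by (subst mp_eval_superset[where A = "{m}"]) (auto simp: assms)

context
  fixes j :: "'a::field \<Rightarrow> 'b::field"
  assumes j: "field_embedding j"
begin

lemma mp_eval_add: "mp_eval j (p + q) x = mp_eval j p x + mp_eval j q x"
proof -
  note h = field_embedding_simps[OF j]
  let ?A = "Poly_Mapping.keys p \<union> Poly_Mapping.keys q"
  have "mp_eval j (p + q) x = (\<Sum>m\<in>?A. j (Poly_Mapping.lookup (p + q) m) * mon_eval x m)"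
    by (rule mp_eval_superset) (auto simp: h keys_add)
  also have "\<dots> = mp_eval j p x + mp_eval j q x"
    by (simp add: mp_eval_superset[of j ?A] h lookup_add sum.distrib algebra_simps)
  finally show ?thesis .
qed

lemma mp_eval_mult: "mp_eval j (p * q) x = mp_eval j p x * mp_eval j q x"
proof (induction p rule: poly_mapping_induct_single)
  case (single m c)
  show ?case
  proof (induction q rule: poly_mapping_induct_single)
    case (single m' c')
    then show ?case
      by (simp add: mult_single mp_eval_single field_embedding_simps[OF j] mon_eval_add)
  qed (simp add: distrib_left mp_eval_add)
qed (simp add: distrib_right mp_eval_add)

lemma mp_eval_1 [simp]: "mp_eval j 1 x = 1"
  unfolding single_one[symmetric] by (subst mp_eval_single) (simp_all add: field_embedding_simps[OF j])

lemma mp_eval_uminus: "mp_eval j (- p) x = - mp_eval j p x"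
  using mp_eval_add[of p "- p" x] by (simp add: eq_neg_iff_add_eq_0 add.commute)

lemma mp_eval_diff: "mp_eval j (p - q) x = mp_eval j p x - mp_eval j q x"
  using mp_eval_add[of p "- q" x] mp_eval_uminus[of q x] by simp

lemma mp_eval_power: "mp_eval j (p ^ n) x = mp_eval j p x ^ n"
  by (induction n) (simp_all add: mp_eval_mult)

lemma mp_eval_numeral: "mp_eval j (numeral n) x = numeral n"
  unfolding single_numeral[symmetric] by (subst mp_eval_single) (simp_all add: field_embedding_simps[OF j])

lemmas mp_eval_ring = mp_eval_add mp_eval_mult mp_eval_uminus mp_eval_diff mp_eval_power mp_eval_numeral mp_eval_1 mp_eval_0

end

definition mp_var :: "'v \<Rightarrow> ('v, 'a::field) mpoly" where
  "mp_var v = Poly_Mapping.single (Poly_Mapping.single v 1) 1"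

definition mp_const :: "'a::field \<Rightarrow> ('v, 'a) mpoly" where
  "mp_const c = Poly_Mapping.single 0 c"

lemma mp_eval_var: "field_embedding j \<Longrightarrow> mp_eval j (mp_var v) x = x v"
  unfolding mp_var_def by (subst mp_eval_single) (simp_all add: field_embedding_simps mon_eval_single)

lemma mp_eval_const: "field_embedding j \<Longrightarrow> mp_eval j (mp_const c) x = j c"
  unfolding mp_const_def by (subst mp_eval_single) (simp_all add: field_embedding_simps)

subsection \<open>Partial derivatives\<close>

lemma mp_partial_superset:
  assumes "finite A" "Poly_Mapping.keys p \<subseteq> A"
  shows "mp_partial v p = (\<Sum>m\<in>A. Poly_Mapping.single (m - Poly_Mapping.single v 1)
    (of_nat (Poly_Mapping.lookup m v) * Poly_Mapping.lookup p m))"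
  unfolding mp_partial_def by (rule sum.mono_neutral_left[OF assms]) (auto simp: in_keys_iff)

lemma mp_partial_single:
  "mp_partial v (Poly_Mapping.single m c) = Poly_Mapping.single (m - Poly_Mapping.single v 1) (of_nat (Poly_Mapping.lookup m v) * c)"
  by (subst mp_partial_superset[where A = "{m}"]) auto

lemma mp_partial_add: "mp_partial v (p + q) = mp_partial v p + mp_partial v q"
proof -
  let ?A = "Poly_Mapping.keys p \<union> Poly_Mapping.keys q"
  have "mp_partial v (p + q) = (\<Sum>m\<in>?A. Poly_Mapping.single (m - Poly_Mapping.single v 1)
    (of_nat (Poly_Mapping.lookup m v) * Poly_Mapping.lookup (p + q) m))"
    by (rule mp_partial_superset) (auto simp: keys_add)
  also have "\<dots> = mp_partial v p + mp_partial v q"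
    by (simp add: mp_partial_superset[of ?A] lookup_add distrib_left single_add sum.distrib)
  finally show ?thesis .
qed

text \<open>If v does not occur in m, the truncated subtraction may produce different exponents on
  the two sides, but both coefficients are 0.\<close>

lemma single_Leibniz:
  fixes c c' :: "'a::field"
  shows "Poly_Mapping.single (m + m' - Poly_Mapping.single v (1::nat)) (of_nat (Poly_Mapping.lookup m v) * (c * c')) =
    Poly_Mapping.single (m - Poly_Mapping.single v 1) (of_nat (Poly_Mapping.lookup m v) * c) * Poly_Mapping.single m' c'"
proof (cases "Poly_Mapping.lookup m v = 0")
  case False
  have "m + m' - Poly_Mapping.single v 1 = (m - Poly_Mapping.single v 1) + m'"
    by (rule poly_mapping_eqI) (use False in \<open>auto simp: lookup_add lookup_minus lookup_single when_def\<close>)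
  then show ?thesis by (simp add: mult_single mult.assoc)
qed simp

lemma mp_partial_mult: "mp_partial v (p * q) = mp_partial v p * q + p * mp_partial v q"
proof (induction p rule: poly_mapping_induct_single)
  case (single m c)
  show ?case
  proof (induction q rule: poly_mapping_induct_single)
    case (single m' c')
    have 1: "Poly_Mapping.single (m + m' - Poly_Mapping.single v 1) (of_nat (Poly_Mapping.lookup m' v) * (c * c')) =
      Poly_Mapping.single m c * Poly_Mapping.single (m' - Poly_Mapping.single v 1) (of_nat (Poly_Mapping.lookup m' v) * c')"
      using single_Leibniz[of m' m v c' c]
      by (simp only: add.commute[of m' m] mult.commute[of c' c] mult.commute[of _ "Poly_Mapping.single m c"])
    show ?case
      unfolding mult_single mp_partial_single lookup_add of_nat_add distrib_right single_add single_Leibniz[of m m' v c c'] 1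
      unfolding mult_single ..
  qed (simp add: distrib_left mp_partial_add algebra_simps)
qed (simp add: distrib_right mp_partial_add algebra_simps)

lemma mp_partial_const [simp]: "mp_partial v (mp_const c) = 0"
  by (simp add: mp_const_def mp_partial_single)

lemma mp_partial_var: "mp_partial v (mp_var u) = (if u = v then 1 else 0)"
  by (auto simp: mp_var_def mp_partial_single lookup_single when_def)

lemma mp_partial_uminus: "mp_partial v (- p) = - mp_partial v p"
  using mp_partial_add[of v p "- p"] mp_partial_const[of v 0]
  by (metis eq_neg_iff_add_eq_0 add.commute add.right_inverse mp_const_def single_zero)

lemma mp_partial_diff: "mp_partial v (p - q) = mp_partial v p - mp_partial v q"
  using mp_partial_add[of v p "- q"] mp_partial_uminus[of v q] by simp

lemmas mp_partial_ring = mp_partial_add mp_partial_mult mp_partial_uminus mp_partial_diff mp_partial_var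

subsection \<open>Forms\<close>

lemma keys_degree_add:
  "(\<Sum>v\<in>Poly_Mapping.keys (m + m'). Poly_Mapping.lookup (m + m') v) =
   (\<Sum>v\<in>Poly_Mapping.keys m. Poly_Mapping.lookup m v) + (\<Sum>v\<in>Poly_Mapping.keys m'. Poly_Mapping.lookup m' v)"
  for m m' :: "'v \<Rightarrow>\<^sub>0 nat"
proof -
  let ?A = "Poly_Mapping.keys m \<union> Poly_Mapping.keys m'"
  have *: "(\<Sum>v\<in>Poly_Mapping.keys n. Poly_Mapping.lookup n v) = (\<Sum>v\<in>?A. Poly_Mapping.lookup n v)"
    if "Poly_Mapping.keys n \<subseteq> ?A" for n
    by (rule sum.mono_neutral_left) (use that in \<open>auto simp: in_keys_iff\<close>)
  have "(\<Sum>v\<in>Poly_Mapping.keys (m + m'). Poly_Mapping.lookup (m + m') v) = (\<Sum>v\<in>?A. Poly_Mapping.lookup (m + m') v)"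
    by (rule *) (rule keys_add)
  also have "\<dots> = (\<Sum>v\<in>?A. Poly_Mapping.lookup m v) + (\<Sum>v\<in>?A. Poly_Mapping.lookup m' v)"
    by (simp only: lookup_add sum.distrib)
  also have "\<dots> = (\<Sum>v\<in>Poly_Mapping.keys m. Poly_Mapping.lookup m v) + (\<Sum>v\<in>Poly_Mapping.keys m'. Poly_Mapping.lookup m' v)"
    using *[of m] *[of m'] by simp
  finally show ?thesis .
qed

lemma forms_0 [simp]: "0 \<in> forms V d"
  by (simp add: forms_def)

lemma forms_add: "p \<in> forms V d \<Longrightarrow> q \<in> forms V d \<Longrightarrow> p + q \<in> forms V d"
  unfolding forms_def using keys_add[of p q] by blast

lemma forms_uminus: "p \<in> forms V d \<Longrightarrow> - p \<in> forms V d"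
  unfolding forms_def by (simp add: in_keys_iff)

lemma forms_diff: "p \<in> forms V d \<Longrightarrow> q \<in> forms V d \<Longrightarrow> p - q \<in> forms V d"
  using forms_add[of p V d "- q"] forms_uminus[of q V d] by simp

lemma forms_mult:
  assumes "p \<in> forms V d" "q \<in> forms V d'"
  shows "p * q \<in> forms V (d + d')"
  unfolding forms_def
proof (intro CollectI ballI)
  fix m assume "m \<in> Poly_Mapping.keys (p * q)"
  then obtain a b where ab: "m = a + b" "a \<in> Poly_Mapping.keys p" "b \<in> Poly_Mapping.keys q"
    using keys_mult[of p q] by blast
  then show "Poly_Mapping.keys m \<subseteq> V \<and> (\<Sum>v\<in>Poly_Mapping.keys m. Poly_Mapping.lookup m v) = d + d'"
    using assms keys_add[of a b] unfolding forms_def ab(1) keys_degree_add by fastforce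
qed

lemma forms_const: "mp_const c \<in> forms V 0"
  unfolding forms_def mp_const_def by (cases "c = 0") auto

lemma forms_1: "1 \<in> forms V 0"
  using forms_const[of 1 V] by (simp add: mp_const_def)

lemma forms_numeral: "numeral n \<in> forms V 0"
  using forms_const[of "numeral n" V] by (simp add: mp_const_def)

lemma forms_var: "v \<in> V \<Longrightarrow> mp_var v \<in> forms V 1"
  unfolding forms_def mp_var_def by auto

lemma forms_power: "p \<in> forms V d \<Longrightarrow> p ^ n \<in> forms V (n * d)"
  by (induction n) (auto simp: forms_1 intro: forms_mult)

lemma mon_eval_scale:
  "mon_eval (\<lambda>v. c * x v) m = c ^ (\<Sum>v\<in>Poly_Mapping.keys m. Poly_Mapping.lookup m v) * mon_eval x m"
  for c :: "'b::comm_semiring_1"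
  by (simp add: mon_eval_def power_mult_distrib prod.distrib power_sum)

lemma mp_eval_scale:
  assumes "p \<in> forms V d"
  shows "mp_eval j p (\<lambda>v. c * x v) = c ^ d * mp_eval j p x"
  unfolding mp_eval_def mon_eval_def[symmetric] sum_distrib_left
proof (rule sum.cong[OF refl])
  fix m assume "m \<in> Poly_Mapping.keys p"
  then have "(\<Sum>v\<in>Poly_Mapping.keys m. Poly_Mapping.lookup m v) = d" using assms by (auto simp: forms_def)
  then show "j (Poly_Mapping.lookup p m) * mon_eval (\<lambda>v. c * x v) m = c ^ d * (j (Poly_Mapping.lookup p m) * mon_eval x m)"
    by (simp add: mon_eval_scale)
qed

section \<open>Unirationality\<close>

definition point4 :: "'b \<Rightarrow> 'b \<Rightarrow> 'b \<Rightarrow> 'b \<Rightarrow> 'b^4" where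
  "point4 T Y z w = (\<chi> a. if a = 1 then T else if a = 2 then Y else if a = 3 then z else w)"

lemma point4_nth [simp]: "point4 T Y z w $ 1 = T" "point4 T Y z w $ 2 = Y" "point4 T Y z w $ 3 = z" "point4 T Y z w $ 4 = w"
  by (simp_all add: point4_def)

lemma point4_eq_iff: "point4 T Y z w = point4 T' Y' z' w' \<longleftrightarrow> T = T' \<and> Y = Y' \<and> z = z' \<and> w = w'"
  by (metis point4_nth)

lemma vec4_eq_iff: "x = y \<longleftrightarrow> x $ 1 = y $ 1 \<and> x $ 2 = y $ 2 \<and> x $ 3 = y $ 3 \<and> x $ 4 = y $ (4::4)"
  by (simp add: vec_eq_iff forall_4)

lemma point4_components: "point4 (y $ 1) (y $ 2) (y $ 3) (y $ 4) = y"
  by (simp add: vec4_eq_iff)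

lemma point4_eq_0_iff: "point4 T Y z w = 0 \<longleftrightarrow> T = 0 \<and> Y = 0 \<and> z = 0 \<and> w = 0"
  by (simp add: vec4_eq_iff)

text \<open>The form is an instance of \<open>cubic\<close> in the ring of polynomials itself, so
  evaluating it is a matter of ring homomorphisms.\<close>

definition cubic_mp :: "(nat \<Rightarrow> 'k::field) \<Rightarrow> 'k quaternary" where
  "cubic_mp k = cubic (\<lambda>n. mp_const (k n)) (mp_var 1) (mp_var 2) (mp_var 3) (mp_var 4)"

lemma mp_eval_cubic:
  assumes "field_embedding j"
  shows "mp_eval j (cubic K T Y z w) x =
    cubic (\<lambda>n. mp_eval j (K n) x) (mp_eval j T x) (mp_eval j Y x) (mp_eval j z x) (mp_eval j w x)"
  unfolding cubic_def by (simp add: mp_eval_ring[OF assms])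

lemma mp_eval_cubic_mp:
  assumes "field_embedding j"
  shows "mp_eval j (cubic_mp k) (($) x) = cubic (\<lambda>n. j (k n)) (x $ 1) (x $ 2) (x $ 3) (x $ 4)"
  unfolding cubic_mp_def by (simp add: mp_eval_cubic[OF assms] mp_eval_const[OF assms] mp_eval_var[OF assms])

lemma forms_eq: "p \<in> forms V d \<Longrightarrow> d = e \<Longrightarrow> p \<in> forms V e"
  by simp

lemma cubic_in_forms:
  assumes "\<And>n. K n \<in> forms V 0" "T \<in> forms V d" "Y \<in> forms V d" "z \<in> forms V d" "w \<in> forms V d"
  shows "cubic K T Y z w \<in> forms V (3 * d)"
  unfolding cubic_def
  by (intro forms_add forms_diff; rule forms_eq, (rule assms forms_mult forms_power)+, simp)

lemma cubic_mp_form: "cubic_mp k \<in> forms UNIV 3"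
  unfolding cubic_mp_def
  using cubic_in_forms[of "\<lambda>n. mp_const (k n)" UNIV "mp_var 1" 1 "mp_var 2" "mp_var 3" "mp_var 4"]
  by (simp add: forms_const forms_var[unfolded One_nat_def])

lemma mp_eval_partial_cubic_mp:
  assumes j: "field_embedding j"
  shows "mp_eval j (mp_partial 1 (cubic_mp k)) (($) x) = cubic_dT (\<lambda>n. j (k n)) (x $ 1) (x $ 2) (x $ 3) (x $ 4)"
    "mp_eval j (mp_partial 2 (cubic_mp k)) (($) x) = cubic_dY (\<lambda>n. j (k n)) (x $ 1) (x $ 2) (x $ 3) (x $ 4)"
    "mp_eval j (mp_partial 3 (cubic_mp k)) (($) x) = cubic_dz (\<lambda>n. j (k n)) (x $ 1) (x $ 2) (x $ 3) (x $ 4)"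
    "mp_eval j (mp_partial 4 (cubic_mp k)) (($) x) = cubic_dw (\<lambda>n. j (k n)) (x $ 1) (x $ 2) (x $ 3) (x $ 4)"
proof -
  have *: "cubic_mp k = cubic (\<lambda>n. mp_const (k n)) (mp_var 1) (mp_var 2) (mp_var 3) (mp_var 4)"
    by (simp add: cubic_mp_def)
  note ev = mp_eval_ring[OF j] mp_eval_const[OF j] mp_eval_var[OF j]
  show "mp_eval j (mp_partial 1 (cubic_mp k)) (($) x) = cubic_dT (\<lambda>n. j (k n)) (x $ 1) (x $ 2) (x $ 3) (x $ 4)"
    unfolding * cubic_def cubic_dT_def power2_eq_square power3_eq_cube by (simp add: mp_partial_ring ev algebra_simps)
  show "mp_eval j (mp_partial 2 (cubic_mp k)) (($) x) = cubic_dY (\<lambda>n. j (k n)) (x $ 1) (x $ 2) (x $ 3) (x $ 4)"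
    unfolding * cubic_def cubic_dY_def power2_eq_square power3_eq_cube by (simp add: mp_partial_ring ev algebra_simps)
  show "mp_eval j (mp_partial 3 (cubic_mp k)) (($) x) = cubic_dz (\<lambda>n. j (k n)) (x $ 1) (x $ 2) (x $ 3) (x $ 4)"
    unfolding * cubic_def cubic_dz_def power2_eq_square power3_eq_cube by (simp add: mp_partial_ring ev algebra_simps)
  show "mp_eval j (mp_partial 4 (cubic_mp k)) (($) x) = cubic_dw (\<lambda>n. j (k n)) (x $ 1) (x $ 2) (x $ 3) (x $ 4)"
    unfolding * cubic_def cubic_dw_def power2_eq_square power3_eq_cube by (simp add: mp_partial_ring ev algebra_simps)
qed

section \<open>The parametrisation by tangent lines\<close>

text \<open>The coefficient of x y^2 in the cubic at the point x p + y d, for p = (p1, p2, p3, 0)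
  and d = (d1, d2, 0, d4).\<close>

definition polar :: "(nat \<Rightarrow> 'a::comm_ring_1) \<Rightarrow> 'a \<Rightarrow> 'a \<Rightarrow> 'a \<Rightarrow> 'a \<Rightarrow> 'a \<Rightarrow> 'a \<Rightarrow> 'a" where
  "polar k p1 p2 p3 d1 d2 d4 = 3 * p1 * d1^2 - 2 * p2 * d2 * d4 + k 2 * d4 * (p1 * d2 + p2 * d1) + k 3 * d4 * d2 * p3
     + 2 * k 4 * p1 * d1 * d4 + k 5 * d1 * p3 * d4 + k 8 * p1 * d4^2 + k 9 * p3 * d4^2"

text \<open>The tangent vector \<open>d\<close> at the point \<open>p = (t\<^sub>0\<^sup>2 t\<^sub>1, t\<^sub>1\<^sup>3, t\<^sub>0\<^sup>3, 0)\<close> of the cuspidal section \<open>w = 0\<close>.\<close>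

definition tangent2 :: "(nat \<Rightarrow> 'a::comm_ring_1) \<Rightarrow> 'a \<Rightarrow> 'a \<Rightarrow> 'a \<Rightarrow> 'a \<Rightarrow> 'a" where
  "tangent2 k t0 t1 t2 t3 = 3 * t1^2 * t0^4 * t2
     + (k 2 * t1^4 * t0^2 - t1^6 + k 3 * t1^3 * t0^3 + k 4 * t1^2 * t0^4 + k 5 * t1 * t0^5 + k 6 * t0^6) * t3"

definition residual0 :: "(nat \<Rightarrow> 'a::comm_ring_1) \<Rightarrow> 'a \<Rightarrow> 'a \<Rightarrow> 'a \<Rightarrow> 'a \<Rightarrow> 'a" where
  "residual0 k t0 t1 t2 t3 = cubic k (t2 * t0^6) (tangent2 k t0 t1 t2 t3) 0 (t0^6 * t3)"

definition residual1 :: "(nat \<Rightarrow> 'a::comm_ring_1) \<Rightarrow> 'a \<Rightarrow> 'a \<Rightarrow> 'a \<Rightarrow> 'a \<Rightarrow> 'a" where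
  "residual1 k t0 t1 t2 t3 = polar k (t1 * t0^2) (t1^3) (t0^3) (t2 * t0^6) (tangent2 k t0 t1 t2 t3) (t0^6 * t3)"

text \<open>The third intersection of the surface with the line through p and d, which is tangent at
  p: the cubic at x p + y d is x y^2 \<open>residual1\<close> + y^3 \<open>residual0\<close>, so the
  remaining zero has x = - \<open>residual0\<close> and y = \<open>residual1\<close>. Here t1 / t0
  is the parameter of p on the cuspidal cubic, and t2, t3 give the direction in the tangent
  plane.\<close>

definition unimap :: "(nat \<Rightarrow> 'a::comm_ring_1) \<Rightarrow> 'a \<Rightarrow> 'a \<Rightarrow> 'a \<Rightarrow> 'a \<Rightarrow> 4 \<Rightarrow> 'a" where
  "unimap k t0 t1 t2 t3 a =
     (if a = 1 then residual1 k t0 t1 t2 t3 * (t2 * t0^6) - residual0 k t0 t1 t2 t3 * (t1 * t0^2)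
      else if a = 2 then residual1 k t0 t1 t2 t3 * tangent2 k t0 t1 t2 t3 - residual0 k t0 t1 t2 t3 * t1^3
      else if a = 3 then - (residual0 k t0 t1 t2 t3 * t0^3)
      else residual1 k t0 t1 t2 t3 * (t0^6 * t3))"

text \<open>By \<open>p\<close> the point lies on the cuspidal cubic, which removes x^3; by
  \<open>L\<close> the vector d lies in the tangent plane, which removes x^2 y.
  \<open>tangent2\<close> is this linear condition solved for the second coordinate, with
  denominators cleared by t0^6.\<close>

lemma cubic_tangent:
  fixes k :: "nat \<Rightarrow> 'a::comm_ring_1"
  shows "cubic k (x * (t1 * t0^2) + y * (t2 * t0^6)) (x * t1^3 + y * tangent2 k t0 t1 t2 t3) (x * t0^3) (y * (t0^6 * t3))
    = x * y^2 * residual1 k t0 t1 t2 t3 + y^3 * residual0 k t0 t1 t2 t3"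
proof -
  have *: "(x * p1 + y * d1)^3 - (x * p2 + y * d2) * (x * p3)^2 - (x * p2 + y * d2)^2 * (y * d4)
      + k2 * (x * p2 + y * d2) * (x * p1 + y * d1) * (y * d4) + k3 * (x * p2 + y * d2) * (x * p3) * (y * d4)
      + k4 * (x * p1 + y * d1)^2 * (y * d4) + k5 * (x * p1 + y * d1) * (x * p3) * (y * d4) + k6 * (x * p3)^2 * (y * d4)
      + k8 * (x * p1 + y * d1) * (y * d4)^2 + k9 * (x * p3) * (y * d4)^2 + k12 * (y * d4)^3
    = x^3 * (p1^3 - p2 * p3^2)
      + x^2 * y * (3 * p1^2 * d1 - d2 * p3^2 - p2^2 * d4 + k2 * p1 * p2 * d4 + k3 * p2 * p3 * d4 + k4 * p1^2 * d4 + k5 * p1 * p3 * d4 + k6 * p3^2 * d4)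
      + x * y^2 * (3 * p1 * d1^2 - 2 * p2 * d2 * d4 + k2 * d4 * (p1 * d2 + p2 * d1) + k3 * d4 * d2 * p3
     + 2 * k4 * p1 * d1 * d4 + k5 * d1 * p3 * d4 + k8 * p1 * d4^2 + k9 * p3 * d4^2)
      + y^3 * (d1^3 - d2 * 0^2 - d2^2 * d4 + k2 * d2 * d1 * d4 + k3 * d2 * 0 * d4 + k4 * d1^2 * d4 + k5 * d1 * 0 * d4 + k6 * 0^2 * d4
       + k8 * d1 * d4^2 + k9 * 0 * d4^2 + k12 * d4^3)"
    for p1 p2 p3 d1 d2 d4 k2 k3 k4 k5 k6 k8 k9 k12 :: 'a
    by (reify ring_reify, rule ring_eqI, simp, code_simp)
  have p: "(t1 * t0^2)^3 - t1^3 * (t0^3)^2 = 0" for t0 t1 :: 'a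
    by (reify ring_reify, rule ring_eqI, simp, code_simp)
  have L: "3 * (t1 * t0^2)^2 * (t2 * t0^6) - (3 * t1^2 * t0^4 * t2
     + (k2 * t1^4 * t0^2 - t1^6 + k3 * t1^3 * t0^3 + k4 * t1^2 * t0^4 + k5 * t1 * t0^5 + k6 * t0^6) * t3) * (t0^3)^2
     - (t1^3)^2 * (t0^6 * t3) + k2 * (t1 * t0^2) * t1^3 * (t0^6 * t3) + k3 * t1^3 * t0^3 * (t0^6 * t3)
     + k4 * (t1 * t0^2)^2 * (t0^6 * t3) + k5 * (t1 * t0^2) * t0^3 * (t0^6 * t3) + k6 * (t0^3)^2 * (t0^6 * t3) = 0"
    for t0 t1 t2 t3 k2 k3 k4 k5 k6 :: 'a
    by (reify ring_reify, rule ring_eqI, simp, code_simp)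
  show ?thesis
    unfolding residual1_def residual0_def polar_def cubic_def * p L[of t1 t0 t2 "k 2" "k 3" "k 4" "k 5" "k 6" t3, folded tangent2_def]
    by simp
qed

lemma unimap_on_cubic:
  fixes k :: "nat \<Rightarrow> 'a::comm_ring_1"
  shows "cubic k (unimap k t0 t1 t2 t3 1) (unimap k t0 t1 t2 t3 2) (unimap k t0 t1 t2 t3 3) (unimap k t0 t1 t2 t3 4) = 0"
proof -
  have "cubic k (unimap k t0 t1 t2 t3 1) (unimap k t0 t1 t2 t3 2) (unimap k t0 t1 t2 t3 3) (unimap k t0 t1 t2 t3 4)
     = cubic k (- residual0 k t0 t1 t2 t3 * (t1 * t0^2) + residual1 k t0 t1 t2 t3 * (t2 * t0^6))
       (- residual0 k t0 t1 t2 t3 * t1^3 + residual1 k t0 t1 t2 t3 * tangent2 k t0 t1 t2 t3)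
       (- residual0 k t0 t1 t2 t3 * t0^3) (residual1 k t0 t1 t2 t3 * (t0^6 * t3))"
    by (simp add: unimap_def)
  also have "\<dots> = 0" unfolding cubic_tangent by (simp add: power2_eq_square power3_eq_cube)
  finally show ?thesis .
qed

definition unimap_mp :: "(nat \<Rightarrow> 'k::field) \<Rightarrow> 4 \<Rightarrow> (nat, 'k) mpoly" where
  "unimap_mp k = unimap (\<lambda>n. mp_const (k n)) (mp_var 0) (mp_var 1) (mp_var 2) (mp_var 3)"

lemma mp_eval_unimap:
  assumes j: "field_embedding j"
  shows "mp_eval j (unimap_mp k a) t = unimap (\<lambda>n. j (k n)) (t 0) (t 1) (t 2) (t 3) a"
  unfolding unimap_mp_def unimap_def residual0_def residual1_def polar_def tangent2_def
  by (simp add: mp_eval_cubic[OF j] mp_eval_ring[OF j] mp_eval_const[OF j] mp_eval_var[OF j])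

text \<open>The point p has degree 3 and the direction d degree 7, so \<open>residual0\<close> has
  degree 21 and \<open>residual1\<close> degree 3 + 7 + 7 = 17; both 17 + 7 and 21 + 3 are
  24.\<close>

lemma unimap_mp_forms: "unimap_mp k a \<in> forms {..3} 24"
proof -
  define V where "V = {..3::nat}"
  define t :: "nat \<Rightarrow> (nat, 'a) mpoly" where "t = mp_var"
  define K :: "nat \<Rightarrow> (nat, 'a) mpoly" where "K n = mp_const (k n)" for n
  have v: "t 0 \<in> forms V 1" "t 1 \<in> forms V 1" "t 2 \<in> forms V 1" "t 3 \<in> forms V 1"
    unfolding t_def V_def by (rule forms_var, simp)+
  have K: "K n \<in> forms V 0" for n unfolding K_def by (rule forms_const)
  note F = v K forms_mult forms_power forms_numeral
  have d1: "t 2 * t 0^6 \<in> forms V 7" by (rule forms_eq, (rule F)+, simp)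
  have d4: "t 0^6 * t 3 \<in> forms V 7" by (rule forms_eq, (rule F)+, simp)
  have p1: "t 1 * t 0^2 \<in> forms V 3" by (rule forms_eq, (rule F)+, simp)
  have p2: "t 1^3 \<in> forms V 3" by (rule forms_eq, (rule F)+, simp)
  have p3: "t 0^3 \<in> forms V 3" by (rule forms_eq, (rule F)+, simp)
  have psi: "K 2 * t 1^4 * t 0^2 - t 1^6 + K 3 * t 1^3 * t 0^3 + K 4 * t 1^2 * t 0^4 + K 5 * t 1 * t 0^5 + K 6 * t 0^6 \<in> forms V 6"
    by (intro forms_add forms_diff; rule forms_eq, (rule F)+, simp)
  have d2: "tangent2 K (t 0) (t 1) (t 2) (t 3) \<in> forms V 7"
    unfolding tangent2_def by (intro forms_add; rule forms_eq, (rule psi F)+, simp)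
  have r0: "residual0 K (t 0) (t 1) (t 2) (t 3) \<in> forms V 21"
    unfolding residual0_def using cubic_in_forms[OF K d1 d2 forms_0 d4] by simp
  have pp: "t 1 * t 0^2 * tangent2 K (t 0) (t 1) (t 2) (t 3) + t 1^3 * (t 2 * t 0^6) \<in> forms V 10"
    by (rule forms_add; rule forms_eq, (rule d1 d2 p1 p2 forms_mult)+, simp)
  have r1: "residual1 K (t 0) (t 1) (t 2) (t 3) \<in> forms V 17"
    unfolding residual1_def polar_def
    by (intro forms_add forms_diff; rule forms_eq, (rule d1 d2 d4 p1 p2 p3 K pp forms_mult forms_numeral forms_power)+, simp)
  have "unimap K (t 0) (t 1) (t 2) (t 3) a \<in> forms V 24"
    unfolding unimap_def
    using forms_mult[OF r1 d1] forms_mult[OF r0 p1] forms_mult[OF r1 d2] forms_mult[OF r0 p2] forms_mult[OF r0 p3] forms_mult[OF r1 d4]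
    by (simp add: forms_diff forms_uminus)
  then show ?thesis unfolding unimap_mp_def V_def t_def K_def by simp
qed

section \<open>Density of the image\<close>

lemma poly_eq_0_if_cofinite:
  fixes p :: "'b::idom poly"
  assumes "infinite (UNIV :: 'b set)" "finite B" "\<And>x. x \<notin> B \<Longrightarrow> poly p x = 0"
  shows "p = 0"
proof (rule ccontr)
  assume "p \<noteq> 0"
  then have "finite {x. poly p x = 0}" by (rule poly_roots_finite)
  moreover have "UNIV = {x. poly p x = 0} \<union> B" using assms(3) by blast
  ultimately show False using assms(1,2) by (metis finite_Un)
qed

lemma embedding_id: "field_embedding id"
  by (simp add: field_embedding_def)

text \<open>Along a polynomial curve, vanishing at all but finitely many parameters then implies
  vanishing at all of them.\<close>

lemma mp_eval_along_curve:
  fixes G :: "('v, 'b::field) mpoly" and c :: "'v \<Rightarrow> 'b poly"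
  shows "\<exists>P. \<forall>x. poly P x = mp_eval id G (\<lambda>v. poly (c v) x)"
proof (induction G rule: poly_mapping_induct_single)
  case (single m a)
  have "poly (Polynomial.smult a (\<Prod>v\<in>Poly_Mapping.keys m. c v ^ Poly_Mapping.lookup m v)) x
      = mp_eval id (Poly_Mapping.single m a) (\<lambda>v. poly (c v) x)" for x
    by (simp add: mp_eval_single mon_eval_def poly_prod)
  then show ?case by blast
next
  case (add p q)
  then obtain P Q where "\<forall>x. poly P x = mp_eval id p (\<lambda>v. poly (c v) x)" "\<forall>x. poly Q x = mp_eval id q (\<lambda>v. poly (c v) x)" by blast
  then have "\<forall>x. poly (P + Q) x = mp_eval id (p + q) (\<lambda>v. poly (c v) x)"
    by (simp add: mp_eval_add[OF embedding_id])
  then show ?case by blast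
qed

text \<open>On the double cover Y^2 = \<beta> Y + \<gamma> of the z-line every polynomial function
  has the form A + Y B: the coordinate ring is free over the polynomials in z with basis 1,
  Y.\<close>

definition linear_over :: "'b::comm_ring_1 poly \<Rightarrow> 'b poly \<Rightarrow> ('b \<Rightarrow> 'b \<Rightarrow> 'b) \<Rightarrow> bool" where
  "linear_over \<beta> \<gamma> f \<longleftrightarrow> (\<exists>A B. \<forall>z Y. Y^2 = poly \<beta> z * Y + poly \<gamma> z \<longrightarrow> f z Y = poly A z + Y * poly B z)"

lemma linear_over_poly: "linear_over \<beta> \<gamma> (\<lambda>z Y. poly p z)"
  unfolding linear_over_def by (intro exI[of _ p] exI[of _ 0]) simp

lemma linear_over_var: "linear_over \<beta> \<gamma> (\<lambda>z Y. Y)"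
  unfolding linear_over_def by (intro exI[of _ 0] exI[of _ 1]) simp

lemma linear_over_add: "linear_over \<beta> \<gamma> f \<Longrightarrow> linear_over \<beta> \<gamma> g \<Longrightarrow> linear_over \<beta> \<gamma> (\<lambda>z Y. f z Y + g z Y)"
  unfolding linear_over_def
proof (elim exE)
  fix A B A' B'
  assume 1: "\<forall>z Y. Y^2 = poly \<beta> z * Y + poly \<gamma> z \<longrightarrow> f z Y = poly A z + Y * poly B z"
    and 2: "\<forall>z Y. Y^2 = poly \<beta> z * Y + poly \<gamma> z \<longrightarrow> g z Y = poly A' z + Y * poly B' z"
  show "\<exists>A B. \<forall>z Y. Y^2 = poly \<beta> z * Y + poly \<gamma> z \<longrightarrow> f z Y + g z Y = poly A z + Y * poly B z"
    by (rule exI[of _ "A + A'"], rule exI[of _ "B + B'"]) (use 1 2 in \<open>simp add: algebra_simps\<close>)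
qed

lemma linear_over_mult: "linear_over \<beta> \<gamma> f \<Longrightarrow> linear_over \<beta> \<gamma> g \<Longrightarrow> linear_over \<beta> \<gamma> (\<lambda>z Y. f z Y * g z Y)"
  unfolding linear_over_def
proof (elim exE)
  fix A B A' B'
  assume 1: "\<forall>z Y. Y^2 = poly \<beta> z * Y + poly \<gamma> z \<longrightarrow> f z Y = poly A z + Y * poly B z"
    and 2: "\<forall>z Y. Y^2 = poly \<beta> z * Y + poly \<gamma> z \<longrightarrow> g z Y = poly A' z + Y * poly B' z"
  show "\<exists>A B. \<forall>z Y. Y^2 = poly \<beta> z * Y + poly \<gamma> z \<longrightarrow> f z Y * g z Y = poly A z + Y * poly B z"
  proof (rule exI[of _ "A * A' + \<gamma> * B * B'"], rule exI[of _ "A * B' + B * A' + \<beta> * B * B'"], intro allI impI)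
    fix z Y assume Y: "Y^2 = poly \<beta> z * Y + poly \<gamma> z"
    have "f z Y * g z Y = (poly A z + Y * poly B z) * (poly A' z + Y * poly B' z)" using 1 2 Y by simp
    also have "\<dots> = poly A z * poly A' z + Y * (poly A z * poly B' z + poly B z * poly A' z) + Y^2 * (poly B z * poly B' z)"
      by (simp add: algebra_simps power2_eq_square)
    also have "\<dots> = poly (A * A' + \<gamma> * B * B') z + Y * poly (A * B' + B * A' + \<beta> * B * B') z"
      unfolding Y by (simp add: algebra_simps)
    finally show "f z Y * g z Y = poly (A * A' + \<gamma> * B * B') z + Y * poly (A * B' + B * A' + \<beta> * B * B') z" .
  qed
qed

lemma linear_over_power: "linear_over \<beta> \<gamma> f \<Longrightarrow> linear_over \<beta> \<gamma> (\<lambda>z Y. f z Y ^ n)"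
proof (induction n)
  case 0 show ?case using linear_over_poly[of \<beta> \<gamma> 1] by simp
next
  case (Suc n) then show ?case by (simp add: linear_over_mult)
qed

lemma linear_over_prod: "(\<And>v. v \<in> I \<Longrightarrow> linear_over \<beta> \<gamma> (f v)) \<Longrightarrow> linear_over \<beta> \<gamma> (\<lambda>z Y. \<Prod>v\<in>I. f v z Y)"
proof (induction I rule: infinite_finite_induct)
  case (infinite A) then show ?case using linear_over_poly[of \<beta> \<gamma> 1] by simp
next
  case empty show ?case using linear_over_poly[of \<beta> \<gamma> 1] by simp
next
  case (insert x F) then show ?case by (simp add: linear_over_mult)
qed

lemma linear_over_mp_eval:
  fixes G :: "('v, 'b::field) mpoly"
  assumes "\<And>v. linear_over \<beta> \<gamma> (c v)"
  shows "linear_over \<beta> \<gamma> (\<lambda>z Y. mp_eval id G (\<lambda>v. c v z Y))"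
proof (induction G rule: poly_mapping_induct_single)
  case (single m a)
  show ?case
    using linear_over_mult[OF linear_over_poly[of \<beta> \<gamma> "[:a:]"]
        linear_over_prod[of "Poly_Mapping.keys m" \<beta> \<gamma> "\<lambda>v z Y. c v z Y ^ Poly_Mapping.lookup m v", OF linear_over_power[OF assms]]]
    by (simp add: mp_eval_single mon_eval_def)
next
  case (add p q)
  show ?case unfolding mp_eval_add[OF embedding_id] by (rule linear_over_add[OF add])
qed

text \<open>D is the discriminant of the cover. If it is not 0, almost every z has two distinct
  points above it, which forces A and B to vanish there, hence identically. If D = 0, the only point
  above z has Y = \<beta>(z) / 2, and A + Y B becomes half of a polynomial in z. Reducible covers
  are treated alike.\<close>

lemma double_cover_closure:
  fixes A B \<beta> \<gamma> :: "'b::alg_closed_field poly"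
  assumes inf: "infinite (UNIV :: 'b set)" and two: "(2::'b) \<noteq> 0" and fin: "finite Z"
    and v: "\<And>z Y. z \<notin> Z \<Longrightarrow> Y^2 = poly \<beta> z * Y + poly \<gamma> z \<Longrightarrow> poly A z + Y * poly B z = 0"
    and Y: "Y^2 = poly \<beta> z * Y + poly \<gamma> z"
  shows "poly A z + Y * poly B z = 0"
proof -
  define D where "D = \<beta>^2 + Polynomial.smult 4 \<gamma>"
  have root: "((poly \<beta> z + e) / 2)^2 = poly \<beta> z * ((poly \<beta> z + e) / 2) + poly \<gamma> z" if "e^2 = poly D z" for z e
  proof -
    have 4: "(4::'b) \<noteq> 0" 
    proof -
      have "(4::'b) = 2 * 2" by simp
      then show ?thesis using two by (metis mult_eq_0_iff)
    qed
    have "4 * (((poly \<beta> z + e) / 2)^2 - poly \<beta> z * ((poly \<beta> z + e) / 2) - poly \<gamma> z) =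
      (2 * ((poly \<beta> z + e) / 2))^2 - 2 * poly \<beta> z * (2 * ((poly \<beta> z + e) / 2)) - 4 * poly \<gamma> z"
      by (simp only: power2_eq_square algebra_simps) simp
    also have "2 * ((poly \<beta> z + e) / 2) = poly \<beta> z + e" using two by simp
    also have "(poly \<beta> z + e)^2 - 2 * poly \<beta> z * (poly \<beta> z + e) - 4 * poly \<gamma> z = e^2 - poly D z"
      by (simp add: D_def power2_eq_square algebra_simps)
    finally have "4 * (((poly \<beta> z + e) / 2)^2 - poly \<beta> z * ((poly \<beta> z + e) / 2) - poly \<gamma> z) = 0"
      using that by simp
    then have "((poly \<beta> z + e) / 2)^2 - poly \<beta> z * ((poly \<beta> z + e) / 2) - poly \<gamma> z = 0"
      using 4 unfolding mult_eq_0_iff by blast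
    then show ?thesis unfolding diff_diff_eq right_minus_eq .
  qed
  show ?thesis
  proof (cases "D = 0")
    case True
    have Yb: "Y = poly \<beta> z / 2" if "Y^2 = poly \<beta> z * Y + poly \<gamma> z" for z Y
    proof -
      have "(2 * Y - poly \<beta> z)^2 = 4 * (Y^2 - poly \<beta> z * Y - poly \<gamma> z) + poly D z"
        by (simp add: D_def power2_eq_square algebra_simps)
      then have "(2 * Y - poly \<beta> z)^2 = 0" using that True by simp
      then have "2 * Y = poly \<beta> z" by simp
      then show ?thesis using two by (simp add: field_simps)
    qed
    define P where "P = Polynomial.smult 2 A + \<beta> * B"
    have "poly P z = 0" if "z \<notin> Z" for z
    proof -
      have "poly A z + poly \<beta> z / 2 * poly B z = 0"
        using v[OF that root[of 0 z]] True by simp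
      then show ?thesis using two by (simp add: P_def field_simps)
    qed
    then have "P = 0" by (rule poly_eq_0_if_cofinite[OF inf fin])
    then have "2 * poly A z + poly \<beta> z * poly B z = 0" by (metis P_def poly_0 poly_add poly_mult poly_smult)
    moreover have "2 * Y = poly \<beta> z" using Yb[OF Y] two by (simp add: mult.commute)
    ultimately have "2 * (poly A z + Y * poly B z) = 0" by (metis distrib_left mult.assoc)
    then show ?thesis using two by (metis mult_eq_0_iff)
  next
    case False
    then have fin': "finite (Z \<union> {z. poly D z = 0})" using fin poly_roots_finite by blast
    have AB: "poly A z = 0 \<and> poly B z = 0" if z: "z \<notin> Z \<union> {z. poly D z = 0}" for z
    proof -
      obtain e where e: "e^2 = poly D z" using quadratic_root[of 0 "- poly D z"] by auto
      have e0: "e \<noteq> 0" using e z by auto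
      have 1: "poly A z + (poly \<beta> z + e) / 2 * poly B z = 0" using v[OF _ root[OF e]] z by blast
      have "(- e)^2 = poly D z" using e by simp
      then have 2: "poly A z + (poly \<beta> z + - e) / 2 * poly B z = 0" using v[OF _ root] z by blast
      have h: "e / 2 + e / 2 = e" using two by (metis mult_2 nonzero_mult_div_cancel_left times_divide_eq_right)
      have "(e / 2 + e / 2) * poly B z
          = (poly A z + (poly \<beta> z + e) / 2 * poly B z) - (poly A z + (poly \<beta> z + - e) / 2 * poly B z)"
        by (simp add: add_divide_distrib diff_divide_distrib algebra_simps)
      then have "e * poly B z = (poly A z + (poly \<beta> z + e) / 2 * poly B z) - (poly A z + (poly \<beta> z + - e) / 2 * poly B z)"
        unfolding h .
      then have "poly B z = 0" unfolding 1 2 using e0 by simp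
      then show ?thesis using 1 by simp
    qed
    have "A = 0" by (rule poly_eq_0_if_cofinite[OF inf fin']) (use AB in blast)
    moreover have "B = 0" by (rule poly_eq_0_if_cofinite[OF inf fin']) (use AB in blast)
    ultimately show ?thesis by simp
  qed
qed

lemma finite_labels: "finite {x. label x}"
proof (rule finite_subset)
  show "{x. label x} \<subseteq> LA ` {1..6} \<union> LB ` {1..6} \<union> (\<lambda>(i, j). LC i j) ` ({1..6} \<times> {1..6})"
  proof
    fix x assume "x \<in> {x. label x}"
    then show "x \<in> LA ` {1..6} \<union> LB ` {1..6} \<union> (\<lambda>(i, j). LC i j) ` ({1..6} \<times> {1..6})"
      by (cases x) auto
  qed
qed simp

text \<open>A point with \<open>w\<close> nonzero outside finitely many planes lies on the image, as
  the third intersection of a tangent line; the other points with \<open>w\<close> nonzero are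
  limits of such points along a plane section. The smooth points of the cuspidal cubic are images
  too, and its cusp is a limit of them.\<close>

theorem unimap_dense:
  fixes r :: "nat \<Rightarrow> 'b::alg_closed_field" and G :: "(4, 'b) mpoly"
  assumes inf: "infinite (UNIV :: 'b set)" and g: "generic r s" and G: "G \<in> forms UNIV d"
    and vanish: "\<And>t0 t1 t2 t3. (\<chi> a. unimap (surface_coeffs r s) t0 t1 t2 t3 a) \<noteq> 0 \<Longrightarrow> mp_eval id G (unimap (surface_coeffs r s) t0 t1 t2 t3) = 0"
    and y: "cubic (surface_coeffs r s) T Y z w = 0"
  shows "(T, Y, z, w) \<noteq> (0, 0, 0, 0) \<Longrightarrow> mp_eval id G (($) (point4 T Y z w)) = 0"
proof -
  define k where "k = surface_coeffs r s"
  define gv where "gv T Y z w = mp_eval id G (($) (point4 T Y z w))" for T Y z w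
  have point4_fun: "(($) (point4 (f 1) (f 2) (f 3) (f 4))) = f" for f :: "4 \<Rightarrow> 'b"
  proof (rule ext)
    fix a show "point4 (f 1) (f 2) (f 3) (f 4) $ a = f a" using exhaust_4[of a] by auto
  qed
  have scale: "gv (c * T) (c * Y) (c * z) (c * w) = c^d * gv T Y z w" for c T Y z w
  proof -
    have "(($) (point4 (c * T) (c * Y) (c * z) (c * w))) = (\<lambda>a. c * point4 T Y z w $ a)"
    proof (rule ext)
      fix a show "point4 (c * T) (c * Y) (c * z) (c * w) $ a = c * point4 T Y z w $ a" using exhaust_4[of a] by auto
    qed
    then show ?thesis unfolding gv_def by (simp add: mp_eval_scale[OF G])
  qed
  have scale0: "gv T Y z w = 0" if "c \<noteq> 0" "gv (c * T) (c * Y) (c * z) (c * w) = 0" for c T Y z w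
    using that scale by simp
  have U: "gv (unimap k t0 t1 t2 t3 1) (unimap k t0 t1 t2 t3 2) (unimap k t0 t1 t2 t3 3) (unimap k t0 t1 t2 t3 4) = 0"
    if "(unimap k t0 t1 t2 t3 1, unimap k t0 t1 t2 t3 2, unimap k t0 t1 t2 t3 3, unimap k t0 t1 t2 t3 4) \<noteq> (0, 0, 0, 0)" for t0 t1 t2 t3
  proof -
    have "(\<chi> a. unimap k t0 t1 t2 t3 a) \<noteq> 0" using that by (auto simp: vec4_eq_iff)
    then show ?thesis unfolding gv_def point4_fun using vanish unfolding k_def by blast
  qed
  have cusp: "gv u (u^3) 1 0 = 0" for u
  proof - \<comment> \<open>the tangent to the cuspidal cubic at the parameter \<open>v\<close> meets it again at \<open>-2 v\<close>\<close>
    have two: "(2::'b) \<noteq> 0" by (rule genericD(1)[OF g])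
    define v where "v = - u / 2"
    have u: "u = - 2 * v" using two by (simp add: v_def field_simps)
    have t: "tangent2 k 1 v 1 0 = 3 * v^2" "residual0 k 1 v 1 0 = 1" "residual1 k 1 v 1 0 = 3 * v"
      by (simp_all add: residual0_def residual1_def polar_def tangent2_def cubic_def)
    have c: "unimap k 1 v 1 0 1 = -1 * u" "unimap k 1 v 1 0 2 = -1 * u^3" "unimap k 1 v 1 0 3 = -1 * 1" "unimap k 1 v 1 0 4 = -1 * 0"
      by (simp_all add: unimap_def t u power2_eq_square power3_eq_cube)
    have "gv (-1 * u) (-1 * u^3) (-1 * 1) (-1 * 0) = 0" using U[of 1 v 1 0] unfolding c by simp
    then show ?thesis by (rule scale0[rotated]) simp
  qed
  have cusp0: "gv 0 1 0 0 = 0"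
  proof -
    \<comment> \<open>The curve (x^2, 1, x^3, 0) parametrises the cuspidal cubic near its cusp,
      which is at x = 0.\<close>
    obtain P where P: "\<And>x. poly P x = mp_eval id G (\<lambda>a. poly (if a = 1 then monom 1 2 else if a = 2 then 1 else if a = 3 then monom 1 3 else 0) x)"
      using mp_eval_along_curve[of G "\<lambda>a. if a = 1 then monom 1 2 else if a = 2 then 1 else if a = 3 then monom 1 3 else 0"] by blast
    have PG: "poly P x = gv (x^2) 1 (x^3) 0" for x
      unfolding P gv_def
      by (rule arg_cong[where f = "mp_eval id G"], rule ext) (simp add: point4_def poly_monom)
    have "poly P x = 0" if "x \<notin> {0}" for x
    proof -
      have "gv (x^3 * inverse x) (x^3 * (inverse x)^3) (x^3 * 1) (x^3 * 0) = 0" unfolding scale using cusp by simp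
      moreover have "x^3 * inverse x = x^2" "x^3 * (inverse x)^3 = 1"
        using that by (simp_all add: power2_eq_square power3_eq_cube field_simps)
      ultimately show ?thesis unfolding PG by simp
    qed
    then have "P = 0" by (intro poly_eq_0_if_cofinite[OF inf, of "{0}"]) simp_all
    then show ?thesis using PG[of 0] by simp
  qed
  have affine_good: "gv T Y z 1 = 0"
    if F: "cubic k T Y z 1 = 0" and no: "\<And>x. label x \<Longrightarrow> T \<noteq> slope r s x * z + offset r s x" for T Y z
  proof - \<comment> \<open>the roots \<open>u\<close> of \<open>P\<close> are the points of the cuspidal cubic whose tangent plane passes through \<open>(T, Y, z, 1)\<close>\<close>
    define P where "P = [:k 6 - Y, k 5, k 4 + 3 * T, k 3 - 2 * z, k 2, 0, -1:]"
    have "degree P > 0" by (simp add: P_def)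
    then obtain u where u: "poly P u = 0" using alg_closed_imp_poly_has_root by blast
    define a where "a = T - u * z"
    have T: "T = u * z + a" by (simp add: a_def)
    have d2: "tangent2 k 1 u a 1 = intercept k u a" unfolding tangent2_def intercept_def by simp
    have Y: "Y = u^3 * z + intercept k u a"
      using u unfolding P_def intercept_def a_def by (simp add: algebra_simps power2_eq_square power3_eq_cube eval_nat_numeral)
    have r1: "residual1 k 1 u a 1 = line_eq1 k u a"
      unfolding residual1_def polar_def d2 line_eq1_def by (simp add: algebra_simps)
    have r0: "residual0 k 1 u a 1 = line_eq0 k u a"
      unfolding residual0_def d2 line_eq0_def cubic_def by (simp add: algebra_simps)
    \<comment> \<open>The point is z p + d with p = (u, u^3, 1, 0), so the formula for the cubic on
      a tangent line applies at x = z and y = 1.\<close>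
    have "z * residual1 k 1 u a 1 + residual0 k 1 u a 1 = 0"
      using cubic_tangent[of k z u 1 1 a 1] F unfolding d2 T Y by (simp add: mult.commute)
    then have r0': "residual0 k 1 u a 1 = - z * residual1 k 1 u a 1" by (simp add: eq_neg_iff_add_eq_0 add.commute)
    \<comment> \<open>Otherwise the whole tangent line lies on the surface; it is then one of the
      27, and the point lies in an excluded plane.\<close>
    have ne: "residual1 k 1 u a 1 \<noteq> 0"
    proof
      assume "residual1 k 1 u a 1 = 0"
      then have "on_surface k u a" using r0' r0 r1 by (simp add: on_surface_def)
      then obtain x where "label x" "u = slope r s x" "a = offset r s x" using all_lines[OF g] unfolding k_def by blast
      then show False using no T by blast
    qed
    define c where "c = residual1 k 1 u a 1"
    have m: "unimap k 1 u a 1 1 = c * T" "unimap k 1 u a 1 2 = c * Y" "unimap k 1 u a 1 3 = c * z" "unimap k 1 u a 1 4 = c * 1"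
      unfolding unimap_def r0' d2 c_def[symmetric] T Y by (simp_all add: algebra_simps)
    have "c \<noteq> 0" using ne by (simp add: c_def)
    moreover have "gv (c * T) (c * Y) (c * z) (c * 1) = 0" using U[of 1 u a 1] \<open>c \<noteq> 0\<close> unfolding m by simp
    ultimately show ?thesis by (rule scale0)
  qed
  have affine: "gv T0 Y0 z0 1 = 0" if F: "cubic k T0 Y0 z0 1 = 0" for T0 Y0 z0
  proof - \<comment> \<open>the plane \<open>T = poly \<tau> z\<close> through the point cuts out a double cover of the \<open>z\<close>-line, and only finitely many of its
    fibres meet the planes excluded in \<open>affine_good\<close>\<close>
    have "finite (slope r s ` {x. label x})" using finite_labels by simp
    \<comment> \<open>With a slope different from those of all 27 lines, the plane meets each
      excluded plane over a single z.\<close>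
    then obtain m where m: "m \<notin> slope r s ` {x. label x}" using inf ex_new_if_finite by blast
    define \<tau> where "\<tau> = [:T0 - m * z0, m:]"
    define \<beta> where "\<beta> = [:0, k 3:] - [:0, 0, 1:] + Polynomial.smult (k 2) \<tau>"
    define \<gamma> where "\<gamma> = \<tau>^3 + Polynomial.smult (k 4) (\<tau>^2) + Polynomial.smult (k 5) (\<tau> * [:0, 1:]) + [:0, 0, k 6:]
       + Polynomial.smult (k 8) \<tau> + [:0, k 9:] + [:k 12:]"
    have eq: "cubic k (poly \<tau> z) Y z 1 = poly \<beta> z * Y + poly \<gamma> z - Y^2" for z Y
      unfolding cubic_def \<beta>_def \<gamma>_def by (simp add: algebra_simps power2_eq_square)
    have "linear_over \<beta> \<gamma> (\<lambda>z Y. mp_eval id G (\<lambda>a. if a = 1 then poly \<tau> z else if a = 2 then Y else if a = 3 then poly [:0, 1:] z else poly 1 z))"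
    proof (rule linear_over_mp_eval)
      fix a :: 4
      show "linear_over \<beta> \<gamma> (\<lambda>z Y. if a = 1 then poly \<tau> z else if a = 2 then Y else if a = 3 then poly [:0, 1:] z else poly 1 z)"
        by (cases "a = 1"; cases "a = 2"; cases "a = 3")
          (simp_all add: linear_over_poly linear_over_var del: poly_pCons poly_1 poly_0)
    qed
    moreover have "mp_eval id G (\<lambda>a. if a = 1 then poly \<tau> z else if a = 2 then Y else if a = 3 then poly [:0, 1:] z else poly 1 z)
        = gv (poly \<tau> z) Y z 1" for z Y
      unfolding gv_def by (rule arg_cong[where f = "mp_eval id G"], rule ext) (simp add: point4_def)
    ultimately obtain A B where AB: "\<And>z Y. Y^2 = poly \<beta> z * Y + poly \<gamma> z \<Longrightarrow> gv (poly \<tau> z) Y z 1 = poly A z + Y * poly B z"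
      unfolding linear_over_def by auto
    define Z where "Z = (\<Union>x\<in>{x. label x}. {z. poly \<tau> z = slope r s x * z + offset r s x})"
    have "finite Z"
      unfolding Z_def
    proof (rule finite_UN_I[OF finite_labels])
      fix x assume "x \<in> {x. label x}"
      then have "m \<noteq> slope r s x" using m by blast
      then have "\<tau> - [:offset r s x, slope r s x:] \<noteq> 0" by (simp add: \<tau>_def)
      then have "finite {z. poly (\<tau> - [:offset r s x, slope r s x:]) z = 0}" by (rule poly_roots_finite)
      then show "finite {z. poly \<tau> z = slope r s x * z + offset r s x}"
        by (rule rev_finite_subset) (auto simp: algebra_simps)
    qed
    moreover have "poly A z + Y * poly B z = 0" if "z \<notin> Z" "Y^2 = poly \<beta> z * Y + poly \<gamma> z" for z Y
    proof -
      have "gv (poly \<tau> z) Y z 1 = 0"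
        by (rule affine_good) (use that eq in \<open>auto simp: Z_def\<close>)
      then show ?thesis using AB[OF that(2)] by simp
    qed
    moreover have T0: "poly \<tau> z0 = T0" by (simp add: \<tau>_def)
    have Y0: "Y0^2 = poly \<beta> z0 * Y0 + poly \<gamma> z0" using F eq[of z0 Y0] unfolding T0 by simp
    ultimately have "poly A z0 + Y0 * poly B z0 = 0"
      using double_cover_closure[OF inf genericD(1)[OF g]] by blast
    then show ?thesis using AB[OF Y0] T0 by simp
  qed
  assume ne: "(T, Y, z, w) \<noteq> (0, 0, 0, 0)"
  have F: "cubic k T Y z w = 0" using y by (simp add: k_def)
  have cubic_scale: "cubic k (c * T) (c * Y) (c * z) (c * w) = c^3 * cubic k T Y z w" for c T Y z w
    unfolding cubic_def by (simp add: algebra_simps power2_eq_square power3_eq_cube)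
  show "mp_eval id G (($) (point4 T Y z w)) = 0"
    unfolding gv_def[symmetric]
  proof (cases "w = 0")
    case False
    have "cubic k (inverse w * T) (inverse w * Y) (inverse w * z) (inverse w * w) = 0" unfolding cubic_scale F by simp
    then have "gv (inverse w * T) (inverse w * Y) (inverse w * z) (inverse w * w) = 0" using affine False by simp
    then show "gv T Y z w = 0" by (rule scale0[rotated]) (use False in simp)
  next
    case w: True
    show "gv T Y z w = 0"
    proof (cases "z = 0")
      case True
      then have "T = 0" using F w by (simp add: cubic_def)
      then have "gv T Y z w = gv (Y * 0) (Y * 1) (Y * 0) (Y * 0)" using True w by simp
      then show ?thesis unfolding scale cusp0 by simp
    next
      case False
      have Y: "T^3 = Y * z^2" using F w by (simp add: cubic_def)
      have "z * (T / z)^3 = Y" using False Y by (simp add: field_simps power2_eq_square power3_eq_cube)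
      then have "gv T Y z w = gv (z * (T / z)) (z * (T / z)^3) (z * 1) (z * 0)" using False w by simp
      then show ?thesis unfolding scale cusp by simp
    qed
  qed
qed

theorem unirational_cubic_mp:
  fixes j :: "'k::field \<Rightarrow> 'b::alg_closed_field"
  assumes j: "field_embedding j" and inf: "infinite (UNIV :: 'b set)" and g: "generic r s"
    and k: "\<And>n. j (k n) = surface_coeffs r s n"
  shows "unirational j (cubic_mp k)"
  unfolding unirational_def
proof (intro exI conjI)
  have kj: "(\<lambda>n. j (k n)) = surface_coeffs r s" using k by auto
  have ev: "mp_eval j (unimap_mp k a) t = unimap (surface_coeffs r s) (t 0) (t 1) (t 2) (t 3) a" for a t
    unfolding mp_eval_unimap[OF j] kj ..
  show "rational_map 3 (unimap_mp k)"
    unfolding rational_map_def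
  proof (intro conjI exI allI)
    show "unimap_mp k a \<in> forms {..3} 24" for a by (rule unimap_mp_forms)
    \<comment> \<open>At (1, 0, 1, 0) one has p = (0, 0, 1, 0) and d = (1, 0, 0, 0), where
      \<open>residual0\<close> is 1.\<close>
    have "mp_eval j (unimap_mp k 3) (\<lambda>i. if i = 0 \<or> i = 2 then 1 else 0) = -1"
      unfolding ev by (simp add: unimap_def residual0_def cubic_def tangent2_def)
    then show "unimap_mp k 3 \<noteq> 0" by auto
  qed
  show "image_of_map j (unimap_mp k) \<subseteq> zero_locus j (cubic_mp k)"
  proof
    fix y assume "y \<in> image_of_map j (unimap_mp k)"
    then obtain t where y: "y \<noteq> 0" "y = (\<chi> a. mp_eval j (unimap_mp k a) t)" unfolding image_of_map_def by blast
    have "mp_eval j (cubic_mp k) (($) y) = 0"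
      unfolding mp_eval_cubic_mp[OF j] kj y(2) ev vec_lambda_beta by (rule unimap_on_cubic)
    then show "y \<in> zero_locus j (cubic_mp k)" using y(1) by (simp add: zero_locus_def)
  qed
  show "zero_locus j (cubic_mp k) \<subseteq> zariski_closure (image_of_map j (unimap_mp k))"
  proof
    fix y assume "y \<in> zero_locus j (cubic_mp k)"
    then have y: "y \<noteq> 0" "cubic (surface_coeffs r s) (y $ 1) (y $ 2) (y $ 3) (y $ 4) = 0"
      unfolding zero_locus_def by (simp_all add: mp_eval_cubic_mp[OF j] kj)
    have "mp_eval id G (($) y) = 0"
      if G: "G \<in> forms UNIV d" and v: "\<forall>a\<in>image_of_map j (unimap_mp k). mp_eval id G (($) a) = 0" for d G
    proof -
      have "mp_eval id G (($) (point4 (y $ 1) (y $ 2) (y $ 3) (y $ 4))) = 0"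
      proof (rule unimap_dense[OF inf g G _ y(2)])
        fix t0 t1 t2 t3
        assume ne: "(\<chi> a. unimap (surface_coeffs r s) t0 t1 t2 t3 a) \<noteq> 0"
        define t where "t i = (if i = 0 then t0 else if i = 1 then t1 else if i = 2 then t2 else t3)" for i :: nat
        have "(\<chi> a. unimap (surface_coeffs r s) t0 t1 t2 t3 a) = (\<chi> a. mp_eval j (unimap_mp k a) t)"
          unfolding ev by (simp add: t_def)
        then have "(\<chi> a. unimap (surface_coeffs r s) t0 t1 t2 t3 a) \<in> image_of_map j (unimap_mp k)"
          using ne unfolding image_of_map_def by blast
        then have "mp_eval id G (($) (\<chi> a. unimap (surface_coeffs r s) t0 t1 t2 t3 a)) = 0" using v by blast
        moreover have "($) (\<chi> a. unimap (surface_coeffs r s) t0 t1 t2 t3 a) = unimap (surface_coeffs r s) t0 t1 t2 t3" by auto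
        ultimately show "mp_eval id G (unimap (surface_coeffs r s) t0 t1 t2 t3) = 0" by simp
      next
        show "(y $ 1, y $ 2, y $ 3, y $ 4) \<noteq> (0, 0, 0, 0)" using y(1) by (auto simp: vec4_eq_iff)
      qed
      then show ?thesis by (simp add: point4_components)
    qed
    then show "y \<in> zariski_closure (image_of_map j (unimap_mp k))"
      using y(1) unfolding zariski_closure_def by blast
  qed
qed

section \<open>Lines as subspaces and Galois conjugation\<close>

definition line_set :: "(nat \<Rightarrow> 'b::field) \<Rightarrow> 'b \<Rightarrow> 'b \<Rightarrow> ('b^4) set" where
  "line_set k u b = {v. on_line k u b (v $ 1) (v $ 2) (v $ 3) (v $ 4)}"

lemma line_set_basis:
  "point4 u (u^3) 1 0 \<in> line_set k u b" "point4 b (intercept k u b) 0 1 \<in> line_set k u b"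
  by (simp_all add: line_set_def on_line_def)

lemma line_set_combination: "v \<in> line_set k u b \<Longrightarrow> v = v $ 3 *s point4 u (u^3) 1 0 + v $ 4 *s point4 b (intercept k u b) 0 1"
  by (simp add: line_set_def on_line_def vec4_eq_iff)

lemma subspace_line_set: "vec.subspace (line_set k u b)"
  unfolding vec.subspace_def line_set_def on_line_def by (auto simp: algebra_simps)

lemma line_set_span: "line_set k u b = vec.span {point4 u (u^3) 1 0, point4 b (intercept k u b) 0 1}"
proof
  show "line_set k u b \<subseteq> vec.span {point4 u (u^3) 1 0, point4 b (intercept k u b) 0 1}"
  proof
    fix v assume "v \<in> line_set k u b"
    from line_set_combination[OF this] show "v \<in> vec.span {point4 u (u^3) 1 0, point4 b (intercept k u b) 0 1}"
      by (metis insertI1 insertI2 vec.span_add vec.span_base vec.span_scale)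
  qed
  show "vec.span {point4 u (u^3) 1 0, point4 b (intercept k u b) 0 1} \<subseteq> line_set k u b"
    by (rule vec.span_minimal[OF _ subspace_line_set]) (use line_set_basis in blast)
qed

lemma dim_line_set: "vec.dim (line_set k u b) = 2"
proof -
  let ?P = "point4 u (u^3) 1 0" and ?Q = "point4 b (intercept k u b) 0 1"
  have ne: "?P \<noteq> ?Q" by (simp add: point4_eq_iff)
  have "?P \<notin> vec.span {?Q}"
  proof
    assume "?P \<in> vec.span {?Q}"
    then obtain c where "?P = c *s ?Q" by (auto simp: vec.span_singleton)
    then show False by (simp add: vec4_eq_iff)
  qed
  moreover have "vec.independent {?Q}" by (simp add: point4_eq_0_iff)
  ultimately have "vec.independent {?P, ?Q}" by (simp add: vec.independent_insert)
  then show ?thesis unfolding line_set_span using ne by (simp add: vec.dim_eq_card_independent)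
qed

lemma line_set_inject: "line_set k u b = line_set k u' b' \<longleftrightarrow> u = u' \<and> b = b'"
proof
  assume e: "line_set k u b = line_set k u' b'"
  have "point4 u (u^3) 1 0 \<in> line_set k u' b'" "point4 b (intercept k u b) 0 1 \<in> line_set k u' b'"
    using line_set_basis[where u = u and b = b and k = k] unfolding e by blast+
  then show "u = u' \<and> b = b'" by (simp add: line_set_def on_line_def)
qed simp

text \<open>For the converse with u different from u', the common point is found by equating the
  coordinates \<open>T\<close>; the vanishing skewness then makes the coordinates \<open>Y\<close>
  agree.\<close>

lemma line_set_meet:
  "line_set k u b \<inter> line_set k u' b' \<noteq> {0} \<longleftrightarrow> skewness k u b u' b' = 0"
proof
  assume "line_set k u b \<inter> line_set k u' b' \<noteq> {0}"
  moreover have "0 \<in> line_set k u b \<inter> line_set k u' b'" by (simp add: line_set_def on_line_def)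
  ultimately obtain v where v: "v \<noteq> 0" "v \<in> line_set k u b" "v \<in> line_set k u' b'" by blast
  have "(v $ 3, v $ 4) \<noteq> (0, 0)" using v(1) line_set_combination[OF v(2)] by auto
  then show "skewness k u b u' b' = 0"
    using v(2,3) unfolding line_set_def mem_Collect_eq by (rule on_line_skew[rotated 2])
next
  assume s: "skewness k u b u' b' = 0"
  have "\<exists>v. v \<noteq> 0 \<and> v \<in> line_set k u b \<and> v \<in> line_set k u' b'"
  proof (cases "u = u'")
    case True
    then show ?thesis using line_set_basis(1)[where u = u] by (intro exI[of _ "point4 u (u^3) 1 0"]) (simp add: point4_eq_0_iff)
  next
    case False
    define z where "z = - (b - b') / (u - u')"
    have z: "(u - u') * z = - (b - b')" using False by (simp add: z_def)
    have i: "intercept k u b - intercept k u' b' = (u^2 + u * u' + u'^2) * (b - b')" using s by (simp add: skewness_def)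
    have "u * z + b - (u' * z + b') = 0" using z by (simp add: algebra_simps)
    moreover have "u^3 * z + intercept k u b - (u'^3 * z + intercept k u' b')
      = (u^2 + u * u' + u'^2) * ((u - u') * z) + (intercept k u b - intercept k u' b')"
      by (simp add: algebra_simps power2_eq_square power3_eq_cube)
    then have "u^3 * z + intercept k u b - (u'^3 * z + intercept k u' b') = 0" unfolding z i by (simp add: algebra_simps)
    ultimately show ?thesis
      by (intro exI[of _ "point4 (u * z + b) (u^3 * z + intercept k u b) z 1"]) (simp add: point4_eq_0_iff line_set_def on_line_def)
  qed
  then show "line_set k u b \<inter> line_set k u' b' \<noteq> {0}" by blast
qed

abbreviation schlaefli_line :: "(nat \<Rightarrow> 'b::field) \<Rightarrow> 'b \<Rightarrow> schlaefli \<Rightarrow> ('b^4) set" where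
  "schlaefli_line r s x \<equiv> line_set (surface_coeffs r s) (slope r s x) (offset r s x)"

lemma normal_label_imp_label: "normal_label x \<Longrightarrow> label x"
  by (cases x) auto

lemma slope_mkC: "slope r s (mkC i j) = slope r s (LC i j)" "offset r s (mkC i j) = offset r s (LC i j)"
  by (auto simp: mkC_def min_def max_def offset_C_commute)

lemma label_normal_form:
  assumes "label x"
  shows "\<exists>y. normal_label y \<and> slope r s y = slope r s x \<and> offset r s y = offset r s x"
proof (cases x)
  case (LC i j)
  then show ?thesis using assms normal_label_mkC[of i j] slope_mkC[of r s i j] by (intro exI[of _ "mkC i j"]) auto
qed (use assms in \<open>auto intro!: exI[of _ x]\<close>)

text \<open>Skewness 0 cannot tell two meeting lines from two equal ones; a third line that meets
  exactly one of them can.\<close>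

lemma distinguishing_line:
  assumes "normal_label x" "normal_label y" "schlaefli_pairing x y = 1"
  shows "\<exists>w. normal_label w \<and> (schlaefli_pairing x w = 0 \<and> schlaefli_pairing y w = 1 \<or>
    schlaefli_pairing x w = 1 \<and> schlaefli_pairing y w = 0)"
proof -
  have third: "\<exists>k\<in>{1..6}. k \<noteq> i \<and> k \<noteq> j" for i j :: nat
  proof -
    have "\<exists>k\<in>{1, 2, 3::nat}. k \<noteq> i \<and> k \<noteq> j" by auto
    then show ?thesis by fastforce
  qed
  show ?thesis
  proof (cases x)
    case X: (LA i)
    show ?thesis
    proof (cases y)
      case (LA j) then show ?thesis using X assms by (simp split: if_splits)
    next
      case (LB j)
      obtain k where "k \<in> {1..6}" "k \<noteq> i" "k \<noteq> j" using third by blast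
      then show ?thesis using X LB by (intro exI[of _ "LA k"]) auto
    next
      case (LC j k)
      then show ?thesis using X assms by (intro exI[of _ "LB i"]) (auto split: if_splits)
    qed
  next
    case X: (LB i)
    show ?thesis
    proof (cases y)
      case (LA j)
      obtain k where "k \<in> {1..6}" "k \<noteq> i" "k \<noteq> j" using third by blast
      then show ?thesis using X LA by (intro exI[of _ "LA k"]) auto
    next
      case (LB j) then show ?thesis using X assms by (simp split: if_splits)
    next
      case (LC j k)
      then show ?thesis using X assms by (intro exI[of _ "LA i"]) (auto split: if_splits)
    qed
  next
    case X: (LC i l)
    show ?thesis
    proof (cases y)
      case (LA j)
      then show ?thesis using X assms by (intro exI[of _ "LB j"]) (auto split: if_splits)
    next
      case (LB j)
      then show ?thesis using X assms by (intro exI[of _ "LA j"]) (auto split: if_splits)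
    next
      case (LC j k)
      then have "{i, l} \<inter> {j, k} = {}" using X assms(3) by (simp split: if_splits)
      then show ?thesis using X LC assms(1,2) by (intro exI[of _ "LA j"]) auto
    qed
  qed
qed

lemma pairing_values: "normal_label x \<Longrightarrow> normal_label y \<Longrightarrow> schlaefli_pairing x y \<in> {-1, 0, 1}"
  by (cases x; cases y) auto

lemma skew_self: "skewness k u b u b = 0"
  by (simp add: skewness_def)

lemma schlaefli_line_inject:
  assumes g: "generic r s" and x: "normal_label x" "normal_label y" and ne: "x \<noteq> y"
  shows "schlaefli_line r s x \<noteq> schlaefli_line r s y"
proof
  assume "schlaefli_line r s x = schlaefli_line r s y"
  then have e: "slope r s x = slope r s y" "offset r s x = offset r s y" by (simp_all add: line_set_inject)
  note P = pairing_cases[OF g normal_label_imp_label normal_label_imp_label]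
  have "schlaefli_pairing x y = 0 \<or> schlaefli_pairing x y = 1"
    using pairing_values[OF x] pairing_eq_minus_1[OF x] ne by auto
  then show False
  proof
    assume "schlaefli_pairing x y = 0"
    then show False using P[OF x] e by (simp add: skew_self)
  next
    assume "schlaefli_pairing x y = 1"
    then obtain w where w: "normal_label w" "schlaefli_pairing x w = 0 \<and> schlaefli_pairing y w = 1 \<or>
      schlaefli_pairing x w = 1 \<and> schlaefli_pairing y w = 0" using distinguishing_line[OF x] by blast
    then show False using P[OF x(1) w(1)] P[OF x(2) w(1)] e by auto
  qed
qed

lemma line_pairing_schlaefli:
  assumes g: "generic r s" and x: "normal_label x" "normal_label y"
  shows "line_pairing (schlaefli_line r s x) (schlaefli_line r s y) = schlaefli_pairing x y"
proof (cases "x = y")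
  case True
  then show ?thesis using pairing_eq_minus_1[OF x] by (simp add: line_pairing_def)
next
  case False
  have "schlaefli_pairing x y = 0 \<or> schlaefli_pairing x y = 1"
    using pairing_values[OF x] pairing_eq_minus_1[OF x] False by auto
  then show ?thesis
    using schlaefli_line_inject[OF g x False] pairing_cases[OF g normal_label_imp_label[OF x(1)] normal_label_imp_label[OF x(2)]]
    unfolding line_pairing_def line_set_meet by auto
qed

text \<open>No line on the surface passes through the cusp or lies in \<open>w = 0\<close>. So a
  line meets this plane in one point, which can be scaled to (u, u^3, 1, 0), and contains a vector
  (b, e, 0, 1); the coefficient of z^2 then gives e = \<open>intercept K u b\<close>.\<close>

lemma plane_of_line_coordinates:
  fixes K :: "nat \<Rightarrow> 'b::field" and W :: "('b^4) set"
  assumes two: "(2::'b) \<noteq> 0" and W: "vec.subspace W" "vec.dim W = 2"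
    and F: "\<And>v. v \<in> W \<Longrightarrow> cubic K (v $ 1) (v $ 2) (v $ 3) (v $ 4) = 0"
  shows "\<exists>u b. on_surface K u b \<and> W = line_set K u b"
proof -
  obtain B where B: "B \<subseteq> W" "vec.independent B" "W \<subseteq> vec.span B" "card B = vec.dim W"
    by (rule vec.basis_exists)
  then obtain p q where pq: "B = {p, q}" "p \<noteq> q" using W(2) by (metis card_2_iff)
  have pW: "p \<in> W" "q \<in> W" using B(1) pq by auto
  note sub = vec.subspace_add[OF W(1)] vec.subspace_scale[OF W(1)] vec.subspace_diff[OF W(1)]
  have "vec.independent {p, q}" "vec.independent {q, p}" using B(2) pq by (simp_all add: insert_commute)
  then have indep0: "p \<notin> vec.span {q}" "q \<notin> vec.span {p}"
    using pq(2) unfolding vec.independent_insert by auto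
  then have indep: "p \<noteq> 0" "q \<notin> vec.span {p}" using vec.span_zero by metis+
  have other: "\<exists>u\<in>W. \<forall>c. u \<noteq> c *s v" if v: "v \<noteq> 0" for v :: "'b^4"
  proof (rule ccontr)
    assume "\<not> ?thesis"
    then obtain c d where cd: "p = c *s v" "q = d *s v" using pW by blast
    have "c \<noteq> 0" using indep(1) cd by auto
    then have "q = (d / c) *s p" unfolding cd by simp
    then show False using indep(2) by (metis insertI1 vec.span_base vec.span_scale)
  qed
  have z_nonzero: "v $ 3 \<noteq> 0" if v: "v \<in> W" "v $ 4 = 0" "v \<noteq> 0" for v :: "'b^4"
  proof
    assume v3: "v $ 3 = 0"
    have v1: "v $ 1 = 0" using F[OF v(1)] v(2) v3 by (simp add: cubic_def)
    then have v2: "v $ 2 \<noteq> 0" using v v3 by (simp add: vec4_eq_iff)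
    obtain u where u: "u \<in> W" "\<And>c. u \<noteq> c *s v" using other[OF v(3)] by blast
    have Fc: "cubic K (u $ 1) (u $ 2 + c * v $ 2) (u $ 3) (u $ 4) = 0" for c
      using F[OF sub(1)[OF u(1) sub(2)[OF v(1), of c]]] v1 v3 v(2) by simp
    \<comment> \<open>Along the direction v of the cusp the cubic is quadratic in c. The second
      difference isolates its leading coefficient; once that vanishes, a first difference isolates
      the linear one.\<close>
    have "2 * (v $ 2)^2 * u $ 4 = 2 * cubic K (u $ 1) (u $ 2 + 0 * v $ 2) (u $ 3) (u $ 4)
      - cubic K (u $ 1) (u $ 2 + 1 * v $ 2) (u $ 3) (u $ 4) - cubic K (u $ 1) (u $ 2 + (-1) * v $ 2) (u $ 3) (u $ 4)"
      unfolding cubic_def by (simp add: algebra_simps power2_eq_square)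
    then have "2 * (v $ 2)^2 * u $ 4 = 0" unfolding Fc by simp
    then have u4: "u $ 4 = 0" using two v2 by simp
    have "v $ 2 * (u $ 3)^2 = cubic K (u $ 1) (u $ 2 + 0 * v $ 2) (u $ 3) (u $ 4) - cubic K (u $ 1) (u $ 2 + 1 * v $ 2) (u $ 3) (u $ 4)"
      unfolding cubic_def u4 by (simp add: algebra_simps)
    then have u3: "u $ 3 = 0" unfolding Fc using v2 by simp
    have u1: "u $ 1 = 0" using F[OF u(1)] u3 u4 by (simp add: cubic_def)
    have "u = (u $ 2 / v $ 2) *s v" using v1 v2 v3 v(2) u1 u3 u4 by (simp add: vec4_eq_iff)
    then show False using u(2) by blast
  qed
  have "\<exists>v\<in>W. v \<noteq> 0 \<and> v $ 4 = 0"
  proof (cases "p $ 4 = 0")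
    case True then show ?thesis using pW indep by blast
  next
    case False
    define v where "v = q - (q $ 4 / p $ 4) *s p"
    have "v \<noteq> 0"
    proof
      assume "v = 0"
      then have "q = (q $ 4 / p $ 4) *s p" by (simp add: v_def)
      then show False using indep(2) by (metis insertI1 vec.span_base vec.span_scale)
    qed
    moreover have "v \<in> W" unfolding v_def by (intro sub pW)
    moreover have "v $ 4 = 0" using False by (simp add: v_def)
    ultimately show ?thesis by blast
  qed
  then obtain v0 where v0: "v0 \<in> W" "v0 \<noteq> 0" "v0 $ 4 = 0" by blast
  define u where "u = v0 $ 1 / v0 $ 3"
  have v03: "v0 $ 3 \<noteq> 0" using z_nonzero v0 by blast
  define P where "P = point4 u (u^3) 1 0"
  have "P = inverse (v0 $ 3) *s v0"
  proof -
    have "(v0 $ 1)^3 = v0 $ 2 * (v0 $ 3)^2" using F[OF v0(1)] v0(3) by (simp add: cubic_def)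
    then have "u^3 = v0 $ 2 / v0 $ 3" using v03 unfolding u_def by (simp add: power_divide power2_eq_square power3_eq_cube field_simps)
    then show ?thesis using v0(3) v03 by (simp add: P_def vec4_eq_iff u_def field_simps)
  qed
  then have PW: "P \<in> W" using sub(2)[OF v0(1)] by simp
  have "P \<noteq> 0" by (simp add: P_def point4_eq_0_iff)
  then obtain q1 where q1: "q1 \<in> W" "\<And>c. q1 \<noteq> c *s P" using other by blast
  define q2 where "q2 = q1 - q1 $ 3 *s P"
  have q2: "q2 \<in> W" "q2 $ 3 = 0" "q2 \<noteq> 0"
    unfolding q2_def using sub(3)[OF q1(1) sub(2)[OF PW]] q1(2)[of "q1 $ 3"] by (auto simp: P_def)
  have q24: "q2 $ 4 \<noteq> 0" using z_nonzero[OF q2(1)] q2 by blast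
  define Q where "Q = inverse (q2 $ 4) *s q2"
  have QW: "Q \<in> W" unfolding Q_def by (rule sub(2)[OF q2(1)])
  have Q34: "Q $ 3 = 0" "Q $ 4 = 1" using q2(2) q24 by (simp_all add: Q_def)
  define b where "b = Q $ 1"
  define e where "e = Q $ 2"
  have Fz: "cubic K (u * z + b) (u^3 * z + e) z 1 = 0" for z
    using F[OF sub(1)[OF sub(2)[OF PW, of z] QW]] Q34 by (simp add: P_def b_def e_def mult.commute)
  \<comment> \<open>The second difference in z isolates twice the coefficient of z^2, as odd powers
    cancel in it.\<close>
  have "cubic K (u * 1 + b) (u^3 * 1 + e) 1 1 + cubic K (u * (-1) + b) (u^3 * (-1) + e) (-1) 1 - 2 * cubic K (u * 0 + b) (u^3 * 0 + e) 0 1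
    = 2 * (intercept K u b - e)"
    unfolding cubic_def intercept_def by (simp add: algebra_simps power2_eq_square power3_eq_cube eval_nat_numeral)
  then have e: "e = intercept K u b" unfolding Fz using two by simp
  have L: "line_eq1 K u b * z + line_eq0 K u b = 0" for z
    using Fz[of z] cubic_line[of K u z b 1] unfolding e by simp
  have on: "on_surface K u b" using L[of 0] L[of 1] by (simp add: on_surface_def)
  have "W = line_set K u b"
  proof
    show "W \<subseteq> line_set K u b"
    proof
      fix x assume x: "x \<in> W"
      define x' where "x' = x - x $ 3 *s P - x $ 4 *s Q"
      have "x' \<in> W" unfolding x'_def by (intro sub x PW QW)
      moreover have "x' $ 3 = 0" "x' $ 4 = 0" using Q34 by (simp_all add: x'_def P_def)
      ultimately have "x' = 0" using z_nonzero by blast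
      then have "x = x $ 3 *s P + x $ 4 *s Q" by (simp add: x'_def algebra_simps)
      then have "x $ 1 = x $ 3 * u + x $ 4 * b" "x $ 2 = x $ 3 * u^3 + x $ 4 * e"
        by (metis P_def b_def point4_nth(1) vector_add_component vector_smult_component,
            metis P_def e_def point4_nth(2) vector_add_component vector_smult_component)
      then show "x \<in> line_set K u b" by (simp add: line_set_def on_line_def e algebra_simps)
    qed
    have "Q = point4 b (intercept K u b) 0 1" using Q34 e by (simp add: vec4_eq_iff b_def e_def)
    then show "line_set K u b \<subseteq> W"
      unfolding line_set_span using PW QW by (intro vec.span_minimal[OF _ W(1)]) (simp add: P_def)
  qed
  then show ?thesis using on by blast
qed

lemma lines_on_cubic_mp:
  fixes j :: "'k::field \<Rightarrow> 'b::alg_closed_field"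
  assumes j: "field_embedding j" and g: "generic r s" and k: "\<And>n. j (k n) = surface_coeffs r s n"
  shows "bij_betw (schlaefli_line r s) {x. normal_label x} (lines_on j (cubic_mp k))"
proof -
  have kj: "(\<lambda>n. j (k n)) = surface_coeffs r s" using k by auto
  note ev = mp_eval_cubic_mp[OF j, of k, unfolded kj]
  have "schlaefli_line r s x \<in> lines_on j (cubic_mp k)" if x: "normal_label x" for x
  proof -
    have on: "on_surface (surface_coeffs r s) (slope r s x) (offset r s x)" using on_surface_line[OF g normal_label_imp_label[OF x]] .
    have "cubic (surface_coeffs r s) (v $ 1) (v $ 2) (v $ 3) (v $ 4) = 0" if "v \<in> schlaefli_line r s x" for v :: "'b^4"
      using that on cubic_line[of "surface_coeffs r s" "slope r s x" "v $ 3" "offset r s x" "v $ 4"]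
      by (simp add: line_set_def on_line_def on_surface_def)
    then show ?thesis
      unfolding lines_on_def zero_locus_def ev using subspace_line_set dim_line_set by auto
  qed
  moreover have "\<exists>x. normal_label x \<and> W = schlaefli_line r s x" if W: "W \<in> lines_on j (cubic_mp k)" for W
  proof -
    have W': "vec.subspace W" "vec.dim W = 2" and Z: "W - {0} \<subseteq> zero_locus j (cubic_mp k)"
      using W unfolding lines_on_def by auto
    have "cubic (surface_coeffs r s) (v $ 1) (v $ 2) (v $ 3) (v $ 4) = 0" if "v \<in> W" for v :: "'b^4"
    proof (cases "v = 0")
      case True then show ?thesis by (simp add: cubic_def)
    next
      case False
      then have "v \<in> zero_locus j (cubic_mp k)" using Z that by blast
      then show ?thesis by (simp add: zero_locus_def ev)
    qed
    then obtain u b where "on_surface (surface_coeffs r s) u b" "W = line_set (surface_coeffs r s) u b"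
      using plane_of_line_coordinates[OF genericD(1)[OF g] W'] by blast
    moreover from this obtain x where "label x" "u = slope r s x" "b = offset r s x" using all_lines[OF g] by blast
    ultimately show ?thesis using label_normal_form[of x r s] by metis
  qed
  ultimately show ?thesis
    unfolding bij_betw_def inj_on_def using schlaefli_line_inject[OF g] by (auto simp: image_iff) blast+
qed

lemma nonsingular_cubic_mp:
  fixes j :: "'k::field \<Rightarrow> 'b::alg_closed_field"
  assumes j: "field_embedding j" and g: "generic r s" and k: "\<And>n. j (k n) = surface_coeffs r s n"
  shows "nonsingular j (cubic_mp k)"
  unfolding nonsingular_def
proof (intro ballI, rule ccontr)
  have kj: "(\<lambda>n. j (k n)) = surface_coeffs r s" using k by auto
  fix x assume "x \<in> zero_locus j (cubic_mp k)" and no: "\<nexists>v. mp_eval j (mp_partial v (cubic_mp k)) (($) x) \<noteq> 0"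
  then have x: "x \<noteq> 0" "cubic (surface_coeffs r s) (x $ 1) (x $ 2) (x $ 3) (x $ 4) = 0"
    unfolding zero_locus_def by (simp_all add: mp_eval_cubic_mp[OF j] kj)
  have D: "cubic_dT (surface_coeffs r s) (x $ 1) (x $ 2) (x $ 3) (x $ 4) = 0" "cubic_dY (surface_coeffs r s) (x $ 1) (x $ 2) (x $ 3) (x $ 4) = 0"
    "cubic_dz (surface_coeffs r s) (x $ 1) (x $ 2) (x $ 3) (x $ 4) = 0" "cubic_dw (surface_coeffs r s) (x $ 1) (x $ 2) (x $ 3) (x $ 4) = 0"
    using no mp_eval_partial_cubic_mp[OF j, of k x] unfolding kj by metis+
  have "(x $ 1, x $ 2, x $ 3, x $ 4) \<noteq> (0, 0, 0, 0)" using x(1) by (auto simp: vec4_eq_iff)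
  then show False using gradient_nonzero[OF g x(2) _ D] by blast
qed

lemma cubic_surface_cubic_mp: "cubic_surface (cubic_mp k)"
proof -
  have e: "field_embedding (id :: 'a \<Rightarrow> 'a)" by (simp add: field_embedding_def)
  have "mp_eval id (cubic_mp k) (($) (point4 1 0 0 0)) = 1"
    unfolding mp_eval_cubic_mp[OF e] by (simp add: cubic_def)
  then have "cubic_mp k \<noteq> 0" by auto
  then show ?thesis by (simp add: cubic_surface_def cubic_mp_form)
qed

subsection \<open>Conjugation\<close>

lemma esym_hom: "field_embedding j \<Longrightarrow> j (esym xs n) = esym (map j xs) n"
proof (induction xs arbitrary: n)
  case Nil then show ?case by (simp add: field_embedding_simps)
next
  case (Cons x xs) then show ?case by (cases n) (simp_all add: field_embedding_simps)
qed

lemma root_esym_hom: "field_embedding j \<Longrightarrow> j (root_esym r n) = root_esym (j \<circ> r) n"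
  by (simp add: root_esym_def esym_hom)

lemma coeffs_hom: "field_embedding j \<Longrightarrow> j (coeffs e s n) = coeffs (j \<circ> e) (j s) n"
  by (simp add: coeffs_def field_embedding_simps)

lemma surface_coeffs_hom:
  assumes "field_embedding j"
  shows "j (surface_coeffs r s n) = surface_coeffs (j \<circ> r) (j s) n"
proof -
  have "j \<circ> root_esym r = root_esym (j \<circ> r)" using root_esym_hom[OF assms] by auto
  then show ?thesis by (simp add: coeffs_hom[OF assms])
qed

lemma intercept_hom: "field_embedding j \<Longrightarrow> j (intercept k u b) = intercept (\<lambda>n. j (k n)) (j u) (j b)"
  by (simp add: intercept_def field_embedding_simps)

lemma slope_hom: "field_embedding j \<Longrightarrow> j (slope r s x) = slope (j \<circ> r) (j s) x"
  by (cases x) (simp_all add: field_embedding_simps)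

lemma offset_hom: "field_embedding j \<Longrightarrow> j (offset r s x) = offset (j \<circ> r) (j s) x"
  by (cases x) (simp_all add: field_embedding_simps offset_A_def offset_C_def root_esym_hom)

lemma generic_hom:
  assumes j: "field_embedding j" and g: "generic r s"
  shows "generic (j \<circ> r) (j s)"
proof -
  note h = field_embedding_simps[OF j] and i = field_embedding_eq_iff[OF j]
  have "j 2 \<noteq> j 0" unfolding i by (rule genericD(1)[OF g])
  then have "(2::'b) \<noteq> 0" by (simp add: h)
  moreover have "j s \<noteq> 0" using genericD(2)[OF g] field_embedding_eq_0_iff[OF j] by blast
  moreover have "(\<Sum>i\<in>{1..6}. (j \<circ> r) i) = 0"
    using genericD(3)[OF g] field_embedding_sum[OF j, of r "{1..6}"] h(1) by simp
  moreover have "inj_on (j \<circ> r) {1..6}" using g i by (auto simp: generic_def inj_on_def)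
  moreover have "(j \<circ> r) a + (j \<circ> r) b + (j \<circ> r) c \<noteq> j s \<and> (j \<circ> r) a + (j \<circ> r) b + (j \<circ> r) c \<noteq> - j s"
    if "a \<in> {1..6}" "b \<in> {1..6}" "c \<in> {1..6}" "a \<noteq> b" "a \<noteq> c" "b \<noteq> c" for a b c
    unfolding o_def h(3)[symmetric] h(5)[symmetric] i using genericD(5,6)[OF g that] by blast
  ultimately show ?thesis unfolding generic_def by blast
qed

lemma vec_emb_point4: "vec_emb j (point4 T Y z w) = point4 (j T) (j Y) (j z) (j w)"
  by (simp add: vec_emb_def vec4_eq_iff)

lemma span_image_line_set:
  assumes j: "field_embedding j"
  shows "vec.span (vec_emb j ` line_set k u b) = line_set (\<lambda>n. j (k n)) (j u) (j b)"
proof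
  note h = field_embedding_simps[OF j]
  have "vec_emb j ` line_set k u b \<subseteq> line_set (\<lambda>n. j (k n)) (j u) (j b)"
  proof (rule image_subsetI)
    fix v assume "v \<in> line_set k u b"
    then show "vec_emb j v \<in> line_set (\<lambda>n. j (k n)) (j u) (j b)"
      by (simp add: line_set_def on_line_def vec_emb_def h intercept_hom[OF j])
  qed
  then show "vec.span (vec_emb j ` line_set k u b) \<subseteq> line_set (\<lambda>n. j (k n)) (j u) (j b)"
    by (rule vec.span_minimal[OF _ subspace_line_set])
  have "vec_emb j (point4 u (u^3) 1 0) \<in> vec_emb j ` line_set k u b" "vec_emb j (point4 b (intercept k u b) 0 1) \<in> vec_emb j ` line_set k u b"
    using line_set_basis by blast+
  then have "{point4 (j u) ((j u)^3) 1 0, point4 (j b) (intercept (\<lambda>n. j (k n)) (j u) (j b)) 0 1} \<subseteq> vec_emb j ` line_set k u b"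
    by (simp add: vec_emb_point4 h intercept_hom[OF j])
  then show "line_set (\<lambda>n. j (k n)) (j u) (j b) \<subseteq> vec.span (vec_emb j ` line_set k u b)"
    unfolding line_set_span[of "\<lambda>n. j (k n)"] by (rule vec.span_mono)
qed

lemma vec_emb_in_line_set:
  assumes j: "field_embedding j"
  shows "vec_emb j v \<in> line_set (\<lambda>n. j (k n)) (j u) (j b) \<longleftrightarrow> v \<in> line_set k u b"
proof -
  note h = field_embedding_simps[OF j] and i = field_embedding_eq_iff[OF j]
  have 1: "j u * j (v $ 3) + j b * j (v $ 4) = j (u * v $ 3 + b * v $ 4)" by (simp add: h)
  have 2: "(j u)^3 * j (v $ 3) + intercept (\<lambda>n. j (k n)) (j u) (j b) * j (v $ 4) = j (u^3 * v $ 3 + intercept k u b * v $ 4)"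
    by (simp add: h intercept_hom[OF j])
  show ?thesis unfolding line_set_def on_line_def mem_Collect_eq vec_emb_def vec_lambda_beta 1 2 i ..
qed

text \<open>The rational vectors of the line form the line with the same parameters over the smaller
  field, so conjugation applies \<open>\<sigma>\<close> to the parameters.\<close>

lemma conjugate_line_set:
  assumes j: "field_embedding j" and \<sigma>: "field_embedding \<sigma>"
  shows "conjugate j \<sigma> (line_set (\<lambda>n. j (k n)) (j u) (j b)) = line_set (\<lambda>n. j (\<sigma> (k n))) (j (\<sigma> u)) (j (\<sigma> b))"
  unfolding conjugate_def vec_emb_in_line_set[OF j] Collect_mem_eq
  using span_image_line_set[OF field_embedding_comp[OF j \<sigma>], of k u b] by simp

lemma root_esym_permute:
  assumes "p permutes {1..6}"
  shows "root_esym (\<lambda>i. r (p i)) = root_esym r"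
  unfolding root_esym_def
proof (rule esym_mset_cong)
  have m: "mset [1..<7] = mset_set {1..6::nat}"
    by (metis atLeastLessThanSuc_atLeastAtMost eval_nat_numeral(3) mset_upt)
  have "image_mset p (mset_set {1..6}) = mset_set {1..6}"
    using assms by (simp add: image_mset_mset_set permutes_inj_on permutes_image)
  then have "image_mset r (image_mset p (mset_set {1..6})) = image_mset r (mset_set {1..6})" by simp
  then show "mset (map (\<lambda>i. r (p i)) [1..<7]) = mset (map r [1..<7])"
    unfolding mset_map m by (simp add: image_mset.compositionality o_def)
qed

text \<open>The coefficients involve the r_i only through symmetric functions and s only through its
  square; slopes and offsets are polynomials in r and s, and the sign of s exchanges the formulas
  for A and B.\<close>

lemma Galois_action:
  fixes \<sigma> :: "'l::field \<Rightarrow> 'l"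
  assumes \<sigma>: "field_embedding \<sigma>" and p: "p permutes {1..6}"
    and r: "\<And>i. i \<in> {1..6} \<Longrightarrow> \<sigma> (r i) = r (p i)" and s: "\<sigma> s = (if sw then - s else s)"
  shows "\<sigma> (surface_coeffs r s n) = surface_coeffs r s n"
    "normal_label x \<Longrightarrow> \<sigma> (slope r s x) = slope r s (relabel p sw x)"
    "normal_label x \<Longrightarrow> \<sigma> (offset r s x) = offset r s (relabel p sw x)"
proof -
  note h = field_embedding_simps[OF \<sigma>]
  have e: "\<sigma> (root_esym r n) = root_esym r n" for n
  proof -
    have "map (\<sigma> \<circ> r) [1..<7] = map (\<lambda>i. r (p i)) [1..<7]" using r by auto
    then have "root_esym (\<sigma> \<circ> r) = root_esym (\<lambda>i. r (p i))" unfolding root_esym_def by (rule arg_cong)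
    then show ?thesis using root_esym_permute[OF p, of r] by (metis root_esym_hom[OF \<sigma>])
  qed
  then have "\<sigma> \<circ> root_esym r = root_esym r" by auto
  then show "\<sigma> (surface_coeffs r s n) = surface_coeffs r s n" unfolding coeffs_hom[OF \<sigma>] s by auto
  show "normal_label x \<Longrightarrow> \<sigma> (slope r s x) = slope r s (relabel p sw x)"
    by (cases x) (auto simp: h r s slope_mkC)
  show "normal_label x \<Longrightarrow> \<sigma> (offset r s x) = offset r s (relabel p sw x)"
    by (cases x) (auto simp: h r s slope_mkC offset_A_def offset_C_def e power2_eq_square)
qed

lemma pairing_group_cong:
  assumes "\<And>x y. x \<in> A \<Longrightarrow> y \<in> A \<Longrightarrow> P x y = Q x y"
  shows "pairing_group A P = pairing_group A Q"
  unfolding pairing_group_def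
proof (rule Collect_cong, rule conj_cong[OF refl], intro ball_cong refl)
  fix \<pi> x y assume "\<pi> permutes A" "x \<in> A" "y \<in> A"
  then show "(P (\<pi> x) (\<pi> y) = P x y) = (Q (\<pi> x) (\<pi> y) = Q x y)"
    using assms by (simp add: permutes_in_image)
qed

lemma double_six_sixes:
  assumes "double_six {1..27} pairing27 D"
  obtains E E' where "sixes E E'" "D = E ` {1..6} \<union> E' ` {1..6}"
  using assms unfolding double_six_def sixes_def by blast

lemma infinite_field_embedding:
  fixes j :: "'k::field \<Rightarrow> 'b::field"
  assumes "field_embedding j" "infinite (UNIV :: 'k set)"
  shows "infinite (UNIV :: 'b set)"
proof -
  have "inj j" using field_embedding_eq_iff[OF assms(1)] by (auto intro: injI)
  then have "infinite (range j)" using assms(2) by (metis finite_imageD)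
  then show ?thesis by (meson finite_subset subset_UNIV)
qed

lemma two_neq_0_if_CHAR: 
  assumes "CHAR('k::field) \<noteq> 2"
  shows "(2::'k) \<noteq> 0"
proof
  assume "(2::'k) = 0"
  then have "of_nat 2 = (0::'k)" by simp
  then have "CHAR('k) dvd 2" by (simp only: of_nat_eq_0_iff_char_dvd)
  then have "CHAR('k) = 1 \<or> CHAR('k) = 2" by (metis dvd_refl one_dvd prime_nat_iff two_is_prime_nat)
  then show False using assms by simp
qed

theorem theorem6p1:
  fixes \<iota> :: "'k::field \<Rightarrow> 'l::field"
    and i :: "('l \<Rightarrow> 'l) \<Rightarrow> nat \<Rightarrow> nat"
    and D :: "nat set"
  assumes "infinite (UNIV :: 'k set)"
    and "CHAR('k) \<noteq> 2"
    and "normal_extension \<iota>"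
    and "separable_extension \<iota>"
    and "double_six {1..27} pairing27 D"
    and "i \<in> mon (Gal \<iota>) ((sym_group 27)\<lparr>carrier := U_ds D\<rparr>)"
  shows "\<exists>F :: 'k quaternary.
    let j = (to_ac :: 'l \<Rightarrow> 'l alg_closure) in
      cubic_surface F \<and> nonsingular (j \<circ> \<iota>) F \<and>
      (\<exists>\<nu>. line_numbering (j \<circ> \<iota>) F \<nu> \<and>
           (\<forall>n\<in>{1..27}. defined_over j (\<nu> n)) \<and>
           (\<forall>\<sigma>\<in>carrier (Gal \<iota>). \<forall>n\<in>{1..27}. conjugate j \<sigma> (\<nu> n) = \<nu> (i \<sigma> n))) \<and>
      unirational (j \<circ> \<iota>) F"
proof -
  have emb: "field_embedding \<iota>" using assms(3) unfolding normal_extension_def algebraic_extension_def by blast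
  obtain E E' where S: "sixes E E'" and D: "D = E ` {1..6} \<union> E' ` {1..6}"
    by (rule double_six_sixes[OF assms(5)])
  let ?G = "carrier (Gal \<iota>)"
  have iU: "i \<sigma> \<in> U_ds D" if "\<sigma> \<in> ?G" for \<sigma>
    using assms(6) that unfolding mon_def hom_def by (auto simp: Pi_iff)
  have ihom: "i (\<sigma> \<circ> \<tau>) = i \<sigma> \<circ> i \<tau>" if "\<sigma> \<in> ?G" "\<tau> \<in> ?G" for \<sigma> \<tau>
    using assms(6) that unfolding mon_def hom_def by (simp add: Gal_def sym_group_def)
  have "finite {\<pi>. \<pi> permutes {1..27::nat}}" by (rule finite_permutations) simp
  moreover have "i ` ?G \<subseteq> {\<pi>. \<pi> permutes {1..27}}"
    using iU unfolding U_ds_def G_max_def pairing_group_def by blast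
  ultimately have "finite (i ` ?G)" by (rule rev_finite_subset)
  moreover have "inj_on i ?G" using assms(6) unfolding mon_def by blast
  ultimately have fin: "finite ?G" by (rule finite_imageD)
  have "\<forall>\<sigma>\<in>?G. \<exists>q. fst q permutes {1..6} \<and>
      (\<forall>x. normal_label x \<longrightarrow> i \<sigma> (place E E' x) = place E E' (relabel (fst q) (snd q) x))"
    using U_ds_relabel[OF S D iU] by (metis fst_conv snd_conv)
  then obtain q where q: "\<And>\<sigma>. \<sigma> \<in> ?G \<Longrightarrow> fst (q \<sigma>) permutes {1..6}"
    "\<And>\<sigma> x. \<sigma> \<in> ?G \<Longrightarrow> normal_label x \<Longrightarrow> i \<sigma> (place E E' x) = place E E' (relabel (fst (q \<sigma>)) (snd (q \<sigma>)) x)"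
    by metis
  define p where "p \<sigma> = fst (q \<sigma>)" for \<sigma>
  define sw where "sw \<sigma> = snd (q \<sigma>)" for \<sigma>
  define \<psi> :: "('l \<Rightarrow> 'l) \<Rightarrow> 'l" where "\<psi> \<sigma> = (if sw \<sigma> then -1 else 1)" for \<sigma>
  have p: "p \<sigma> permutes {1..6}" if "\<sigma> \<in> ?G" for \<sigma> using q(1)[OF that] by (simp add: p_def)
  have act: "i \<sigma> (place E E' x) = place E E' (relabel (p \<sigma>) (sw \<sigma>) x)" if "\<sigma> \<in> ?G" "normal_label x" for \<sigma> x
    using q(2)[OF that] by (simp add: p_def sw_def)
  have comp: "relabel (p (\<sigma> \<circ> \<tau>)) (sw (\<sigma> \<circ> \<tau>)) x = relabel (p \<sigma>) (sw \<sigma>) (relabel (p \<tau>) (sw \<tau>) x)"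
    if "\<sigma> \<in> ?G" "\<tau> \<in> ?G" "normal_label x" for \<sigma> \<tau> x
  proof -
    have n: "normal_label (relabel (p \<tau>) (sw \<tau>) x)" by (rule normal_label_relabel[OF p[OF that(2)] that(3)])
    have c: "\<sigma> \<circ> \<tau> \<in> ?G" by (rule Gal_comp[OF that(1,2)])
    have "place E E' (relabel (p (\<sigma> \<circ> \<tau>)) (sw (\<sigma> \<circ> \<tau>)) x) = place E E' (relabel (p \<sigma>) (sw \<sigma>) (relabel (p \<tau>) (sw \<tau>) x))"
      using act[OF c that(3)] act[OF that(2,3)] act[OF that(1) n] ihom[OF that(1,2)] by simp
    moreover have "inj_on (place E E') {x. normal_label x}" using place_bij[OF S] by (simp add: bij_betw_def)
    ultimately show ?thesis
      using normal_label_relabel[OF p[OF c] that(3)] normal_label_relabel[OF p[OF that(1)] n] by (simp add: inj_on_def)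
  qed
  have comp_p: "p (\<sigma> \<circ> \<tau>) = p \<sigma> \<circ> p \<tau>" and comp_sw: "sw (\<sigma> \<circ> \<tau>) \<longleftrightarrow> sw \<sigma> \<noteq> sw \<tau>"
    if st: "\<sigma> \<in> ?G" "\<tau> \<in> ?G" for \<sigma> \<tau>
  proof -
    \<comment> \<open>The image of A_m shows both parts of a relabelling: the new index, and whether
      A and B are exchanged.\<close>
    have 1: "p (\<sigma> \<circ> \<tau>) m = p \<sigma> (p \<tau> m) \<and> (sw (\<sigma> \<circ> \<tau>) \<longleftrightarrow> sw \<sigma> \<noteq> sw \<tau>)" if "m \<in> {1..6}" for m
      using comp[OF st, of "LA m"] that by (simp split: if_splits)
    show "sw (\<sigma> \<circ> \<tau>) \<longleftrightarrow> sw \<sigma> \<noteq> sw \<tau>" using 1[of 1] by simp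
    show "p (\<sigma> \<circ> \<tau>) = p \<sigma> \<circ> p \<tau>"
    proof
      fix m
      show "p (\<sigma> \<circ> \<tau>) m = (p \<sigma> \<circ> p \<tau>) m"
      proof (cases "m \<in> {1..6}")
        case True then show ?thesis using 1 by simp
      next
        case False
        then show ?thesis using p[OF Gal_comp[OF st]] p[OF st(1)] p[OF st(2)] by (simp add: permutes_not_in)
      qed
    qed
  qed
  interpret galois_sextic \<iota> p \<psi>
    by unfold_locales (use assms(1) emb fin p comp_p comp_sw in \<open>auto simp: \<psi>_def\<close>)
  have "\<iota> 2 \<noteq> \<iota> 0" unfolding field_embedding_eq_iff[OF emb] by (rule two_neq_0_if_CHAR[OF assms(2)])
  then have two: "(2::'l) \<noteq> 0" by (simp add: field_embedding_simps[OF emb])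
  obtain r s where g: "generic r s"
    and r: "\<And>\<sigma> m. \<sigma> \<in> ?G \<Longrightarrow> m \<in> {1..6} \<Longrightarrow> \<sigma> (r m) = r (p \<sigma> m)"
    and s: "\<And>\<sigma>. \<sigma> \<in> ?G \<Longrightarrow> \<sigma> s = \<psi> \<sigma> * s"
    using exists_generic[OF two] by blast
  have Gemb: "field_embedding \<sigma>" if "\<sigma> \<in> ?G" for \<sigma> using that by (simp add: Gal_carrier)
  have s': "\<sigma> s = (if sw \<sigma> then - s else s)" if "\<sigma> \<in> ?G" for \<sigma> using s[OF that] by (simp add: \<psi>_def)
  have action: "\<sigma> (surface_coeffs r s n) = surface_coeffs r s n" "normal_label x \<Longrightarrow> \<sigma> (slope r s x) = slope r s (relabel (p \<sigma>) (sw \<sigma>) x)"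
    "normal_label x \<Longrightarrow> \<sigma> (offset r s x) = offset r s (relabel (p \<sigma>) (sw \<sigma>) x)" if "\<sigma> \<in> ?G" for \<sigma> n x
    using Galois_action[where \<sigma> = \<sigma> and p = "p \<sigma>" and sw = "sw \<sigma>" and r = r and s = s,
        OF Gemb[OF that] p[OF that] r[OF that] s'[OF that]] by blast+
  \<comment> \<open>Descent: coefficients fixed by the Galois group belong to the base field, so the
    surface is defined there.\<close>
  have "surface_coeffs r s n \<in> range \<iota>" for n
    by (rule fixed_field_of_Gal[OF assms(3,4)]) (rule action(1))
  then have "\<forall>n. \<exists>c. \<iota> c = surface_coeffs r s n" by (metis imageE)
  then obtain k where k: "\<And>n. \<iota> (k n) = surface_coeffs r s n" by metis
  define j where "j = (to_ac :: 'l \<Rightarrow> 'l alg_closure)"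
  have j: "field_embedding j" unfolding j_def field_embedding_def by simp
  have j\<iota>: "field_embedding (j \<circ> \<iota>)" by (rule field_embedding_comp[OF j emb])
  define r' where "r' = j \<circ> r"
  define s1 where "s1 = j s"
  have g': "generic r' s1" unfolding r'_def s1_def by (rule generic_hom[OF j g])
  have k': "(j \<circ> \<iota>) (k n) = surface_coeffs r' s1 n" for n by (simp add: k surface_coeffs_hom[OF j] r'_def s1_def)
  have inf': "infinite (UNIV :: 'l alg_closure set)" by (rule infinite_field_embedding[OF j\<iota> assms(1)])
  define h where "h = inv_into {x. normal_label x} (place E E')"
  note pb = place_bij[OF S]
  have hb: "bij_betw h {1..27} {x. normal_label x}" unfolding h_def by (rule bij_betw_inv_into[OF pb])
  have hn: "normal_label (h n)" and ph: "place E E' (h n) = n" if "n \<in> {1..27}" for n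
    using that hb bij_betw_inv_into_right[OF pb] by (auto simp: h_def bij_betw_def)
  have hp: "h (place E E' x) = x" if "normal_label x" for x
    using bij_betw_inv_into_left[OF pb] that by (simp add: h_def)
  \<comment> \<open>The number n carries the line whose label the given double-six places at n, so
    that the prescribed permutation of the numbers becomes the relabelling realised by the Galois
    group.\<close>
  define \<nu> where "\<nu> n = schlaefli_line r' s1 (h n)" for n
  have \<nu>l: "\<nu> n = line_set (\<lambda>m. j (surface_coeffs r s m)) (j (slope r s (h n))) (j (offset r s (h n)))" for n
    unfolding \<nu>_def r'_def s1_def surface_coeffs_hom[OF j] slope_hom[OF j] offset_hom[OF j] ..
  have num: "line_numbering (j \<circ> \<iota>) (cubic_mp k) \<nu>"
    unfolding line_numbering_def
  proof
    have "bij_betw (schlaefli_line r' s1 \<circ> h) {1..27} (lines_on (j \<circ> \<iota>) (cubic_mp k))"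
      by (rule bij_betw_trans[OF hb lines_on_cubic_mp[OF j\<iota> g' k']])
    then show "bij_betw \<nu> {1..27} (lines_on (j \<circ> \<iota>) (cubic_mp k))" by (simp add: o_def \<nu>_def[abs_def])
    show "pairing_group {1..27} (\<lambda>m n. line_pairing (\<nu> m) (\<nu> n)) = G_max"
      unfolding G_max_def
    proof (rule pairing_group_cong)
      fix m n :: nat assume mn: "m \<in> {1..27}" "n \<in> {1..27}"
      show "line_pairing (\<nu> m) (\<nu> n) = pairing27 m n"
        unfolding \<nu>_def line_pairing_schlaefli[OF g' hn[OF mn(1)] hn[OF mn(2)]]
        using place_pairing[OF S hn[OF mn(1)] hn[OF mn(2)]] ph mn by simp
    qed
  qed
  have def: "defined_over j (\<nu> n)" for n
    unfolding defined_over_def \<nu>l using span_image_line_set[OF j] by metis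
  have conj: "conjugate j \<sigma> (\<nu> n) = \<nu> (i \<sigma> n)" if \<sigma>: "\<sigma> \<in> ?G" and n: "n \<in> {1..27}" for \<sigma> n
  proof -
    have "h (i \<sigma> n) = relabel (p \<sigma>) (sw \<sigma>) (h n)"
      using act[OF \<sigma> hn[OF n]] ph[OF n] hp[OF normal_label_relabel[OF p[OF \<sigma>] hn[OF n]]] by simp
    then show ?thesis
      unfolding \<nu>l conjugate_line_set[OF j Gemb[OF \<sigma>]]
      by (simp add: action(1)[OF \<sigma>] action(2,3)[OF \<sigma> hn[OF n]])
  qed
  have "cubic_surface (cubic_mp k) \<and> nonsingular (j \<circ> \<iota>) (cubic_mp k) \<and>
      (\<exists>\<nu>. line_numbering (j \<circ> \<iota>) (cubic_mp k) \<nu> \<and>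
           (\<forall>n\<in>{1..27}. defined_over j (\<nu> n)) \<and>
           (\<forall>\<sigma>\<in>carrier (Gal \<iota>). \<forall>n\<in>{1..27}. conjugate j \<sigma> (\<nu> n) = \<nu> (i \<sigma> n))) \<and>
      unirational (j \<circ> \<iota>) (cubic_mp k)"
    using cubic_surface_cubic_mp nonsingular_cubic_mp[OF j\<iota> g' k'] num def conj unirational_cubic_mp[OF j\<iota> inf' g' k'] by blast
  then show ?thesis unfolding j_def Let_def by blast
qed

end
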